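(* Let $\sigma>0$ and $\mu>0$, let $(h_0,v_0)\in H^1(0,1)\times L^2(0,1)$, and let $(h,v)$ be a positive classical solution, for $r\in(0,1)$ and $t>0$, of the system $$v_t+vv_r=\sigma\Big(\frac1r\,[r h_r]_r\Big)_r+\frac{4\mu}{h}\left(\Big[\frac hr (rv)_r\Big]_r-\frac{v h_r}{2r}\right),\qquad h_t=-\frac{(rhv)_r}{r},$$ with boundary conditions $h_r(0,t)=h_r(1,t)=v(0,t)=v(1,t)=0$ and initial data $(h_0,v_0)$. Assume that $$h(r,t)\geqslant m>0\qquad\text{for all } r\in(0,1),\ t>0 .$$ Let $\bar h:=2\int_0^1 h_0(r)\,r\,dr$ be the mean of the initial height over the unit disc. Then there exist positive constants $A_i,B_i$, $i=1,2$, depending only on $E(v_0,h_0)$, $S(v_0,h_0)$ and the parameters $\sigma$, $\mu$ and $m$, such that $$\|h(\cdot,t)-\bar h\|_{H^1(B_1(0))}\leqslant A_1e^{-B_1t}\qquad\text{and}\qquad \|v(\cdot,t)\|_{L^2(B_1(0))}\leqslant A_2e^{-B_2t}\qquad\text{for all } t\geqslant0 .$$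
   Context: The system is the radially symmetric reduction of the two-dimensional viscous sheet system on the unit disc $B_1(0)\subset\mathbb{R}^2$; $h$ is the height, $v$ the radial velocity, $\sigma$ the surface tension and $\mu$ the viscosity. Functions of $r\in(0,1)$ are identified with radially symmetric functions on $B_1(0)$ through $r=\sqrt{x^2+y^2}$, and norms over $B_1(0)$ are taken in this sense. The radial energy and entropy functionals are $$E(v,h):=\tfrac12\int_0^1\left[hv^2+\sigma|h_r|^2\right]r\,dr,\qquad S(v,h):=\tfrac12\int_0^1\left\{h\left(v+4\mu\frac{h_r}{h}\right)^2+\sigma|h_r|^2\right\}r\,dr .$$ The boundary conditions imply the mass conservation $\int_0^1 h(r,t)\,r\,dr=\int_0^1 h_0(r)\,r\,dr$ for all $t$. *)

theory Defs
  imports "HOL-Analysis.Analysis"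
begin

definition in_L2 :: "'a::euclidean_space set \<Rightarrow> ('a \<Rightarrow> 'b::euclidean_space) \<Rightarrow> bool" where
  "in_L2 \<Omega> u \<longleftrightarrow> set_borel_measurable lebesgue \<Omega> u \<and>
     set_integrable lebesgue \<Omega> (\<lambda>x. (norm (u x))\<^sup>2)"

definition L2_nrm :: "'a::euclidean_space set \<Rightarrow> ('a \<Rightarrow> 'b::euclidean_space) \<Rightarrow> real" where
  "L2_nrm \<Omega> u = sqrt (LINT x:\<Omega>|lebesgue. (norm (u x))\<^sup>2)"

(* A test function phi of class C^1 with compact support in Omega, together with its
   gradient D. *)
definition test_function ::
  "'a::euclidean_space set \<Rightarrow> ('a \<Rightarrow> real) \<Rightarrow> ('a \<Rightarrow> 'a) \<Rightarrow> bool" where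
  "test_function \<Omega> \<phi> D \<longleftrightarrow> (\<forall>x. GDERIV \<phi> x :> D x) \<and> continuous_on UNIV D \<and>
     (\<exists>K. compact K \<and> K \<subseteq> \<Omega> \<and> (\<forall>x. x \<notin> K \<longrightarrow> \<phi> x = 0))"

(* Vector-valued form of the integration by parts formula, i.e. all partial derivatives at
   once; on the real line g is the weak derivative of u. *)
definition is_weak_gradient ::
  "'a::euclidean_space set \<Rightarrow> ('a \<Rightarrow> real) \<Rightarrow> ('a \<Rightarrow> 'a) \<Rightarrow> bool" where
  "is_weak_gradient \<Omega> u g \<longleftrightarrow> (\<forall>\<phi> D. test_function \<Omega> \<phi> D \<longrightarrow>
     (LINT x:\<Omega>|lebesgue. u x *\<^sub>R D x) = - (LINT x:\<Omega>|lebesgue. \<phi> x *\<^sub>R g x))"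

definition in_H1 :: "'a::euclidean_space set \<Rightarrow> ('a \<Rightarrow> real) \<Rightarrow> bool" where
  "in_H1 \<Omega> u \<longleftrightarrow> in_L2 \<Omega> u \<and> (\<exists>g. in_L2 \<Omega> g \<and> is_weak_gradient \<Omega> u g)"

(* Meaningful when in_H1 \<Omega> u and \<Omega> is open; the weak gradient is then unique up to null sets. *)
definition weak_grad :: "'a::euclidean_space set \<Rightarrow> ('a \<Rightarrow> real) \<Rightarrow> 'a \<Rightarrow> 'a" where
  "weak_grad \<Omega> u = (SOME g. in_L2 \<Omega> g \<and> is_weak_gradient \<Omega> u g)"

definition H1_nrm :: "'a::euclidean_space set \<Rightarrow> ('a \<Rightarrow> real) \<Rightarrow> real" where
  "H1_nrm \<Omega> u = sqrt ((L2_nrm \<Omega> u)\<^sup>2 + (L2_nrm \<Omega> (weak_grad \<Omega> u))\<^sup>2)"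

abbreviation unit_interval :: "real set" where
  "unit_interval \<equiv> {0<..<1}"

abbreviation unit_disc :: "(real^2) set" where
  "unit_disc \<equiv> ball 0 1"

definition radial :: "(real \<Rightarrow> real) \<Rightarrow> real^2 \<Rightarrow> real" where
  "radial u = (\<lambda>x. u (norm x))"

definition energy :: "real \<Rightarrow> (real \<Rightarrow> real) \<Rightarrow> (real \<Rightarrow> real) \<Rightarrow> real" where
  "energy \<sigma> v h = 1/2 * (LINT r:unit_interval|lebesgue.
     (h r * (v r)\<^sup>2 + \<sigma> * (weak_grad unit_interval h r)\<^sup>2) * r)"

definition entropy :: "real \<Rightarrow> real \<Rightarrow> (real \<Rightarrow> real) \<Rightarrow> (real \<Rightarrow> real) \<Rightarrow> real" where
  "entropy \<sigma> \<mu> v h = 1/2 * (LINT r:unit_interval|lebesgue.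
     (h r * (v r + 4 * \<mu> * (weak_grad unit_interval h r / h r))\<^sup>2
       + \<sigma> * (weak_grad unit_interval h r)\<^sup>2) * r)"

definition disc_mean :: "(real \<Rightarrow> real) \<Rightarrow> real" where
  "disc_mean h = 2 * (LINT r:unit_interval|lebesgue. h r * r)"

(* The r-derivatives of u of order at most k exist up to the boundary (one-sided at r = 0, 1)
   and are continuous on [0,1] x (0,\<infinity>). *)
definition C_space :: "nat \<Rightarrow> (real \<Rightarrow> real \<Rightarrow> real) \<Rightarrow> bool" where
  "C_space k u \<longleftrightarrow> (\<exists>D. D 0 = u \<and>
     (\<forall>j<k. \<forall>r\<in>{0..1}. \<forall>t>0.
        ((\<lambda>x. D j x t) has_real_derivative D (Suc j) r t) (at r within {0..1})) \<and>
     (\<forall>j\<le>k. continuous_on ({0..1} \<times> {0<..}) (\<lambda>(r, t). D j r t)))"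

definition momentum_eq ::
  "real \<Rightarrow> real \<Rightarrow> (real \<Rightarrow> real \<Rightarrow> real) \<Rightarrow> (real \<Rightarrow> real \<Rightarrow> real) \<Rightarrow> real \<Rightarrow> real \<Rightarrow> bool" where
  "momentum_eq \<sigma> \<mu> h v r t \<longleftrightarrow>
     deriv (\<lambda>s. v r s) t + v r t * deriv (\<lambda>x. v x t) r =
       \<sigma> * deriv (\<lambda>x. 1 / x * deriv (\<lambda>y. y * deriv (\<lambda>z. h z t) y) x) r
       + 4 * \<mu> / h r t *
         (deriv (\<lambda>x. h x t / x * deriv (\<lambda>y. y * v y t) x) r
          - v r t * deriv (\<lambda>x. h x t) r / (2 * r))"

definition continuity_eq ::
  "(real \<Rightarrow> real \<Rightarrow> real) \<Rightarrow> (real \<Rightarrow> real \<Rightarrow> real) \<Rightarrow> real \<Rightarrow> real \<Rightarrow> bool" where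
  "continuity_eq h v r t \<longleftrightarrow>
     deriv (\<lambda>s. h r s) t = - deriv (\<lambda>x. x * h x t * v x t) r / r"

(* Arguments: h r t and v r t.  The data (h0, v0) are only in H^1 x L^2, so no classical
   regularity is asked at t = 0; instead the solution converges to the data in the norm of
   H^1(0,1) x L^2(0,1) as t tends to 0 from the right. *)
definition positive_classical_solution ::
  "real \<Rightarrow> real \<Rightarrow> (real \<Rightarrow> real) \<Rightarrow> (real \<Rightarrow> real) \<Rightarrow>
   (real \<Rightarrow> real \<Rightarrow> real) \<Rightarrow> (real \<Rightarrow> real \<Rightarrow> real) \<Rightarrow> bool" where
  "positive_classical_solution \<sigma> \<mu> h0 v0 h v \<longleftrightarrow>
     C_space 3 h \<and> C_space 2 v \<and>
     (\<forall>r\<in>unit_interval. \<forall>t>0.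
        (\<lambda>s. h r s) differentiable (at t) \<and> (\<lambda>s. v r s) differentiable (at t) \<and>
        0 < h r t \<and> momentum_eq \<sigma> \<mu> h v r t \<and> continuity_eq h v r t) \<and>
     (\<forall>t>0.
        ((\<lambda>r. h r t) has_real_derivative 0) (at 0 within {0..1}) \<and>
        ((\<lambda>r. h r t) has_real_derivative 0) (at 1 within {0..1}) \<and>
        v 0 t = 0 \<and> v 1 t = 0) \<and>
     (\<forall>r\<in>unit_interval. h r 0 = h0 r \<and> v r 0 = v0 r) \<and>
     ((\<lambda>t. H1_nrm unit_interval (\<lambda>r. h r t - h0 r)) \<longlongrightarrow> 0) (at_right 0) \<and>
     ((\<lambda>t. L2_nrm unit_interval (\<lambda>r. v r t - v0 r)) \<longlongrightarrow> 0) (at_right 0)"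

end

theory Submission
  imports Defs
begin

text \<open>
  Write \<open>E\<close> for the energy, \<open>S\<close> for the entropy and \<open>w = v + 4 \<mu> h\<^sub>r / h\<close> for the effective
  velocity. Testing the momentum equation with \<open>h v r\<close> gives the energy balance
  \<open>E' = - 4 \<mu> \<integral> h (v\<^sup>2/r + v v\<^sub>r + r v\<^sub>r\<^sup>2)\<close>, hence \<open>E' \<le> - 2 \<mu> X\<close> with the viscous dissipation
  \<open>X = \<integral> h (v\<^sup>2/r + r v\<^sub>r\<^sup>2)\<close>. In the equation for \<open>w\<close> all second derivatives of \<open>v\<close> cancel, and
  testing it with \<open>h w r\<close> gives the entropy balance
  \<open>S' = - 4 \<mu> \<sigma> Y + 2 \<mu> \<integral> w h\<^sub>r v\<close> with \<open>Y = \<integral> r (\<Delta>h)\<^sup>2\<close>, where \<open>\<Delta>h = h\<^sub>r\<^sub>r + h\<^sub>r / r\<close>.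

  The entropy alone need not decrease, since the last integral, \<open>2 \<mu> \<integral> h\<^sub>r v\<^sup>2 + 8 \<mu>\<^sup>2 \<integral> v h\<^sub>r\<^sup>2 / h\<close>,
  has no sign. Its first part is at most \<open>2 \<mu> X\<close> after an integration by parts. For the second part,
  \<open>v\<^sup>2 \<le> X / m\<close> pointwise because \<open>v\<close> vanishes at \<open>r = 0\<close>, and \<open>\<integral> h\<^sub>r\<^sup>2 / r \<le> Y\<close>, so that Young's inequality
  bounds it by \<open>2 \<mu> \<sigma> Y + C X\<close>, where \<open>C\<close> is proportional to the initial energy,
  which bounds the later ones. Therefore
  \<open>F = S + K E\<close> satisfies \<open>F' \<le> - 2 \<mu> (X + \<sigma> Y)\<close> for a suitable \<open>K\<close>, and since the boundary conditions also give
  \<open>F \<le> C' (X + Y)\<close>, the functional \<open>F\<close> decays exponentially (lemma \<open>radial_flow.decay\<close>). The energy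
  controls \<open>v\<close> in \<open>L\<^sup>2\<close> because \<open>h \<ge> m\<close>, and \<open>h\<^sub>r\<close> in \<open>L\<^sup>2\<close>; conservation of mass and a Poincare
  inequality (\<open>poincare_unit_disc\<close>) then control \<open>h\<close> minus its mean.

  Three points need care beyond this computation. The quotients \<open>v / r\<close> and \<open>h\<^sub>r / r\<close> are averages
  of \<open>v\<^sub>r\<close> and \<open>h\<^sub>r\<^sub>r\<close> and hence regular at \<open>r = 0\<close>; through them the equations extend the time
  derivatives of \<open>h\<close>, \<open>h\<^sub>r\<close> and \<open>v\<close> continuously to \<open>0 \<le> r \<le> 1\<close>, which justifies differentiating under
  the integrals and integrating by parts. The data are attained only in \<open>H\<^sup>1 \<times> L\<^sup>2\<close>; the estimates for positive
  times start from times tending to \<open>0\<close>, along which \<open>h\<close> converges uniformly by the one-dimensional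
  Sobolev inequality, so that \<open>E\<close> and \<open>S\<close> converge to their initial values (\<open>solution_decay\<close>).
  Finally, the norms are defined through an arbitrarily chosen weak gradient; it is identified with the classical one by the
  fundamental lemma of the calculus of variations (\<open>weak_gradient_unique\<close>), and the norms on the disc are
  weighted integrals over \<open>(0,1)\<close> because the image of Lebesgue measure on the disc under \<open>norm\<close>
  has density \<open>2 \<pi> r\<close> (\<open>distr_norm_unit_disc\<close>).
\<close>

section \<open>Square-integrable functions: Cauchy--Schwarz, Minkowski and limits\<close>

lemma in_L2_iff:
  "in_L2 \<Omega> u \<longleftrightarrow> (\<lambda>x. indicator \<Omega> x *\<^sub>R u x) \<in> borel_measurable lebesgue \<and>
     integrable lebesgue (\<lambda>x. (norm (indicator \<Omega> x *\<^sub>R u x))\<^sup>2)"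
proof -
  have "(\<lambda>x. indicator \<Omega> x *\<^sub>R (norm (u x))\<^sup>2) = (\<lambda>x. (norm (indicator \<Omega> x *\<^sub>R u x))\<^sup>2)"
    by (auto simp: indicator_def)
  then show ?thesis by (simp add: in_L2_def set_borel_measurable_def set_integrable_def)
qed

lemma L2_nrm_power2: "(L2_nrm \<Omega> u)\<^sup>2 = (LINT x:\<Omega>|lebesgue. (norm (u x))\<^sup>2)"
  unfolding L2_nrm_def by (simp add: set_lebesgue_integral_def)

lemma L2_nrm_nonneg: "0 \<le> L2_nrm \<Omega> u"
  by (simp add: L2_nrm_def set_lebesgue_integral_def)

lemma in_L2_cmult: "in_L2 \<Omega> u \<Longrightarrow> in_L2 \<Omega> (\<lambda>x. c *\<^sub>R u x)"
proof -
  assume u: "in_L2 \<Omega> u"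
  have eq: "indicator \<Omega> x *\<^sub>R c *\<^sub>R u x = c *\<^sub>R indicator \<Omega> x *\<^sub>R u x" for x
    by (rule scaleR_left_commute)
  have *: "(\<lambda>x. c *\<^sub>R w x) \<in> borel_measurable lebesgue \<and> integrable lebesgue (\<lambda>x. (norm (c *\<^sub>R w x))\<^sup>2)"
    if "w \<in> borel_measurable lebesgue" "integrable lebesgue (\<lambda>x. (norm (w x))\<^sup>2)" for w :: "'a \<Rightarrow> 'b"
    using that by (simp add: power_mult_distrib)
  show ?thesis using u unfolding in_L2_iff eq by (intro *) auto
qed

lemma L2_nrm_cmult: "L2_nrm \<Omega> (\<lambda>x. c *\<^sub>R u x) = \<bar>c\<bar> * L2_nrm \<Omega> u"
  unfolding L2_nrm_def by (simp add: power_mult_distrib real_sqrt_mult)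

lemma in_L2_add:
  assumes "in_L2 \<Omega> u" "in_L2 \<Omega> v"
  shows "in_L2 \<Omega> (\<lambda>x. u x + v x)"
proof -
  let ?u = "\<lambda>x. indicator \<Omega> x *\<^sub>R u x" and ?v = "\<lambda>x. indicator \<Omega> x *\<^sub>R v x"
  have m: "?u \<in> borel_measurable lebesgue" "?v \<in> borel_measurable lebesgue"
    and i: "integrable lebesgue (\<lambda>x. (norm (?u x))\<^sup>2)" "integrable lebesgue (\<lambda>x. (norm (?v x))\<^sup>2)"
    using assms unfolding in_L2_iff by auto
  have "integrable lebesgue (\<lambda>x. (norm (?u x + ?v x))\<^sup>2)"
  proof (rule Bochner_Integration.integrable_bound)
    show "integrable lebesgue (\<lambda>x. 2 * (norm (?u x))\<^sup>2 + 2 * (norm (?v x))\<^sup>2)" using i by simp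
    have "(norm (?u x + ?v x))\<^sup>2 \<le> 2 * (norm (?u x))\<^sup>2 + 2 * (norm (?v x))\<^sup>2" for x
    proof -
      have "(norm (?u x + ?v x))\<^sup>2 \<le> (norm (?u x) + norm (?v x))\<^sup>2"
        by (intro power_mono norm_triangle_ineq) auto
      also have "\<dots> \<le> 2 * (norm (?u x))\<^sup>2 + 2 * (norm (?v x))\<^sup>2"
        using zero_le_power2[of "norm (?u x) - norm (?v x)"] by (simp add: power2_sum power2_diff)
      finally show ?thesis .
    qed
    then show "AE x in lebesgue. norm ((norm (?u x + ?v x))\<^sup>2) \<le> norm (2 * (norm (?u x))\<^sup>2 + 2 * (norm (?v x))\<^sup>2)"
      by auto
  qed (use m in measurable)
  then show ?thesis using m unfolding in_L2_iff by (simp add: scaleR_add_right)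
qed

lemma in_L2_diff:
  assumes "in_L2 \<Omega> u" "in_L2 \<Omega> v"
  shows "in_L2 \<Omega> (\<lambda>x. u x - v x)"
  using in_L2_add[OF assms(1) in_L2_cmult[OF assms(2), of "-1"]] by simp

lemma in_L2_cong_AE:
  fixes u v :: "'a::euclidean_space \<Rightarrow> 'b::euclidean_space"
  assumes "AE x in lebesgue. x \<in> \<Omega> \<longrightarrow> u x = v x" "in_L2 \<Omega> u"
  shows "in_L2 \<Omega> v" "L2_nrm \<Omega> v = L2_nrm \<Omega> u"
proof -
  let ?u = "\<lambda>x. indicator \<Omega> x *\<^sub>R u x" and ?v = "\<lambda>x. indicator \<Omega> x *\<^sub>R v x"
  have ae: "AE x in lebesgue. ?u x = ?v x" using assms(1) by eventually_elim (auto simp: indicator_def)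
  have m: "?u \<in> borel_measurable lebesgue"
    and i: "integrable lebesgue (\<lambda>x. (norm (?u x))\<^sup>2)"
    using assms unfolding in_L2_iff by auto
  have mv: "?v \<in> borel_measurable lebesgue"
    using borel_measurable_AE[OF m ae] .
  have ae2: "AE x in lebesgue. (norm (?u x))\<^sup>2 = (norm (?v x))\<^sup>2" using ae by (rule eventually_mono) (simp only:)
  have "integrable lebesgue (\<lambda>x. (norm (?v x))\<^sup>2)"
    by (rule integrable_cong_AE_imp[OF i _ ae2]) (use mv in measurable)
  then show "in_L2 \<Omega> v" using mv by (simp add: in_L2_iff)
  have "(LINT x|lebesgue. (norm (?u x))\<^sup>2) = (LINT x|lebesgue. (norm (?v x))\<^sup>2)"
    by (rule integral_cong_AE[OF _ _ ae2]) (use m mv in measurable)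
  moreover have "(\<lambda>x. indicator \<Omega> x *\<^sub>R (norm (w x))\<^sup>2) = (\<lambda>x. (norm (indicator \<Omega> x *\<^sub>R w x))\<^sup>2)" for w :: "'a \<Rightarrow> 'b"
    by (auto simp: indicator_def)
  ultimately show "L2_nrm \<Omega> v = L2_nrm \<Omega> u" unfolding L2_nrm_def set_lebesgue_integral_def by simp
qed

lemma norm_mult_integrable:
  assumes "in_L2 \<Omega> u" "in_L2 \<Omega> v"
  shows "set_integrable lebesgue \<Omega> (\<lambda>x. norm (u x) * norm (v x))"
proof -
  let ?u = "\<lambda>x. indicator \<Omega> x *\<^sub>R u x" and ?v = "\<lambda>x. indicator \<Omega> x *\<^sub>R v x"
  have m: "?u \<in> borel_measurable lebesgue" "?v \<in> borel_measurable lebesgue"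
    and i: "integrable lebesgue (\<lambda>x. (norm (?u x))\<^sup>2)" "integrable lebesgue (\<lambda>x. (norm (?v x))\<^sup>2)"
    using assms unfolding in_L2_iff by auto
  have "integrable lebesgue (\<lambda>x. norm (?u x) * norm (?v x))"
  proof (rule Bochner_Integration.integrable_bound)
    show "integrable lebesgue (\<lambda>x. (norm (?u x))\<^sup>2 + (norm (?v x))\<^sup>2)" using i by simp
    have "norm (?u x) * norm (?v x) \<le> (norm (?u x))\<^sup>2 + (norm (?v x))\<^sup>2" for x
      using sum_squares_bound[of "norm (?u x)" "norm (?v x)"]
        mult_nonneg_nonneg[OF norm_ge_zero[of "?u x"] norm_ge_zero[of "?v x"]] by linarith
    then show "AE x in lebesgue. norm (norm (?u x) * norm (?v x)) \<le> norm ((norm (?u x))\<^sup>2 + (norm (?v x))\<^sup>2)"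
      by auto
  qed (use m in measurable)
  moreover have "(\<lambda>x. norm (?u x) * norm (?v x)) = (\<lambda>x. indicator \<Omega> x *\<^sub>R (norm (u x) * norm (v x)))"
    by (auto simp: indicator_def)
  ultimately show ?thesis by (simp add: set_integrable_def)
qed

lemma scaleR_integrable:
  assumes "in_L2 \<Omega> u" "in_L2 \<Omega> v"
  shows "set_integrable lebesgue \<Omega> (\<lambda>x. u x *\<^sub>R v x)"
proof (rule set_integrable_bound[OF norm_mult_integrable[OF assms]])
  have "(\<lambda>x. (indicator \<Omega> x *\<^sub>R u x) *\<^sub>R (indicator \<Omega> x *\<^sub>R v x)) \<in> borel_measurable lebesgue"
    by (rule borel_measurable_scaleR) (use assms in_L2_iff in blast)+
  moreover have "(\<lambda>x. (indicator \<Omega> x *\<^sub>R u x) *\<^sub>R (indicator \<Omega> x *\<^sub>R v x)) = (\<lambda>x. indicator \<Omega> x *\<^sub>R (u x *\<^sub>R v x))"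
    by (auto simp: indicator_def)
  ultimately show "set_borel_measurable lebesgue \<Omega> (\<lambda>x. u x *\<^sub>R v x)"
    by (simp add: set_borel_measurable_def)
qed auto

text \<open>The quadratic polynomial \<open>t \<mapsto> \<integral> (\<bar>u\<bar> - t \<bar>v\<bar>)\<^sup>2\<close> is nonnegative.\<close>

lemma Cauchy_Schwarz_L2_norms:
  assumes "in_L2 \<Omega> u" "in_L2 \<Omega> v"
  shows "(LINT x:\<Omega>|lebesgue. norm (u x) * norm (v x)) \<le> L2_nrm \<Omega> u * L2_nrm \<Omega> v"
proof -
  define A where "A = L2_nrm \<Omega> u"
  define B where "B = L2_nrm \<Omega> v"
  define I where "I = (LINT x:\<Omega>|lebesgue. norm (u x) * norm (v x))"
  have n: "A \<ge> 0" "B \<ge> 0" unfolding A_def B_def by (auto simp: L2_nrm_nonneg)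
  have i: "set_integrable lebesgue \<Omega> (\<lambda>x. (norm (u x))\<^sup>2)" "set_integrable lebesgue \<Omega> (\<lambda>x. (norm (v x))\<^sup>2)"
    using assms by (auto simp: in_L2_def)
  have q: "2 * t * I \<le> A\<^sup>2 + t\<^sup>2 * B\<^sup>2" for t
  proof -
    have "2 * t * I = (LINT x:\<Omega>|lebesgue. 2 * t * (norm (u x) * norm (v x)))" by (simp add: I_def)
    also have "\<dots> \<le> (LINT x:\<Omega>|lebesgue. (norm (u x))\<^sup>2 + t\<^sup>2 * (norm (v x))\<^sup>2)"
    proof (rule set_integral_mono)
      show "set_integrable lebesgue \<Omega> (\<lambda>x. 2 * t * (norm (u x) * norm (v x)))"
        using norm_mult_integrable[OF assms] by simp
      show "set_integrable lebesgue \<Omega> (\<lambda>x. (norm (u x))\<^sup>2 + t\<^sup>2 * (norm (v x))\<^sup>2)" using i by simp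
      show "2 * t * (norm (u x) * norm (v x)) \<le> (norm (u x))\<^sup>2 + t\<^sup>2 * (norm (v x))\<^sup>2" for x
        using zero_le_power2[of "norm (u x) - t * norm (v x)"] by (simp add: power2_diff power_mult_distrib algebra_simps)
    qed
    also have "\<dots> = A\<^sup>2 + t\<^sup>2 * B\<^sup>2" using i by (simp add: A_def B_def L2_nrm_power2)
    finally show ?thesis .
  qed
  have "I \<le> A * B"
  proof (cases "B = 0")
    case False
    then have B: "B\<^sup>2 > 0" by simp
    have "2 * (I / B\<^sup>2) * I = 2 * (I\<^sup>2 / B\<^sup>2)" "(I / B\<^sup>2)\<^sup>2 * B\<^sup>2 = I\<^sup>2 / B\<^sup>2"
      using B by (simp_all add: power2_eq_square)
    then have "I\<^sup>2 / B\<^sup>2 \<le> A\<^sup>2" using q[of "I / B\<^sup>2"] by linarith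
    then have "I\<^sup>2 \<le> (A * B)\<^sup>2" using B by (simp add: pos_divide_le_eq power_mult_distrib)
    then show ?thesis by (rule power2_le_imp_le) (simp add: n)
  next
    case True
    show ?thesis
    proof (rule ccontr)
      assume "\<not> I \<le> A * B"
      then have I: "I > 0" using True by simp
      have "2 * ((A\<^sup>2 + 1) / I) * I \<le> A\<^sup>2" using q[of "(A\<^sup>2+1)/I"] True by simp
      then have "2 * A\<^sup>2 + 2 \<le> A\<^sup>2" using I by simp
      moreover have "A\<^sup>2 \<ge> 0" by simp
      ultimately show False by (smt (verit))
    qed
  qed
  then show ?thesis by (simp add: A_def B_def I_def)
qed

lemma Cauchy_Schwarz_L2:
  assumes "in_L2 \<Omega> u" "in_L2 \<Omega> v"
  shows "norm (LINT x:\<Omega>|lebesgue. u x *\<^sub>R v x) \<le> L2_nrm \<Omega> u * L2_nrm \<Omega> v"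
proof -
  have "norm (LINT x:\<Omega>|lebesgue. u x *\<^sub>R v x) \<le> (LINT x:\<Omega>|lebesgue. norm (u x *\<^sub>R v x))"
    using scaleR_integrable[OF assms] by (rule set_integral_norm_bound)
  then show ?thesis using Cauchy_Schwarz_L2_norms[OF assms] by simp
qed

lemma L2_nrm_triangle:
  assumes "in_L2 \<Omega> u" "in_L2 \<Omega> v"
  shows "L2_nrm \<Omega> (\<lambda>x. u x + v x) \<le> L2_nrm \<Omega> u + L2_nrm \<Omega> v"
proof (rule power2_le_imp_le)
  have i: "set_integrable lebesgue \<Omega> (\<lambda>x. (norm (u x))\<^sup>2)" "set_integrable lebesgue \<Omega> (\<lambda>x. (norm (v x))\<^sup>2)"
    using assms by (auto simp: in_L2_def)
  note j = norm_mult_integrable[OF assms]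
  have "(L2_nrm \<Omega> (\<lambda>x. u x + v x))\<^sup>2 \<le> (LINT x:\<Omega>|lebesgue. (norm (u x))\<^sup>2 + 2 * (norm (u x) * norm (v x)) + (norm (v x))\<^sup>2)"
    unfolding L2_nrm_power2
  proof (rule set_integral_mono)
    show "set_integrable lebesgue \<Omega> (\<lambda>x. (norm (u x + v x))\<^sup>2)" using in_L2_add[OF assms] by (simp add: in_L2_def)
    show "set_integrable lebesgue \<Omega> (\<lambda>x. (norm (u x))\<^sup>2 + 2 * (norm (u x) * norm (v x)) + (norm (v x))\<^sup>2)"
      using i j by simp
    show "(norm (u x + v x))\<^sup>2 \<le> (norm (u x))\<^sup>2 + 2 * (norm (u x) * norm (v x)) + (norm (v x))\<^sup>2" for x
      using power_mono[OF norm_triangle_ineq[of "u x" "v x"] norm_ge_zero, of 2] by (simp add: power2_sum)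
  qed
  also have "\<dots> = (L2_nrm \<Omega> u)\<^sup>2 + 2 * (LINT x:\<Omega>|lebesgue. norm (u x) * norm (v x)) + (L2_nrm \<Omega> v)\<^sup>2"
    using i j by (simp add: L2_nrm_power2)
  also have "\<dots> \<le> (L2_nrm \<Omega> u + L2_nrm \<Omega> v)\<^sup>2"
    using Cauchy_Schwarz_L2_norms[OF assms] by (simp add: power2_sum)
  finally show "(L2_nrm \<Omega> (\<lambda>x. u x + v x))\<^sup>2 \<le> (L2_nrm \<Omega> u + L2_nrm \<Omega> v)\<^sup>2" .
qed (simp add: L2_nrm_nonneg)

lemma in_L2_bounded_mult:
  assumes a: "set_borel_measurable lebesgue \<Omega> a" and C: "AE x in lebesgue. x \<in> \<Omega> \<longrightarrow> \<bar>a x\<bar> \<le> C" "C \<ge> 0"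
    and u: "in_L2 \<Omega> u"
  shows "in_L2 \<Omega> (\<lambda>x. a x *\<^sub>R u x)" "L2_nrm \<Omega> (\<lambda>x. a x *\<^sub>R u x) \<le> C * L2_nrm \<Omega> u"
proof -
  let ?u = "\<lambda>x. indicator \<Omega> x *\<^sub>R u x" and ?a = "\<lambda>x. indicator \<Omega> x *\<^sub>R a x"
  have m: "?u \<in> borel_measurable lebesgue" "?a \<in> borel_measurable lebesgue"
    and i: "integrable lebesgue (\<lambda>x. (norm (?u x))\<^sup>2)"
    using u a unfolding in_L2_iff set_borel_measurable_def by auto
  have eq: "indicator \<Omega> x *\<^sub>R (a x *\<^sub>R u x) = ?a x *\<^sub>R ?u x" for x by (auto simp: indicator_def)
  have bd: "AE x in lebesgue. (norm (?a x *\<^sub>R ?u x))\<^sup>2 \<le> C\<^sup>2 * (norm (?u x))\<^sup>2"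
    using C(1) by eventually_elim (auto simp: power_mult_distrib indicator_def intro!: mult_right_mono abs_le_square_iff[THEN iffD1])
  have int: "integrable lebesgue (\<lambda>x. (norm (?a x *\<^sub>R ?u x))\<^sup>2)"
  proof (rule Bochner_Integration.integrable_bound)
    show "integrable lebesgue (\<lambda>x. C\<^sup>2 * (norm (?u x))\<^sup>2)" using i by simp
    show "AE x in lebesgue. norm ((norm (?a x *\<^sub>R ?u x))\<^sup>2) \<le> norm (C\<^sup>2 * (norm (?u x))\<^sup>2)"
      using bd by eventually_elim (auto simp: abs_mult)
  qed (use m in measurable)
  then show in1: "in_L2 \<Omega> (\<lambda>x. a x *\<^sub>R u x)"
    unfolding in_L2_iff eq using borel_measurable_scaleR[OF m(2) m(1)] by blast
  have "(LINT x|lebesgue. (norm (?a x *\<^sub>R ?u x))\<^sup>2) \<le> (LINT x|lebesgue. C\<^sup>2 * (norm (?u x))\<^sup>2)"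
    using int i bd by (intro integral_mono_AE) auto
  moreover have "(L2_nrm \<Omega> u)\<^sup>2 = (LINT x|lebesgue. (norm (?u x))\<^sup>2)"
    unfolding L2_nrm_power2 set_lebesgue_integral_def by (intro Bochner_Integration.integral_cong) (auto simp: indicator_def)
  moreover have "(L2_nrm \<Omega> (\<lambda>x. a x *\<^sub>R u x))\<^sup>2 = (LINT x|lebesgue. (norm (?a x *\<^sub>R ?u x))\<^sup>2)"
    unfolding L2_nrm_power2 set_lebesgue_integral_def by (intro Bochner_Integration.integral_cong) (auto simp: indicator_def)
  ultimately have "(L2_nrm \<Omega> (\<lambda>x. a x *\<^sub>R u x))\<^sup>2 \<le> (C * L2_nrm \<Omega> u)\<^sup>2" by (simp add: power_mult_distrib)
  then show "L2_nrm \<Omega> (\<lambda>x. a x *\<^sub>R u x) \<le> C * L2_nrm \<Omega> u"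
    by (rule power2_le_imp_le) (simp add: C L2_nrm_nonneg)
qed

text \<open>Membership of all terms in \<open>L\<^sup>2\<close> is part of the notion, since the value of the norm
  is meaningless without it.\<close>

definition L2_lim :: "'a::euclidean_space set \<Rightarrow> (nat \<Rightarrow> 'a \<Rightarrow> 'b::euclidean_space) \<Rightarrow> ('a \<Rightarrow> 'b) \<Rightarrow> bool" where
  "L2_lim \<Omega> U u \<longleftrightarrow> (\<forall>n. in_L2 \<Omega> (U n)) \<and> in_L2 \<Omega> u \<and> (\<lambda>n. L2_nrm \<Omega> (\<lambda>x. U n x - u x)) \<longlonglongrightarrow> 0"

lemma tendsto_zero_bound:
  assumes "\<And>n. norm (f n) \<le> g n" "g \<longlonglongrightarrow> (0::real)"
  shows "f \<longlonglongrightarrow> 0"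
  using assms by (intro Lim_null_comparison[OF always_eventually, of f g]) auto

lemma L2_lim_nrm:
  assumes "L2_lim \<Omega> U u"
  shows "(\<lambda>n. L2_nrm \<Omega> (U n)) \<longlonglongrightarrow> L2_nrm \<Omega> u"
proof -
  have i: "in_L2 \<Omega> (U n)" "in_L2 \<Omega> u" for n using assms by (auto simp: L2_lim_def)
  have "norm (L2_nrm \<Omega> (U n) - L2_nrm \<Omega> u) \<le> L2_nrm \<Omega> (\<lambda>x. U n x - u x)" for n
    using L2_nrm_triangle[OF in_L2_diff[OF i(1) i(2)] i(2), of n]
      L2_nrm_triangle[OF in_L2_cmult[OF in_L2_diff[OF i(1) i(2)], of "-1"] i(1), of n n]
      L2_nrm_cmult[of \<Omega> "-1" "\<lambda>x. U n x - u x"] by simp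
  moreover have "(\<lambda>n. L2_nrm \<Omega> (\<lambda>x. U n x - u x)) \<longlonglongrightarrow> 0" using assms by (simp add: L2_lim_def)
  ultimately have "(\<lambda>n. L2_nrm \<Omega> (U n) - L2_nrm \<Omega> u) \<longlonglongrightarrow> 0"
    by (rule tendsto_zero_bound)
  then show ?thesis by (simp add: LIM_zero_iff)
qed

lemma L2_lim_add:
  assumes U: "L2_lim \<Omega> U u" and V: "L2_lim \<Omega> V v"
  shows "L2_lim \<Omega> (\<lambda>n x. U n x + V n x) (\<lambda>x. u x + v x)"
proof -
  have i: "in_L2 \<Omega> (U n)" "in_L2 \<Omega> u" "in_L2 \<Omega> (V n)" "in_L2 \<Omega> v" for n using assms by (auto simp: L2_lim_def)
  have "norm (L2_nrm \<Omega> (\<lambda>x. U n x + V n x - (u x + v x))) \<le>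
      L2_nrm \<Omega> (\<lambda>x. U n x - u x) + L2_nrm \<Omega> (\<lambda>x. V n x - v x)" for n
    using L2_nrm_triangle[OF in_L2_diff[OF i(1) i(2)] in_L2_diff[OF i(3) i(4)], of n n]
    by (simp add: L2_nrm_nonneg add_diff_add)
  moreover have "(\<lambda>n. L2_nrm \<Omega> (\<lambda>x. U n x - u x) + L2_nrm \<Omega> (\<lambda>x. V n x - v x)) \<longlonglongrightarrow> 0"
    using assms unfolding L2_lim_def by (intro tendsto_add_zero) auto
  ultimately have "(\<lambda>n. L2_nrm \<Omega> (\<lambda>x. U n x + V n x - (u x + v x))) \<longlonglongrightarrow> 0"
    by (rule tendsto_zero_bound)
  then show ?thesis using i by (auto simp: L2_lim_def intro: in_L2_add)
qed

text \<open>The error splits as \<open>(a\<^sub>n - b) U\<^sub>n + b (U\<^sub>n - u)\<close>, and the norms of the \<open>U\<^sub>n\<close> are bounded.\<close>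

lemma L2_lim_mult:
  assumes U: "L2_lim \<Omega> U u"
    and m: "\<And>n. set_borel_measurable lebesgue \<Omega> (a n)" "set_borel_measurable lebesgue \<Omega> b"
    and e: "\<And>n. AE x in lebesgue. x \<in> \<Omega> \<longrightarrow> \<bar>a n x - b x\<bar> \<le> e n" "e \<longlonglongrightarrow> 0"
    and C: "AE x in lebesgue. x \<in> \<Omega> \<longrightarrow> \<bar>b x\<bar> \<le> C"
  shows "L2_lim \<Omega> (\<lambda>n x. a n x *\<^sub>R U n x) (\<lambda>x. b x *\<^sub>R u x)"
proof -
  define D where "D = \<bar>C\<bar>"
  have D: "AE x in lebesgue. x \<in> \<Omega> \<longrightarrow> \<bar>b x\<bar> \<le> D" "D \<ge> 0" using C unfolding D_def by (auto elim!: eventually_mono)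
  define f where "f n = \<bar>e n\<bar>" for n
  have f: "AE x in lebesgue. x \<in> \<Omega> \<longrightarrow> \<bar>a n x - b x\<bar> \<le> f n" "f n \<ge> 0" for n
    using e(1)[of n] unfolding f_def by (auto elim!: eventually_mono)
  have f0: "f \<longlonglongrightarrow> 0" using e(2) unfolding f_def by (simp add: tendsto_rabs_zero_iff)
  have i: "in_L2 \<Omega> (U n)" "in_L2 \<Omega> u" for n using assms by (auto simp: L2_lim_def)
  have md: "set_borel_measurable lebesgue \<Omega> (\<lambda>x. a n x - b x)" for n
    using m(1)[of n] m(2) unfolding set_borel_measurable_def by (simp add: right_diff_distrib)
  have an: "AE x in lebesgue. x \<in> \<Omega> \<longrightarrow> \<bar>a n x\<bar> \<le> f n + D" for n
    using f(1)[of n] D(1) by eventually_elim auto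
  have i1: "in_L2 \<Omega> (\<lambda>x. a n x *\<^sub>R U n x)" for n
    using in_L2_bounded_mult(1)[OF m(1) an _ i(1)] f(2) D(2) by simp
  have i2: "in_L2 \<Omega> (\<lambda>x. b x *\<^sub>R u x)" using in_L2_bounded_mult(1)[OF m(2) D i(2)] .
  have bd: "L2_nrm \<Omega> (\<lambda>x. a n x *\<^sub>R U n x - b x *\<^sub>R u x) \<le> f n * L2_nrm \<Omega> (U n) + D * L2_nrm \<Omega> (\<lambda>x. U n x - u x)" for n
  proof -
    have "L2_nrm \<Omega> (\<lambda>x. a n x *\<^sub>R U n x - b x *\<^sub>R u x) = L2_nrm \<Omega> (\<lambda>x. (a n x - b x) *\<^sub>R U n x + b x *\<^sub>R (U n x - u x))"
      by (simp add: algebra_simps)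
    also have "\<dots> \<le> L2_nrm \<Omega> (\<lambda>x. (a n x - b x) *\<^sub>R U n x) + L2_nrm \<Omega> (\<lambda>x. b x *\<^sub>R (U n x - u x))"
      by (intro L2_nrm_triangle in_L2_bounded_mult(1)[OF md f i(1)] in_L2_bounded_mult(1)[OF m(2) D in_L2_diff] i)
    also have "\<dots> \<le> f n * L2_nrm \<Omega> (U n) + D * L2_nrm \<Omega> (\<lambda>x. U n x - u x)"
      by (intro add_mono in_L2_bounded_mult(2)[OF md f i(1)] in_L2_bounded_mult(2)[OF m(2) D in_L2_diff] i)
    finally show ?thesis .
  qed
  have "(\<lambda>n. f n * L2_nrm \<Omega> (U n) + D * L2_nrm \<Omega> (\<lambda>x. U n x - u x)) \<longlonglongrightarrow> 0 * L2_nrm \<Omega> u + D * 0"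
    using U by (intro tendsto_add tendsto_mult tendsto_const f0 L2_lim_nrm) (auto simp: L2_lim_def)
  then have "(\<lambda>n. f n * L2_nrm \<Omega> (U n) + D * L2_nrm \<Omega> (\<lambda>x. U n x - u x)) \<longlonglongrightarrow> 0"
    by simp
  moreover have "norm (L2_nrm \<Omega> (\<lambda>x. a n x *\<^sub>R U n x - b x *\<^sub>R u x)) \<le> f n * L2_nrm \<Omega> (U n) + D * L2_nrm \<Omega> (\<lambda>x. U n x - u x)" for n
    using bd[of n] by (simp add: L2_nrm_nonneg)
  ultimately have "(\<lambda>n. L2_nrm \<Omega> (\<lambda>x. a n x *\<^sub>R U n x - b x *\<^sub>R u x)) \<longlonglongrightarrow> 0"
    by (rule tendsto_zero_bound[rotated])
  then show ?thesis using i1 i2 by (simp add: L2_lim_def)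
qed

lemma L2_lim_integral:
  assumes U: "L2_lim \<Omega> U u" and g: "in_L2 \<Omega> g"
  shows "(\<lambda>n. LINT x:\<Omega>|lebesgue. g x *\<^sub>R U n x) \<longlonglongrightarrow> (LINT x:\<Omega>|lebesgue. g x *\<^sub>R u x)"
proof -
  have i: "in_L2 \<Omega> (U n)" "in_L2 \<Omega> u" for n using assms by (auto simp: L2_lim_def)
  have "norm ((LINT x:\<Omega>|lebesgue. g x *\<^sub>R U n x) - (LINT x:\<Omega>|lebesgue. g x *\<^sub>R u x))
      \<le> L2_nrm \<Omega> (\<lambda>x. U n x - u x) * L2_nrm \<Omega> g" for n
    using Cauchy_Schwarz_L2[OF g in_L2_diff[OF i(1) i(2)], of n] scaleR_integrable[OF g i(1)] scaleR_integrable[OF g i(2)]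
    by (simp add: scaleR_diff_right mult.commute L2_nrm_nonneg)
  moreover have "(\<lambda>n. L2_nrm \<Omega> (\<lambda>x. U n x - u x) * L2_nrm \<Omega> g) \<longlonglongrightarrow> 0"
    using U by (intro tendsto_mult_left_zero) (simp add: L2_lim_def)
  ultimately have "(\<lambda>n. (LINT x:\<Omega>|lebesgue. g x *\<^sub>R U n x) - (LINT x:\<Omega>|lebesgue. g x *\<^sub>R u x)) \<longlonglongrightarrow> 0"
    by (rule tendsto_zero_bound)
  then show ?thesis by (simp add: LIM_zero_iff)
qed

lemma L2_lim_integral':
  fixes U :: "nat \<Rightarrow> 'a::euclidean_space \<Rightarrow> real" and g :: "'a \<Rightarrow> 'b::euclidean_space"
  assumes U: "L2_lim \<Omega> U u" and g: "in_L2 \<Omega> g"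
  shows "(\<lambda>n. LINT x:\<Omega>|lebesgue. U n x *\<^sub>R g x) \<longlonglongrightarrow> (LINT x:\<Omega>|lebesgue. u x *\<^sub>R g x)"
proof -
  have i: "in_L2 \<Omega> (U n)" "in_L2 \<Omega> u" for n using assms by (auto simp: L2_lim_def)
  have "norm ((LINT x:\<Omega>|lebesgue. U n x *\<^sub>R g x) - (LINT x:\<Omega>|lebesgue. u x *\<^sub>R g x))
      \<le> L2_nrm \<Omega> (\<lambda>x. U n x - u x) * L2_nrm \<Omega> g" for n
    using Cauchy_Schwarz_L2[OF in_L2_diff[OF i(1) i(2)] g, of n] scaleR_integrable[OF i(1) g] scaleR_integrable[OF i(2) g]
    by (simp add: scaleR_diff_left mult.commute L2_nrm_nonneg)
  moreover have "(\<lambda>n. L2_nrm \<Omega> (\<lambda>x. U n x - u x) * L2_nrm \<Omega> g) \<longlonglongrightarrow> 0"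
    using U by (intro tendsto_mult_left_zero) (simp add: L2_lim_def)
  ultimately have "(\<lambda>n. (LINT x:\<Omega>|lebesgue. U n x *\<^sub>R g x) - (LINT x:\<Omega>|lebesgue. u x *\<^sub>R g x)) \<longlonglongrightarrow> 0"
    by (rule tendsto_zero_bound)
  then show ?thesis by (simp add: LIM_zero_iff)
qed

section \<open>Weak gradients: existence, uniqueness and limits\<close>

lemma gderiv_zero_outside:
  fixes f :: "'a::euclidean_space \<Rightarrow> real"
  assumes d: "\<And>x. GDERIV f x :> D x" and K: "closed K" and f0: "\<And>x. x \<notin> K \<Longrightarrow> f x = 0" and x: "x \<notin> K"
  shows "D x = 0"
proof -
  have "GDERIV (\<lambda>_. 0) x :> D x"
    using d[of x] x K f0 unfolding gderiv_def
    by (elim has_derivative_transform_within_open[of _ _ _ _ "- K"]) auto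
  then have "(\<lambda>h. h \<bullet> D x) = (\<lambda>h. 0)"
    unfolding gderiv_def by (rule has_derivative_unique) simp
  then show ?thesis by (metis inner_eq_zero_iff)
qed

lemma continuous_on_if_gderiv:
  assumes "\<And>x. GDERIV f x :> D x"
  shows "continuous_on S f"
  using assms has_derivative_continuous unfolding gderiv_def
  by (metis continuous_at_imp_continuous_on)

lemma integrable_compact_support:
  fixes D :: "'a::euclidean_space \<Rightarrow> 'b::euclidean_space"
  assumes "continuous_on UNIV D" "compact K" "\<And>x. x \<notin> K \<Longrightarrow> D x = 0"
  shows "integrable lborel D" "D \<in> borel_measurable borel"
proof -
  have "integrable lborel (\<lambda>x. indicator K x *\<^sub>R D x)"
    using assms by (intro borel_integrable_compact) (auto intro: continuous_on_subset)
  also have "(\<lambda>x. indicator K x *\<^sub>R D x) = D" using assms(3) by (auto simp: indicator_def)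
  finally show "integrable lborel D" .
  show "D \<in> borel_measurable borel" using assms(1) by (rule borel_measurable_continuous_onI)
qed

text \<open>By translation invariance the difference quotients of \<open>f\<close> in a coordinate direction
  have integral zero; they converge to the partial derivative and are dominated, which replaces iterated
  integration.\<close>

lemma integral_gradient_compact_support:
  fixes f :: "'a::euclidean_space \<Rightarrow> real"
  assumes d: "\<And>x. GDERIV f x :> D x" and cD: "continuous_on UNIV D"
    and K: "compact K" and f0: "\<And>x. x \<notin> K \<Longrightarrow> f x = 0"
  shows "(LINT x|lebesgue. D x) = 0"
proof -
  have D0: "D x = 0" if "x \<notin> K" for x
    using gderiv_zero_outside[OF d compact_imp_closed[OF K] f0 that] .
  note iD = integrable_compact_support[OF cD K D0]
  have cf: "continuous_on UNIV f" using d by (rule continuous_on_if_gderiv)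
  note if' = integrable_compact_support[OF cf K f0]
  obtain R where R: "R > 0" "K \<subseteq> cball 0 R"
    using bounded_subset_ballD[OF compact_imp_bounded[OF K], of 0] ball_subset_cball by (meson subset_trans)
  obtain M where M: "\<And>x. norm (D x) \<le> M"
  proof -
    have "bounded (D ` K)" using compact_continuous_image[OF continuous_on_subset[OF cD] K] compact_imp_bounded by auto
    then obtain M where "\<And>x. x \<in> K \<Longrightarrow> norm (D x) \<le> M" by (auto simp: bounded_iff)
    then have "norm (D x) \<le> max M 0" for x using D0[of x] by (cases "x \<in> K") (auto simp: max.coboundedI1)
    then show ?thesis using that by blast
  qed
  have "(LINT x|lborel. D x) \<bullet> b = 0" if b: "b \<in> Basis" for b
  proof -
    define g where "g n x = (f (b /\<^sub>R real (Suc n) + x) - f x) * real (Suc n)" for n x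
    have tr: "has_bochner_integral lborel (\<lambda>x. f (c + x)) (LINT x|lborel. f x)" for c
    proof -
      have "integrable lborel (\<lambda>x. f (c + x))"
        using if'(1) integrable_distr_eq[of "(+) c" lborel borel f] if'(2) by (simp add: lborel_distr_plus)
      moreover have "(LINT x|lborel. f (c + x)) = (LINT x|lborel. f x)"
        using integral_distr[of "(+) c" lborel borel f] if'(2) by (simp add: lborel_distr_plus)
      ultimately show ?thesis by (simp add: has_bochner_integral_iff)
    qed
    have g0: "(LINT x|lborel. g n x) = 0" for n
      using tr[of "b /\<^sub>R real (Suc n)"] if'(1) unfolding g_def
      by (simp add: has_bochner_integral_iff)
    have lim: "(\<lambda>n. g n x) \<longlonglongrightarrow> D x \<bullet> b" for x
    proof -
      have d1: "((\<lambda>t. x + t *\<^sub>R b) has_derivative (\<lambda>t. t *\<^sub>R b)) (at 0)"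
        by (auto intro!: derivative_eq_intros)
      have d2: "(f has_derivative (\<lambda>h. h \<bullet> D x)) (at (x + 0 *\<^sub>R b))" using d[of x] by (simp add: gderiv_def)
      have "((\<lambda>t. f (x + t *\<^sub>R b)) has_derivative (\<lambda>t. (t *\<^sub>R b) \<bullet> D x)) (at 0)"
        using has_derivative_compose[OF d1 d2] .
      then have "((\<lambda>t. f (x + t *\<^sub>R b)) has_field_derivative (D x \<bullet> b)) (at 0)"
        by (simp add: has_field_derivative_def inner_commute mult.commute[of _ "_ \<bullet> _"] mult_commute_abs)
      then have "(\<lambda>t. (f (x + t *\<^sub>R b) - f x) / t) \<midarrow>0\<rightarrow> D x \<bullet> b"
        by (simp add: DERIV_def)
      moreover have "filterlim (\<lambda>n. inverse (real (Suc n))) (at 0) sequentially"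
        using LIMSEQ_inverse_real_of_nat by (auto simp: filterlim_at)
      ultimately have "(\<lambda>n. (f (x + inverse (real (Suc n)) *\<^sub>R b) - f x) / inverse (real (Suc n))) \<longlonglongrightarrow> D x \<bullet> b"
        by (rule filterlim_compose)
      then show ?thesis unfolding g_def by (simp add: add.commute divide_inverse)
    qed
    have bnd: "\<bar>g n x\<bar> \<le> M * indicator (cball 0 (R+1)) x" for n x
    proof (cases "x \<in> cball 0 (R+1)")
      case True
      have "norm (f (b /\<^sub>R real (Suc n) + x) - f x) \<le> M * norm ((b /\<^sub>R real (Suc n) + x) - x)"
      proof (rule differentiable_bound[where S=UNIV and f'="\<lambda>x h. h \<bullet> D x"])
        fix x show "onorm (\<lambda>h. h \<bullet> D x) \<le> M"
          by (rule onorm_le) (metis M Cauchy_Schwarz_ineq2 dual_order.trans mult.commute mult_right_mono norm_ge_zero real_norm_def)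
      qed (use d in \<open>auto simp: gderiv_def\<close>)
      also have "\<dots> = M / real (Suc n)" using b by (simp add: divide_inverse)
      finally have "norm (f (b /\<^sub>R real (Suc n) + x) - f x) * real (Suc n) \<le> M / real (Suc n) * real (Suc n)"
        by (rule mult_right_mono) simp
      then show ?thesis using True unfolding g_def by (simp only: abs_mult real_norm_def) simp
    next
      case False
      then have n: "norm x > R + 1" by simp
      have "norm x \<le> norm (b /\<^sub>R real (Suc n) + x) + norm (b /\<^sub>R real (Suc n))"
        by (metis add.commute add_diff_cancel_left' norm_triangle_sub norm_minus_commute)
      moreover have "norm (b /\<^sub>R real (Suc n)) \<le> 1" using b by (simp add: divide_simps)
      ultimately have "norm (b /\<^sub>R real (Suc n) + x) > R" using n by linarith
      then have "b /\<^sub>R real (Suc n) + x \<notin> K" "x \<notin> K" using R n by auto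
      then show ?thesis unfolding g_def using f0 False by simp
    qed
    have "(\<lambda>n. LINT x|lborel. g n x) \<longlonglongrightarrow> (LINT x|lborel. D x \<bullet> b)"
    proof (rule integral_dominated_convergence)
      show "integrable lborel (\<lambda>x. M * indicator (cball 0 (R+1)) x :: real)"
        by (intro integrable_mult_right integrable_real_indicator) (auto intro: emeasure_lborel_cball_finite[unfolded infinity_ennreal_def])
      show "(\<lambda>x. D x \<bullet> b) \<in> borel_measurable lborel" using iD(2) by auto
      show "g n \<in> borel_measurable lborel" for n unfolding g_def using if'(2) by measurable
    qed (use lim bnd in auto)
    then have "(LINT x|lborel. D x \<bullet> b) = 0" using g0 LIMSEQ_const_iff[of 0] by auto
    then show ?thesis using iD(1) by simp
  qed
  then have "(LINT x|lborel. D x) = 0" using euclidean_eqI[of _ 0] by auto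
  then show ?thesis using iD(2) by (simp add: integral_completion)
qed

lemma continuous_extend_zero:
  fixes p :: "'a::euclidean_space \<Rightarrow> 'b::euclidean_space"
  assumes "open \<Omega>" "compact K" "K \<subseteq> \<Omega>" "continuous_on \<Omega> p" "\<And>x. x \<in> \<Omega> \<Longrightarrow> x \<notin> K \<Longrightarrow> p x = 0"
  shows "continuous_on UNIV (\<lambda>x. indicator \<Omega> x *\<^sub>R p x)"
proof -
  have "continuous_on \<Omega> (\<lambda>x. indicator \<Omega> x *\<^sub>R p x)"
    using assms(4) by (rule continuous_on_eq) auto
  moreover have "continuous_on (- K) (\<lambda>x. indicator \<Omega> x *\<^sub>R p x)"
    by (rule continuous_on_eq[OF continuous_on_const[of _ 0]]) (use assms in \<open>auto simp: indicator_def\<close>)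
  moreover have "UNIV = \<Omega> \<union> - K" using assms(3) by auto
  moreover have "open (- K)" using compact_imp_closed[OF assms(2)] by (rule open_Compl)
  ultimately show ?thesis using assms(1) continuous_on_open_Un by metis
qed

lemma set_integrable_continuous_compact_support:
  fixes p :: "'a::euclidean_space \<Rightarrow> 'b::euclidean_space"
  assumes "open \<Omega>" "compact K" "K \<subseteq> \<Omega>" "continuous_on \<Omega> p" "\<And>x. x \<in> \<Omega> \<Longrightarrow> x \<notin> K \<Longrightarrow> p x = 0"
  shows "set_integrable lebesgue \<Omega> p"
proof -
  have "integrable lborel (\<lambda>x. indicator \<Omega> x *\<^sub>R p x)" "(\<lambda>x. indicator \<Omega> x *\<^sub>R p x) \<in> borel_measurable borel"
    using integrable_compact_support[OF continuous_extend_zero[OF assms] assms(2)] assms(3,5) by (auto simp: indicator_def)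
  then show ?thesis unfolding set_integrable_def by (simp add: integrable_completion)
qed

text \<open>The product of \<open>u\<close> and a test function, extended by zero, is a compactly
  supported \<open>C\<^sup>1\<close> function, so its gradient integrates to zero.\<close>

lemma classical_gradient_is_weak:
  fixes u :: "'a::euclidean_space \<Rightarrow> real"
  assumes \<Omega>: "open \<Omega>" and u: "\<And>x. x \<in> \<Omega> \<Longrightarrow> GDERIV u x :> G x" and G: "continuous_on \<Omega> G"
  shows "is_weak_gradient \<Omega> u G"
  unfolding is_weak_gradient_def
proof (intro allI impI)
  fix \<phi> D assume "test_function \<Omega> \<phi> D"
  then obtain K where d: "\<And>x. GDERIV \<phi> x :> D x" and cD: "continuous_on UNIV D"
    and K: "compact K" "K \<subseteq> \<Omega>" and z: "\<And>x. x \<notin> K \<Longrightarrow> \<phi> x = 0" unfolding test_function_def by blast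
  have Dz: "D x = 0" if "x \<notin> K" for x using gderiv_zero_outside[OF d compact_imp_closed[OF K(1)] z that] .
  have cu: "continuous_on \<Omega> u"
    using u has_derivative_continuous unfolding gderiv_def by (metis continuous_at_imp_continuous_on)
  have c\<phi>: "continuous_on \<Omega> \<phi>" using d by (rule continuous_on_if_gderiv)
  have cD': "continuous_on \<Omega> D" using cD by (rule continuous_on_subset) simp
  define f where "f x = indicator \<Omega> x * (u x * \<phi> x)" for x
  define F where "F x = indicator \<Omega> x *\<^sub>R (u x *\<^sub>R D x + \<phi> x *\<^sub>R G x)" for x
  have i1: "set_integrable lebesgue \<Omega> (\<lambda>x. u x *\<^sub>R D x)"
    by (rule set_integrable_continuous_compact_support[OF \<Omega> K]) (use cu cD' Dz in \<open>auto intro!: continuous_intros\<close>)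
  have i2: "set_integrable lebesgue \<Omega> (\<lambda>x. \<phi> x *\<^sub>R G x)"
    by (rule set_integrable_continuous_compact_support[OF \<Omega> K]) (use c\<phi> G z in \<open>auto intro!: continuous_intros\<close>)
  have "GDERIV f x :> F x" for x
  proof (cases "x \<in> \<Omega>")
    case True
    have "GDERIV (\<lambda>x. u x * \<phi> x) x :> u x *\<^sub>R D x + \<phi> x *\<^sub>R G x" using GDERIV_mult[OF u[OF True] d] .
    then have "GDERIV f x :> u x *\<^sub>R D x + \<phi> x *\<^sub>R G x"
      unfolding gderiv_def by (rule has_derivative_transform_within_open[OF _ \<Omega> True]) (simp add: f_def)
    then show ?thesis using True by (simp add: F_def)
  next
    case False
    then have x: "x \<in> - K" using K by auto
    have "GDERIV (\<lambda>_. 0::real) x :> 0" by (rule GDERIV_const)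
    then have "GDERIV f x :> 0"
      unfolding gderiv_def by (rule has_derivative_transform_within_open[OF _ _ x])
        (use compact_imp_closed[OF K(1)] z in \<open>auto simp: f_def\<close>)
    then show ?thesis using False by (simp add: F_def)
  qed
  moreover have "continuous_on UNIV F"
    unfolding F_def by (rule continuous_extend_zero[OF \<Omega> K]) (use cu cD' c\<phi> G Dz z in \<open>auto intro!: continuous_intros\<close>)
  moreover have "f x = 0" if "x \<notin> K" for x using z[OF that] by (simp add: f_def)
  ultimately have "(LINT x|lebesgue. F x) = 0" using K(1) by (intro integral_gradient_compact_support[of f F K]) auto
  then have "(LINT x:\<Omega>|lebesgue. u x *\<^sub>R D x + \<phi> x *\<^sub>R G x) = 0" unfolding F_def set_lebesgue_integral_def .
  then show "(LINT x:\<Omega>|lebesgue. u x *\<^sub>R D x) = - (LINT x:\<Omega>|lebesgue. \<phi> x *\<^sub>R G x)"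
    using i1 i2 by (simp add: eq_neg_iff_add_eq_0)
qed

lemma set_integrable_continuous_bounded:
  fixes p :: "'a::euclidean_space \<Rightarrow> 'b::euclidean_space"
  assumes "open \<Omega>" "bounded \<Omega>" "continuous_on \<Omega> p" "\<And>x. x \<in> \<Omega> \<Longrightarrow> norm (p x) \<le> C"
  shows "set_integrable lebesgue \<Omega> p" "set_borel_measurable lebesgue \<Omega> p"
proof -
  show m: "set_borel_measurable lebesgue \<Omega> p"
    unfolding set_borel_measurable_def using assms
    by (intro measurable_completion[of _ lborel]) (simp add: borel_measurable_continuous_on_indicator)
  have "set_integrable lebesgue \<Omega> (\<lambda>_. C)"
  proof -
    have "\<Omega> \<in> lmeasurable" using assms(1,2) by (intro bounded_set_imp_lmeasurable) auto
    then have "integrable lebesgue (indicator \<Omega> :: 'a \<Rightarrow> real)"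
      by (intro integrable_real_indicator) (auto simp: fmeasurable_def)
    then show ?thesis unfolding set_integrable_def by (rule integrable_scaleR_left)
  qed
  then show "set_integrable lebesgue \<Omega> p"
    by (rule set_integrable_bound[OF _ m]) (use assms(4) in \<open>auto intro!: AE_I2 order_trans[OF _ abs_ge_self]\<close>)
qed

lemma in_L2_continuous_bounded:
  fixes p :: "'a::euclidean_space \<Rightarrow> 'b::euclidean_space"
  assumes "open \<Omega>" "bounded \<Omega>" "continuous_on \<Omega> p" "\<And>x. x \<in> \<Omega> \<Longrightarrow> norm (p x) \<le> C"
  shows "in_L2 \<Omega> p"
  unfolding in_L2_def
proof
  show "set_borel_measurable lebesgue \<Omega> p" using set_integrable_continuous_bounded(2)[OF assms] .
  show "set_integrable lebesgue \<Omega> (\<lambda>x. (norm (p x))\<^sup>2)"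
    by (rule set_integrable_continuous_bounded[of _ _ "C\<^sup>2"]) (use assms in \<open>auto intro!: continuous_intros power_mono\<close>)
qed

definition C1_gradient :: "('a::euclidean_space \<Rightarrow> real) \<Rightarrow> ('a \<Rightarrow> 'a) \<Rightarrow> bool" where
  "C1_gradient f D \<longleftrightarrow> (\<forall>x. GDERIV f x :> D x) \<and> continuous_on UNIV D"

lemma C1_gradient_continuous: "C1_gradient f D \<Longrightarrow> continuous_on S f"
  unfolding C1_gradient_def using continuous_on_if_gderiv by blast

lemma C1_gradient_mult:
  assumes "C1_gradient f D" "C1_gradient g E"
  shows "C1_gradient (\<lambda>x. f x * g x) (\<lambda>x. f x *\<^sub>R E x + g x *\<^sub>R D x)"
  using assms C1_gradient_continuous[OF assms(1)] C1_gradient_continuous[OF assms(2)]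
  unfolding C1_gradient_def by (auto intro!: GDERIV_mult continuous_intros)

lemma C1_gradient_compose:
  assumes "C1_gradient f D" "\<And>s. (p has_real_derivative p' s) (at s)" "continuous_on UNIV p'"
  shows "C1_gradient (\<lambda>x. p (f x)) (\<lambda>x. p' (f x) *\<^sub>R D x)"
  using assms(1) GDERIV_DERIV_compose[OF _ assms(2), of f]
    continuous_on_compose2[OF assms(3) C1_gradient_continuous[OF assms(1), of UNIV]]
  unfolding C1_gradient_def by (auto intro!: continuous_intros)

text \<open>The square of the positive part is the simplest \<open>C\<^sup>1\<close> function that is positive exactly on
  \<open>(0,\<infinity>)\<close>.\<close>

definition pos_sq :: "real \<Rightarrow> real" where "pos_sq s = (max 0 s)\<^sup>2"

lemma pos_sq_deriv: "(pos_sq has_real_derivative 2 * max 0 s) (at s)"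
proof -
  consider "s > 0" | "s < 0" | "s = 0" by linarith
  then show ?thesis
  proof cases
    case 1
    have "((\<lambda>s. s\<^sup>2) has_real_derivative 2 * s) (at s)" by (auto intro!: derivative_eq_intros)
    then have "(pos_sq has_real_derivative 2 * s) (at s)"
      by (rule has_field_derivative_transform_within_open[where S="{0<..}"]) (use 1 in \<open>auto simp: pos_sq_def\<close>)
    then show ?thesis using 1 by simp
  next
    case 2
    have "((\<lambda>s. 0) has_real_derivative 0) (at s)" by simp
    then have "(pos_sq has_real_derivative 0) (at s)"
      by (rule has_field_derivative_transform_within_open[where S="{..<0}"]) (use 2 in \<open>auto simp: pos_sq_def\<close>)
    then show ?thesis using 2 by simp
  next
    case 3
    have "(\<lambda>h. (pos_sq (0 + h) - pos_sq 0) / h) \<midarrow>0\<rightarrow> 0"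
    proof (rule Lim_null_comparison)
      have "norm ((pos_sq (0 + h) - pos_sq 0) / h) \<le> \<bar>h\<bar>" for h
        by (auto simp: pos_sq_def max_def power2_eq_square abs_mult)
      then show "\<forall>\<^sub>F h in at 0. norm ((pos_sq (0 + h) - pos_sq 0) / h) \<le> \<bar>h\<bar>" by simp
      show "(\<lambda>h::real. \<bar>h\<bar>) \<midarrow>0\<rightarrow> 0" by (rule tendsto_rabs_zero) simp
    qed
    then show ?thesis using 3 by (simp add: DERIV_def)
  qed
qed

lemma pos_sq_simps: "pos_sq s \<ge> 0" "pos_sq s > 0 \<longleftrightarrow> s > 0" "\<not> pos_sq s < 0"
  by (auto simp: pos_sq_def)

lemma C1_gradient_pos_sq:
  assumes "C1_gradient f D"
  shows "C1_gradient (\<lambda>x. pos_sq (f x)) (\<lambda>x. (2 * max 0 (f x)) *\<^sub>R D x)"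
  by (rule C1_gradient_compose[OF assms pos_sq_deriv]) (intro continuous_intros)

definition smooth_step :: "nat \<Rightarrow> real \<Rightarrow> real" where
  "smooth_step k s = real k * pos_sq s / (1 + real k * pos_sq s)"

lemma smooth_step_bounds: "0 \<le> smooth_step k s" "smooth_step k s \<le> 1"
  using mult_nonneg_nonneg[OF of_nat_0_le_iff[of k] pos_sq_simps(1)[of s]] by (auto simp: smooth_step_def divide_simps)

lemma smooth_step_lim: "(\<lambda>k. smooth_step k s) \<longlonglongrightarrow> indicator {0<..} s"
proof (cases "s > 0")
  case True
  then have p: "pos_sq s > 0" by (simp add: pos_sq_simps)
  have "(\<lambda>k. 1 - inverse (1 + real k * pos_sq s)) \<longlonglongrightarrow> 1 - 0"
    by (intro tendsto_intros tendsto_inverse_0_at_top filterlim_tendsto_add_at_top[OF tendsto_const]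
        filterlim_at_top_mult_tendsto_pos[OF tendsto_const p] filterlim_real_sequentially)
  moreover have "1 - inverse (1 + real k * pos_sq s) = smooth_step k s" for k
    using mult_nonneg_nonneg[OF of_nat_0_le_iff[of k] pos_sq_simps(1)[of s]] by (simp add: smooth_step_def field_simps)
  ultimately show ?thesis using True by simp
next
  case False
  then show ?thesis by (simp add: smooth_step_def pos_sq_def)
qed

lemma C1_gradient_smooth_step:
  assumes "C1_gradient f D"
  shows "\<exists>E. C1_gradient (\<lambda>x. smooth_step k (f x)) E"
proof -
  have nz: "1 + real k * pos_sq s \<noteq> 0" for s
    using mult_nonneg_nonneg[OF of_nat_0_le_iff[of k] pos_sq_simps(1)[of s]] by linarith
  have "(smooth_step k has_real_derivative (real k * (2 * max 0 s)) / (1 + real k * pos_sq s)\<^sup>2) (at s)" for s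
    unfolding smooth_step_def using nz[of s]
    by (auto intro!: derivative_eq_intros pos_sq_deriv simp: power2_eq_square field_simps)
  moreover have "continuous_on UNIV (\<lambda>s. (real k * (2 * max 0 s)) / (1 + real k * pos_sq s)\<^sup>2)"
    using nz by (intro continuous_intros DERIV_continuous_on[OF DERIV_subset[OF pos_sq_deriv]]) auto
  ultimately have "C1_gradient (\<lambda>x. smooth_step k (f x)) (\<lambda>x. ((real k * (2 * max 0 (f x))) / (1 + real k * pos_sq (f x))\<^sup>2) *\<^sub>R D x)"
    by (rule C1_gradient_compose[OF assms])
  then show ?thesis by blast
qed

text \<open>The positivity sets of \<open>C\<^sup>1\<close> functions are stable under intersection and
  generate the Borel sets, and their indicators are bounded pointwise limits of \<open>C\<^sup>1\<close>
  functions; this replaces mollification.\<close>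

lemma AE_zero_if_C1_orthogonal:
  fixes G :: "'a::euclidean_space \<Rightarrow> real"
  assumes G: "integrable lborel G"
    and orth: "\<And>f D. C1_gradient f D \<Longrightarrow> bounded (range f) \<Longrightarrow> (LINT x|lborel. f x * G x) = 0"
  shows "AE x in lborel. G x = 0"
proof -
  define \<A> :: "'a set set" where "\<A> = {{x. f x > 0} |f. \<exists>D. C1_gradient f D}"
  have stable: "Int_stable \<A>"
  proof (rule Int_stableI)
    fix A B assume "A \<in> \<A>" "B \<in> \<A>"
    then obtain f D g E where f: "A = {x. f x > 0}" "C1_gradient f D" and g: "B = {x. g x > 0}" "C1_gradient g E"
      unfolding \<A>_def by blast
    have "A \<inter> B = {x. pos_sq (f x) * pos_sq (g x) > 0}"
      unfolding f(1) g(1) by (auto simp: zero_less_mult_iff pos_sq_simps)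
    moreover have "\<exists>D. C1_gradient (\<lambda>x. pos_sq (f x) * pos_sq (g x)) D"
      using C1_gradient_mult[OF C1_gradient_pos_sq[OF f(2)] C1_gradient_pos_sq[OF g(2)]] by blast
    ultimately show "A \<inter> B \<in> \<A>" unfolding \<A>_def
      by (intro CollectI exI[of _ "\<lambda>x. pos_sq (f x) * pos_sq (g x)"] conjI)
  qed
  have gen: "sigma_sets UNIV \<A> = sets borel"
  proof
    show "sigma_sets UNIV \<A> \<subseteq> sets borel"
    proof (rule sets.sigma_sets_subset[of _ borel, simplified])
      show "\<A> \<subseteq> sets borel"
        unfolding \<A>_def using C1_gradient_continuous[of _ _ UNIV]
        by (auto intro!: borel_open open_Collect_less[of "\<lambda>_. 0"])
    qed
    have "((\<lambda> (a, i). {x::'a. a < x \<bullet> i}) ` (UNIV \<times> Basis)) \<subseteq> \<A>"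
    proof (clarsimp simp: \<A>_def)
      fix a and i :: 'a
      assume "i \<in> Basis"
      have "GDERIV (\<lambda>x. x \<bullet> i - a) x :> i" for x
        unfolding gderiv_def by (auto intro!: derivative_eq_intros)
      then have "C1_gradient (\<lambda>x. x \<bullet> i - a) (\<lambda>_. i)" by (simp add: C1_gradient_def)
      moreover have "{x. a < x \<bullet> i} = {x. 0 < x \<bullet> i - a}" by auto
      ultimately show "\<exists>f. {x. a < x \<bullet> i} = {x. 0 < f x} \<and> Ex (C1_gradient f)"
        by (intro exI[of _ "\<lambda>x. x \<bullet> i - a"] conjI exI[of _ "\<lambda>_. i"])
    qed
    then show "sets borel \<subseteq> sigma_sets UNIV \<A>"
      by (subst borel_eq_halfspace_greater) (simp add: sigma_sets_mono')
  qed
  have meas: "G \<in> borel_measurable borel" using G by auto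
  have tot: "(LINT x|lborel. G x) = 0"
  proof -
    have "C1_gradient (\<lambda>_::'a. 1) (\<lambda>_. 0)" by (simp add: C1_gradient_def GDERIV_const)
    then show ?thesis using orth[of "\<lambda>_. 1" "\<lambda>_. 0"] by simp
  qed
  have si: "set_integrable lborel A G" if "A \<in> sets borel" for A
    unfolding set_integrable_def using that G by (intro integrable_mult_indicator) auto
  have sub: "\<A> \<subseteq> Pow UNIV" by simp
  have key: "(LINT x:A|lborel. G x) = 0" if "A \<in> sigma_sets UNIV \<A>" for A
    using stable sub that
  proof (induction rule: sigma_sets_induct_disjoint)
    case (basic A)
    then obtain f D where f: "A = {x. f x > 0}" "C1_gradient f D" unfolding \<A>_def by blast
    have "(\<lambda>k. LINT x|lborel. smooth_step k (f x) * G x) \<longlonglongrightarrow> (LINT x|lborel. indicator {0<..} (f x) * G x)"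
    proof (rule integral_dominated_convergence[where w="\<lambda>x. norm (G x)"])
      have [measurable]: "f \<in> borel_measurable borel"
        using C1_gradient_continuous[OF f(2)] by (rule borel_measurable_continuous_onI)
      note [measurable] = meas
      show "(\<lambda>x. indicator {0<..} (f x) * G x) \<in> borel_measurable lborel" by measurable
      show "(\<lambda>x. smooth_step k (f x) * G x) \<in> borel_measurable lborel" for k unfolding smooth_step_def pos_sq_def by measurable
      show "AE x in lborel. (\<lambda>k. smooth_step k (f x) * G x) \<longlonglongrightarrow> indicator {0<..} (f x) * G x"
        by (intro AE_I2 tendsto_mult smooth_step_lim tendsto_const)
      show "AE x in lborel. norm (smooth_step k (f x) * G x) \<le> norm (G x)" for k
        using smooth_step_bounds by (intro AE_I2) (auto simp: abs_mult intro!: mult_left_le_one_le)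
    qed (use G in auto)
    moreover have "(LINT x|lborel. smooth_step k (f x) * G x) = 0" for k
    proof -
      obtain E where "C1_gradient (\<lambda>x. smooth_step k (f x)) E" using C1_gradient_smooth_step[OF f(2)] by blast
      moreover have "bounded (range (\<lambda>x. smooth_step k (f x)))" using smooth_step_bounds by (intro boundedI[of _ 1]) auto
      ultimately show ?thesis by (rule orth)
    qed
    ultimately have "(LINT x|lborel. indicator {0<..} (f x) * G x) = 0" by (simp add: LIMSEQ_const_iff)
    moreover have "(\<lambda>x. indicator {0<..} (f x) * G x) = (\<lambda>x. indicator A x *\<^sub>R G x)" by (auto simp: f(1) indicator_def)
    ultimately show ?case by (simp add: set_lebesgue_integral_def)
  next
    case empty
    then show ?case by (simp add: set_lebesgue_integral_def)
  next
    case (compl A)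
    then have A: "A \<in> sets lborel" by (simp add: gen)
    have "(LINT x:(UNIV - A)|lborel. G x) + (LINT x:A|lborel. G x) = (LINT x:UNIV|lborel. G x)"
      using A si by (subst set_integral_Un[symmetric]) (auto intro!: si)
    then show ?case using compl(2) tot by (simp add: set_lebesgue_integral_def)
  next
    case (union A)
    then have "A i \<in> sets lborel" for i by (auto simp: gen)
    then have "(LINT x:(\<Union>i. A i)|lborel. G x) = (\<Sum>i. (LINT x:(A i)|lborel. G x))"
      using union(1) G by (intro lebesgue_integral_countable_add)
        (auto simp: disjoint_family_on_def intro!: si)
    then show ?case using union(3) by simp
  qed
  show ?thesis
    by (rule density_unique_real[OF G integrable_zero]) (use key gen in \<open>simp add: set_lebesgue_integral_def\<close>)
qed

text \<open>The fundamental lemma of the calculus of variations. On a small ball \<open>g\<close> is multiplied by a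
  cutoff \<open>\<eta>\<close> that is positive there; products of \<open>\<eta>\<close> with arbitrary \<open>C\<^sup>1\<close> functions are test
  functions, so the preceding lemma applies to the components of \<open>\<eta> g\<close>. Countably many balls cover the
  open set.\<close>

lemma AE_zero_if_weakly_zero:
  fixes g :: "'a::euclidean_space \<Rightarrow> 'b::euclidean_space"
  assumes \<Omega>: "open \<Omega>" and g: "in_L2 \<Omega> g"
    and orth: "\<And>\<phi> D. test_function \<Omega> \<phi> D \<Longrightarrow> (LINT x:\<Omega>|lebesgue. \<phi> x *\<^sub>R g x) = 0"
  shows "AE x in lebesgue. x \<in> \<Omega> \<longrightarrow> g x = 0"
proof -
  have local0: "AE x in lebesgue. x \<in> ball c R \<longrightarrow> g x \<bullet> b = 0"
    if cR: "cball c R \<subseteq> \<Omega>" and b: "b \<in> Basis" for c R b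
  proof -
    define \<eta> where "\<eta> x = pos_sq (R\<^sup>2 - (x - c) \<bullet> (x - c))" for x
    have "C1_gradient (\<lambda>x. R\<^sup>2 - (x - c) \<bullet> (x - c)) (\<lambda>x. - 2 *\<^sub>R (x - c))"
      unfolding C1_gradient_def gderiv_def
      by (auto intro!: derivative_eq_intros continuous_intros simp: inner_commute algebra_simps)
    note \<eta> = C1_gradient_pos_sq[OF this, folded \<eta>_def]
    have \<eta>0: "\<eta> x = 0" if "x \<notin> cball c R" "R > 0" for x
    proof -
      have "R\<^sup>2 \<le> (norm (x - c))\<^sup>2" using that by (intro power_mono) (auto simp: dist_norm norm_minus_commute)
      then show ?thesis unfolding \<eta>_def pos_sq_def by (simp add: power2_norm_eq_inner)
    qed
    have \<eta>1: "\<eta> x \<noteq> 0" if "x \<in> ball c R" for x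
    proof -
      have "(norm (x - c))\<^sup>2 < R\<^sup>2" using that by (intro power_strict_mono) (auto simp: dist_norm norm_minus_commute)
      then have "\<eta> x > 0" unfolding \<eta>_def pos_sq_simps by (simp add: power2_norm_eq_inner)
      then show ?thesis by simp
    qed
    show ?thesis
    proof (cases "R > 0")
      case R: True
      define G0 where "G0 x = indicator \<Omega> x *\<^sub>R (\<eta> x *\<^sub>R (g x \<bullet> b))" for x
      have c\<eta>: "continuous_on S \<eta>" for S using C1_gradient_continuous[OF \<eta>] .
      have tst: "test_function \<Omega> (\<lambda>x. f x * \<eta> x) (\<lambda>x. f x *\<^sub>R (2 * max 0 (R\<^sup>2 - (x - c) \<bullet> (x - c))) *\<^sub>R (- 2 *\<^sub>R (x - c)) + \<eta> x *\<^sub>R D x)"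
        if "C1_gradient f D" for f D
        using C1_gradient_mult[OF that \<eta>] cR \<eta>0 R unfolding test_function_def C1_gradient_def
        by (intro conjI exI[of _ "cball c R"]) auto
      have "set_integrable lebesgue \<Omega> (\<lambda>x. (\<eta> x)\<^sup>2)"
        by (rule set_integrable_continuous_compact_support[OF \<Omega> compact_cball cR])
           (use \<eta>0 R c\<eta> in \<open>auto intro!: continuous_intros\<close>)
      then have L\<eta>: "in_L2 \<Omega> \<eta>"
        unfolding in_L2_def using \<Omega> c\<eta>
        by (auto simp: set_borel_measurable_def intro!: measurable_completion borel_measurable_continuous_on_indicator[of \<Omega> \<eta>, simplified])
      have i1: "set_integrable lebesgue \<Omega> (\<lambda>x. \<eta> x *\<^sub>R g x)" using scaleR_integrable[OF L\<eta> g] .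
      have iG0: "integrable lebesgue G0"
      proof -
        have "integrable lebesgue (\<lambda>x. (indicator \<Omega> x *\<^sub>R \<eta> x *\<^sub>R g x) \<bullet> b)"
          using i1 unfolding set_integrable_def by (rule integrable_inner_left)
        then show ?thesis unfolding G0_def by (simp add: mult.assoc)
      qed
      \<comment> \<open>The preceding lemma concerns Borel functions, whereas \<open>G0\<close> is only Lebesgue measurable.\<close>
      obtain G' where G': "G' \<in> borel_measurable lborel" "AE x in lborel. G0 x = G' x"
        using completion_ex_borel_measurable_real[OF borel_measurable_integrable[OF iG0]] by blast
      have ae: "AE x in lebesgue. G0 x = G' x" using G'(2) by (rule AE_completion)
      have iG': "integrable lborel G'"
      proof -
        have "integrable lebesgue G'"
          by (rule integrable_cong_AE_imp[OF iG0 measurable_completion[OF G'(1)] ae])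
        then show ?thesis using G'(1) by (simp add: integrable_completion)
      qed
      have "AE x in lborel. G' x = 0"
      proof (rule AE_zero_if_C1_orthogonal[OF iG'])
        fix f :: "'a \<Rightarrow> real" and D assume f: "C1_gradient f D" "bounded (range f)"
        have [measurable]: "f \<in> borel_measurable lborel"
          using C1_gradient_continuous[OF f(1)] by (simp add: borel_measurable_continuous_onI)
        note [measurable] = G'(1)
        have fb: "set_borel_measurable lebesgue \<Omega> f"
          using \<Omega> C1_gradient_continuous[OF f(1), of \<Omega>]
          by (auto simp: set_borel_measurable_def intro!: measurable_completion borel_measurable_continuous_on_indicator[of \<Omega> f, simplified])
        obtain C where C: "\<And>x. \<bar>f x\<bar> \<le> C" using f(2) by (auto simp: bounded_iff)
        have "C \<ge> 0" using C[of c] by linarith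
        then have Lf: "in_L2 \<Omega> (\<lambda>x. f x *\<^sub>R \<eta> x)"
          using C by (intro in_L2_bounded_mult(1)[OF fb _ _ L\<eta>]) auto
        have "(LINT x|lborel. f x * G' x) = (LINT x|lebesgue. f x * G' x)"
          by (rule integral_completion[symmetric]) simp
        also have "\<dots> = (LINT x|lebesgue. f x * G0 x)"
        proof (rule integral_cong_AE)
          have "f \<in> borel_measurable lebesgue" "G' \<in> borel_measurable lebesgue"
            by (auto intro: measurable_completion)
          then show "(\<lambda>x. f x * G' x) \<in> borel_measurable lebesgue" "(\<lambda>x. f x * G0 x) \<in> borel_measurable lebesgue"
            using borel_measurable_integrable[OF iG0] by auto
          show "AE x in lebesgue. f x * G' x = f x * G0 x" using ae by eventually_elim simp
        qed
        also have "\<dots> = (LINT x:\<Omega>|lebesgue. (f x * \<eta> x) *\<^sub>R g x) \<bullet> b"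
        proof -
          have "(LINT x|lebesgue. indicator \<Omega> x *\<^sub>R (f x * \<eta> x) *\<^sub>R g x) \<bullet> b = (LINT x|lebesgue. (indicator \<Omega> x *\<^sub>R (f x * \<eta> x) *\<^sub>R g x) \<bullet> b)"
            using scaleR_integrable[OF Lf g] unfolding set_integrable_def by (intro integral_inner_left[symmetric]) simp
          then show ?thesis unfolding set_lebesgue_integral_def G0_def by (simp add: mult_ac)
        qed
        also have "\<dots> = 0" using orth[OF tst[OF f(1)]] by simp
        finally show "(LINT x|lborel. f x * G' x) = 0" .
      qed
      then have "AE x in lebesgue. G' x = 0" by (rule AE_completion)
      with ae show ?thesis
      proof eventually_elim
        case (elim x)
        show ?case
        proof
          assume x: "x \<in> ball c R"
          then have "x \<in> \<Omega>" using cR ball_subset_cball by blast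
          then show "g x \<bullet> b = 0" using elim \<eta>1[OF x] by (simp add: G0_def)
        qed
      qed
    next
      case False
      then have "ball c R = {}" by simp
      then show ?thesis by (simp only: empty_iff) simp
    qed
  qed
  have loc2: "AE x in lebesgue. x \<in> ball c R \<longrightarrow> g x = 0" if "cball c R \<subseteq> \<Omega>" for c R
  proof -
    have "AE x in lebesgue. \<forall>b\<in>Basis. x \<in> ball c R \<longrightarrow> g x \<bullet> b = 0"
      using local0[OF that] by (intro AE_finite_allI) auto
    then show ?thesis by eventually_elim (auto intro: euclidean_eqI)
  qed
  obtain \<F> where \<F>: "\<F> \<subseteq> {ball c R |c R. cball c R \<subseteq> \<Omega>}" "countable \<F>" "\<Union>\<F> = \<Union>{ball c R |c R. cball c R \<subseteq> \<Omega>}"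
    using Lindelof[of "{ball c R |c R. cball c R \<subseteq> \<Omega>}"] by auto
  have "AE x in lebesgue. \<forall>B\<in>\<F>. x \<in> B \<longrightarrow> g x = 0"
    using \<F>(1,2) loc2 by (subst AE_ball_countable) auto
  then show ?thesis
  proof eventually_elim
    case (elim x)
    show ?case
    proof
      assume "x \<in> \<Omega>"
      then obtain e where "e > 0" "cball x e \<subseteq> \<Omega>" using \<Omega> open_contains_cball by blast
      then have "ball x e \<in> {ball c R |c R. cball c R \<subseteq> \<Omega>}" "x \<in> ball x e" by (blast, simp)
      then have "x \<in> \<Union>\<F>" unfolding \<F>(3) by (rule UnionI)
      then show "g x = 0" using elim by blast
    qed
  qed
qed

lemma in_L2_test_function:
  assumes "open \<Omega>" "test_function \<Omega> \<phi> D"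
  shows "in_L2 \<Omega> \<phi>" "in_L2 \<Omega> D"
proof -
  obtain K where d: "\<And>x. GDERIV \<phi> x :> D x" and cD: "continuous_on UNIV D"
    and K: "compact K" "K \<subseteq> \<Omega>" and z: "\<And>x. x \<notin> K \<Longrightarrow> \<phi> x = 0" using assms(2) unfolding test_function_def by blast
  have Dz: "D x = 0" if "x \<notin> K" for x using gderiv_zero_outside[OF d compact_imp_closed[OF K(1)] z that] .
  have c: "continuous_on \<Omega> \<phi>" "continuous_on \<Omega> D"
    using d cD by (auto intro: continuous_on_if_gderiv continuous_on_subset)
  have *: "in_L2 \<Omega> p" if "continuous_on \<Omega> p" "\<And>x. x \<notin> K \<Longrightarrow> p x = 0" for p :: "'a \<Rightarrow> 'c::euclidean_space"
  proof -
    have "set_integrable lebesgue \<Omega> (\<lambda>x. (norm (p x))\<^sup>2)"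
      by (rule set_integrable_continuous_compact_support[OF assms(1) K])
        (use that in \<open>auto intro!: continuous_intros\<close>)
    then show ?thesis unfolding in_L2_def set_borel_measurable_def using assms(1) that(1)
      by (intro conjI measurable_completion[of _ lborel]) (simp_all add: borel_measurable_continuous_on_indicator)
  qed
  show "in_L2 \<Omega> \<phi>" "in_L2 \<Omega> D" using *[OF c(1) z] *[OF c(2) Dz] by auto
qed

lemma weak_gradient_unique:
  assumes \<Omega>: "open \<Omega>" and g: "in_L2 \<Omega> g" "is_weak_gradient \<Omega> u g" "in_L2 \<Omega> g'" "is_weak_gradient \<Omega> u g'"
  shows "AE x in lebesgue. x \<in> \<Omega> \<longrightarrow> g x = g' x"
proof -
  have "AE x in lebesgue. x \<in> \<Omega> \<longrightarrow> g x - g' x = 0"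
  proof (rule AE_zero_if_weakly_zero[OF \<Omega> in_L2_diff[OF g(1,3)]])
    fix \<phi> D assume t: "test_function \<Omega> \<phi> D"
    note L = in_L2_test_function[OF \<Omega> t]
    have "(LINT x:\<Omega>|lebesgue. \<phi> x *\<^sub>R g x) = (LINT x:\<Omega>|lebesgue. \<phi> x *\<^sub>R g' x)"
      using g(2)[unfolded is_weak_gradient_def, rule_format, OF t] g(4)[unfolded is_weak_gradient_def, rule_format, OF t]
      by (metis neg_equal_iff_equal)
    then show "(LINT x:\<Omega>|lebesgue. \<phi> x *\<^sub>R (g x - g' x)) = 0"
      using scaleR_integrable[OF L(1) g(1)] scaleR_integrable[OF L(1) g(3)] by (simp add: scaleR_diff_right)
  qed
  then show ?thesis by simp
qed

text \<open>The weak gradient is a choice; every integral and norm of it can be computed from any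
  weak gradient at hand.\<close>

lemma weak_grad_AE:
  assumes "open \<Omega>" "in_L2 \<Omega> g" "is_weak_gradient \<Omega> u g"
  shows "AE x in lebesgue. x \<in> \<Omega> \<longrightarrow> g x = weak_grad \<Omega> u x"
    "L2_nrm \<Omega> (weak_grad \<Omega> u) = L2_nrm \<Omega> g"
proof -
  have "in_L2 \<Omega> (weak_grad \<Omega> u) \<and> is_weak_gradient \<Omega> u (weak_grad \<Omega> u)"
    unfolding weak_grad_def by (rule someI[of _ g]) (use assms in auto)
  then show "AE x in lebesgue. x \<in> \<Omega> \<longrightarrow> g x = weak_grad \<Omega> u x"
    using weak_gradient_unique assms by blast
  then show "L2_nrm \<Omega> (weak_grad \<Omega> u) = L2_nrm \<Omega> g" by (rule in_L2_cong_AE(2)) (rule assms)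
qed

lemma is_weak_gradient_diff:
  assumes "open \<Omega>" "in_L2 \<Omega> u" "in_L2 \<Omega> g" "in_L2 \<Omega> u'" "in_L2 \<Omega> g'"
    and "is_weak_gradient \<Omega> u g" "is_weak_gradient \<Omega> u' g'"
  shows "is_weak_gradient \<Omega> (\<lambda>x. u x - u' x) (\<lambda>x. g x - g' x)"
  unfolding is_weak_gradient_def
proof (intro allI impI)
  fix \<phi> D assume t: "test_function \<Omega> \<phi> D"
  note L = in_L2_test_function[OF assms(1) t]
  show "(LINT x:\<Omega>|lebesgue. (u x - u' x) *\<^sub>R D x) = - (LINT x:\<Omega>|lebesgue. \<phi> x *\<^sub>R (g x - g' x))"
    using assms(6,7) t scaleR_integrable[OF L(1) assms(3)] scaleR_integrable[OF L(1) assms(5)]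
      scaleR_integrable[OF assms(2) L(2)] scaleR_integrable[OF assms(4) L(2)]
    unfolding is_weak_gradient_def by (simp add: scaleR_diff_right scaleR_diff_left)
qed

text \<open>This yields the weak gradient at the initial time, where no classical one exists.\<close>

lemma is_weak_gradient_limit:
  assumes \<Omega>: "open \<Omega>" and lim: "L2_lim \<Omega> U u" "L2_lim \<Omega> G g"
    and w: "\<And>n. is_weak_gradient \<Omega> (U n) (G n)"
  shows "is_weak_gradient \<Omega> u g"
  unfolding is_weak_gradient_def
proof (intro allI impI)
  fix \<phi> D assume t: "test_function \<Omega> \<phi> D"
  note L = in_L2_test_function[OF \<Omega> t]
  have "(\<lambda>n. - (LINT x:\<Omega>|lebesgue. \<phi> x *\<^sub>R G n x)) \<longlonglongrightarrow> - (LINT x:\<Omega>|lebesgue. \<phi> x *\<^sub>R g x)"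
    by (intro tendsto_minus L2_lim_integral lim L)
  moreover have "(\<lambda>n. LINT x:\<Omega>|lebesgue. U n x *\<^sub>R D x) \<longlonglongrightarrow> (LINT x:\<Omega>|lebesgue. u x *\<^sub>R D x)"
    by (intro L2_lim_integral' lim L)
  moreover have "(LINT x:\<Omega>|lebesgue. U n x *\<^sub>R D x) = - (LINT x:\<Omega>|lebesgue. \<phi> x *\<^sub>R G n x)" for n
    using w t unfolding is_weak_gradient_def by blast
  ultimately show "(LINT x:\<Omega>|lebesgue. u x *\<^sub>R D x) = - (LINT x:\<Omega>|lebesgue. \<phi> x *\<^sub>R g x)"
    using LIMSEQ_unique by simp
qed

section \<open>Radial functions on the unit disc\<close>

lemma unit_ball_vol_two: "unit_ball_vol 2 = pi"
  using unit_ball_vol_numeral(1)[of "Num.One"] by (simp add: fact_numeral)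

lemma indicator_unit_disc_measurable [simp, measurable]:
  "(indicator unit_disc :: real^2 \<Rightarrow> 'b::{zero_neq_one,topological_space}) \<in> borel_measurable borel"
  by (rule borel_measurable_indicator') auto

text \<open>Polar coordinates for radial functions: the measures agree on the half-lines \<open>{a<..}\<close> since
  the area of a disc of radius \<open>\<rho>\<close> is \<open>\<pi> \<rho>\<^sup>2\<close>.\<close>

lemma distr_norm_unit_disc:
  "distr (density lborel (indicator unit_disc)) borel norm =
     density lborel (\<lambda>r. ennreal (2 * pi * r) * indicator unit_interval r)"
  (is "?M = ?N")
proof (rule measure_eqI_lessThan)
  show "sets ?M = sets borel" "sets ?N = sets borel" by auto
  have M: "emeasure ?M {a<..} = emeasure lborel (unit_disc - cball 0 a)" for a :: real
  proof -
    have [measurable]: "unit_disc \<in> sets borel" "cball (0::real^2) a \<in> sets borel" by auto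
    have "emeasure ?M {a<..} = emeasure (density lborel (indicator unit_disc)) {x::real^2. a < norm x}"
      by (subst emeasure_distr) (auto simp: vimage_def)
    also have "\<dots> = (\<integral>\<^sup>+x. indicator unit_disc x * indicator {x::real^2. a < norm x} x \<partial>lborel)"
      by (rule emeasure_density) auto
    also have "\<dots> = (\<integral>\<^sup>+x. indicator (unit_disc - cball 0 a) x \<partial>lborel)"
      by (intro nn_integral_cong) (auto simp: indicator_def)
    finally show ?thesis by simp
  qed
  show "emeasure ?M {a<..} < \<infinity>" for a
  proof -
    have "emeasure ?M {a<..} \<le> emeasure lborel unit_disc" unfolding M by (rule emeasure_mono) auto
    also have "\<dots> < \<infinity>" using emeasure_lborel_ball_finite[of "0::real^2" 1] by simp
    finally show ?thesis .
  qed
  show "emeasure ?M {a<..} = emeasure ?N {a<..}" for a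
  proof (cases "a < 1")
    case False
    then have "emeasure ?M {a<..} = 0" unfolding M by (subst Diff_eq_empty_iff[THEN iffD2]) auto
    moreover have "emeasure ?N {a<..} = (\<integral>\<^sup>+r. ennreal (2 * pi * r) * indicator unit_interval r * indicator {a<..} r \<partial>lborel)"
      by (rule emeasure_density) auto
    moreover have "\<dots> = (\<integral>\<^sup>+(r::real). 0 \<partial>lborel)"
      using False by (intro nn_integral_cong) (auto simp: indicator_def)
    ultimately show ?thesis by simp
  next
    case True
    define b where "b = max 0 a"
    have b: "0 \<le> b" "b < 1" "a \<le> b" using True by (auto simp: b_def)
    have "emeasure ?M {a<..} = ennreal (pi * 1^2 - pi * b^2)"
    proof -
      have "emeasure ?M {a<..} = emeasure lborel (unit_disc - cball 0 b)"
      proof (cases "a < 0")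
        case True
        then have [simp]: "b = 0" "cball (0::real^2) a = {}" by (auto simp: b_def)
        have "emeasure lborel (unit_disc - {0}) = emeasure lborel unit_disc"
          by (rule emeasure_Diff_null_set) auto
        then show ?thesis unfolding M by simp
      qed (simp add: M b_def)
      also have "\<dots> = emeasure lborel unit_disc - emeasure lborel (cball (0::real^2) b)"
        using b emeasure_lborel_cball_finite[of "0::real^2" b] by (intro emeasure_Diff) auto
      also have "\<dots> = ennreal (pi * 1^2) - ennreal (pi * b^2)"
        using b by (simp add: emeasure_ball emeasure_cball unit_ball_vol_two)
      also have "\<dots> = ennreal (pi * 1^2 - pi * b^2)" using b by (subst ennreal_minus) auto
      finally show ?thesis .
    qed
    moreover have "emeasure ?N {a<..} = ennreal (pi * 1^2 - pi * b^2)"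
    proof -
      have "emeasure ?N {a<..} = (\<integral>\<^sup>+r. ennreal (2 * pi * r) * indicator {b..1} r \<partial>lborel)"
      proof (subst emeasure_density)
        have "AE r in lborel. r \<noteq> b \<and> r \<noteq> (1::real)"
          using AE_lborel_singleton[of b] AE_lborel_singleton[of "1::real"] by eventually_elim auto
        then show "(\<integral>\<^sup>+r. ennreal (2 * pi * r) * indicator unit_interval r * indicator {a<..} r \<partial>lborel)
          = (\<integral>\<^sup>+r. ennreal (2 * pi * r) * indicator {b..1} r \<partial>lborel)"
          by (intro nn_integral_cong_AE) (elim eventually_mono, auto simp: indicator_def b_def max_def split: if_splits)
      qed auto
      also have "\<dots> = ennreal (pi * 1^2 - pi * b^2)"
        by (rule nn_integral_FTC_Icc) (use b in \<open>auto intro!: derivative_eq_intros\<close>)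
      finally show ?thesis .
    qed
    ultimately show ?thesis by simp
  qed
qed

lemma AE_radial:
  assumes "AE r in lebesgue. r \<in> unit_interval \<longrightarrow> P r"
  shows "AE x in lebesgue. x \<in> unit_disc \<longrightarrow> P (norm x)"
proof -
  have "AE r in lborel. r \<in> unit_interval \<longrightarrow> P r" using assms by (simp add: AE_completion_iff)
  then obtain N where N: "N \<in> null_sets lborel" "\<And>r. r \<notin> N \<Longrightarrow> r \<in> unit_interval \<longrightarrow> P r"
    by (auto elim!: AE_E3 simp: )
  have "AE r in density lborel (\<lambda>r. ennreal (2 * pi * r) * indicator unit_interval r). r \<in> unit_interval \<and> r \<notin> N"
    using AE_not_in[OF N(1)] by (subst AE_density) (auto elim!: eventually_mono simp: indicator_def split: if_splits)
  then have "AE x in density lborel (indicator unit_disc). norm (x::real^2) \<in> unit_interval \<and> norm x \<notin> N"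
    unfolding distr_norm_unit_disc[symmetric] using N(1) by (subst (asm) AE_distr_iff) auto
  then have "AE x in lborel. x \<in> unit_disc \<longrightarrow> norm (x::real^2) \<in> unit_interval \<and> norm x \<notin> N"
    by (subst (asm) AE_density) (auto elim!: eventually_mono simp: indicator_def split: if_splits)
  then have "AE x in lborel. x \<in> unit_disc \<longrightarrow> P (norm (x::real^2))"
    by eventually_elim (use N(2) in auto)
  then show ?thesis by (rule AE_completion)
qed

text \<open>Lebesgue measurable functions are replaced by Borel ones, to which the change of variables
  applies; null sets of \<open>(0,1)\<close> correspond to null sets of the disc.\<close>

lemma radial_integral:
  assumes m: "set_borel_measurable lebesgue unit_interval f"
    and i: "set_integrable lebesgue unit_interval (\<lambda>r. f r * r)"
  shows "set_borel_measurable lebesgue unit_disc (radial f)"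
    and "set_integrable lebesgue unit_disc (radial f)"
    and "(LINT x:unit_disc|lebesgue. radial f x) = 2 * pi * (LINT r:unit_interval|lebesgue. f r * r)"
proof -
  obtain f' where f'[measurable]: "f' \<in> borel_measurable lborel"
    and ae: "AE r in lborel. indicator unit_interval r *\<^sub>R f r = f' r"
    using completion_ex_borel_measurable_real[OF m[unfolded set_borel_measurable_def]] by blast
  have ae1: "AE r in lebesgue. r \<in> unit_interval \<longrightarrow> f r = f' r"
    using AE_completion[OF ae] by eventually_elim auto
  have ae2: "AE x in lebesgue. indicator unit_disc x *\<^sub>R f' (norm x) = indicator unit_disc x *\<^sub>R radial f x"
    using AE_radial[OF ae1] by eventually_elim (auto simp: radial_def indicator_def)
  have ae3: "AE r in lebesgue. indicator unit_interval r *\<^sub>R (f r * r) = indicator unit_interval r *\<^sub>R (f' r * r)"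
    using ae1 by eventually_elim (auto simp: indicator_def)
  have mb: "(\<lambda>x. indicator unit_disc x *\<^sub>R f' (norm (x::real^2))) \<in> borel_measurable lborel"
    by (intro borel_measurable_scaleR borel_measurable_indicator measurable_compose[OF _ f']) auto
  show 1: "set_borel_measurable lebesgue unit_disc (radial f)"
    unfolding set_borel_measurable_def using borel_measurable_AE[OF measurable_completion[OF mb] ae2] .
  have mi: "(\<lambda>r. indicator unit_interval r *\<^sub>R (f' r * r)) \<in> borel_measurable lborel" by measurable
  have "integrable lebesgue (\<lambda>r. indicator unit_interval r *\<^sub>R (f' r * r))"
    by (rule integrable_cong_AE_imp[OF i[unfolded set_integrable_def] measurable_completion[OF mi] ae3])
  then have ii: "integrable lborel (\<lambda>r. indicator unit_interval r *\<^sub>R (f' r * r))"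
    using mi by (simp add: integrable_completion)
  have eqd: "density lborel (\<lambda>r. ennreal (2 * pi * r) * indicator unit_interval r) =
      density lborel (\<lambda>r. ennreal (2 * pi * r * indicator unit_interval r))"
    by (rule arg_cong[where f="density lborel"]) (auto simp: indicator_def)
  have eqd2: "density lborel (indicator unit_disc) = density lborel (\<lambda>x::real^2. ennreal (indicator unit_disc x))"
    by (rule arg_cong[where f="density lborel"]) (auto simp: indicator_def)
  have ii': "integrable lborel (\<lambda>r. (2 * pi * r * indicator unit_interval r) *\<^sub>R f' r)"
    using integrable_mult_right[OF ii, of "2*pi"] by (simp add: mult_ac)
  have iN: "integrable (density lborel (\<lambda>r. ennreal (2 * pi * r) * indicator unit_interval r)) f'"
    unfolding eqd by (subst integrable_density) (use ii' in \<open>auto simp: indicator_def\<close>)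
  then have "integrable (density lborel (\<lambda>x::real^2. ennreal (indicator unit_disc x))) (\<lambda>x. f' (norm x))"
    unfolding distr_norm_unit_disc[symmetric] eqd2 by (subst (asm) integrable_distr_eq) auto
  then have iD: "integrable lborel (\<lambda>x::real^2. indicator unit_disc x *\<^sub>R f' (norm x))"
    by (subst (asm) integrable_density) auto
  then have iD': "integrable lebesgue (\<lambda>x::real^2. indicator unit_disc x *\<^sub>R f' (norm x))"
    using mb by (simp add: integrable_completion)
  show "set_integrable lebesgue unit_disc (radial f)"
    unfolding set_integrable_def
    by (rule integrable_cong_AE_imp[OF iD' 1[unfolded set_borel_measurable_def] ae2])
  have "(LINT x:unit_disc|lebesgue. radial f x) = (LINT x|lebesgue. indicator unit_disc x *\<^sub>R f' (norm x))"
    unfolding set_lebesgue_integral_def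
    by (rule integral_cong_AE[OF 1[unfolded set_borel_measurable_def] measurable_completion[OF mb] ae2[THEN AE_symmetric]])
  also have "\<dots> = (LINT x|lborel. indicator unit_disc x *\<^sub>R f' (norm (x::real^2)))" using mb by (rule integral_completion)
  also have "\<dots> = (LINT x|density lborel (\<lambda>x::real^2. ennreal (indicator unit_disc x)). f' (norm x))"
    by (subst integral_density) auto
  also have "\<dots> = (LINT r|density lborel (\<lambda>r. ennreal (2 * pi * r) * indicator unit_interval r). f' r)"
    unfolding distr_norm_unit_disc[symmetric] eqd2 by (subst integral_distr) auto
  also have "\<dots> = (LINT r|lborel. (2 * pi * r * indicator unit_interval r) *\<^sub>R f' r)"
    unfolding eqd by (subst integral_density) (auto simp: indicator_def)
  also have "\<dots> = 2 * pi * (LINT r|lborel. indicator unit_interval r *\<^sub>R (f' r * r))"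
    by (subst integral_mult_right_zero[symmetric]) (simp add: mult_ac)
  also have "(LINT r|lborel. indicator unit_interval r *\<^sub>R (f' r * r)) = (LINT r|lebesgue. indicator unit_interval r *\<^sub>R (f' r * r))"
    using mi by (rule integral_completion[symmetric])
  also have "\<dots> = (LINT r:unit_interval|lebesgue. f r * r)"
    unfolding set_lebesgue_integral_def
    by (rule integral_cong_AE[OF measurable_completion[OF mi] borel_measurable_integrable[OF i[unfolded set_integrable_def]] ae3[THEN AE_symmetric]])
  finally show "(LINT x:unit_disc|lebesgue. radial f x) = 2 * pi * (LINT r:unit_interval|lebesgue. f r * r)" .
qed

lemma set_integrable_weight:
  assumes "set_integrable lebesgue unit_interval (f::real\<Rightarrow>real)"
  shows "set_integrable lebesgue unit_interval (\<lambda>r. f r * r)"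
proof (rule set_integrable_bound[OF assms])
  have "(\<lambda>r::real. r) \<in> borel_measurable lebesgue" by (rule measurable_completion) simp
  then have "(\<lambda>r. (indicator unit_interval r *\<^sub>R f r) * r) \<in> borel_measurable lebesgue"
    using assms unfolding set_integrable_def by (intro borel_measurable_times) auto
  then show "set_borel_measurable lebesgue unit_interval (\<lambda>r. f r * r)"
    by (simp add: set_borel_measurable_def mult.assoc)
  show "AE x in lebesgue. x \<in> unit_interval \<longrightarrow> norm (f x * x) \<le> norm (f x)"
    by (intro AE_I2) (auto simp: abs_mult intro: mult_left_le)
qed

lemma set_borel_measurable_power2:
  fixes u :: "'a::euclidean_space \<Rightarrow> real"
  assumes "set_borel_measurable lebesgue S u"
  shows "set_borel_measurable lebesgue S (\<lambda>x. (u x)\<^sup>2)"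
proof -
  have "(\<lambda>x. (indicator S x *\<^sub>R u x)\<^sup>2) \<in> borel_measurable lebesgue"
    using assms unfolding set_borel_measurable_def by (rule borel_measurable_power)
  moreover have "(\<lambda>x. (indicator S x *\<^sub>R u x)\<^sup>2) = (\<lambda>x. indicator S x *\<^sub>R (u x)\<^sup>2)" by (auto simp: indicator_def)
  ultimately show ?thesis by (simp add: set_borel_measurable_def)
qed

lemma in_L2_radial:
  fixes u :: "real \<Rightarrow> real"
  assumes "in_L2 unit_interval u"
  shows "in_L2 unit_disc (radial u)"
    and "(L2_nrm unit_disc (radial u))\<^sup>2 = 2 * pi * (LINT r:unit_interval|lebesgue. (u r)\<^sup>2 * r)"
    and "L2_nrm unit_disc (radial u) \<le> sqrt (2 * pi) * L2_nrm unit_interval u"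
proof -
  have m: "set_borel_measurable lebesgue unit_interval u" and i: "set_integrable lebesgue unit_interval (\<lambda>x. (u x)\<^sup>2)"
    using assms by (auto simp: in_L2_def)
  note sq = radial_integral[OF set_borel_measurable_power2[OF m] set_integrable_weight[OF i]]
  have rsq: "radial (\<lambda>r. (u r)\<^sup>2) = (\<lambda>x. (norm (radial u x))\<^sup>2)" by (auto simp: radial_def)
  have one: "in_L2 unit_interval (\<lambda>_. 1 :: real)" by (rule in_L2_continuous_bounded[where C=1]) auto
  have "set_integrable lebesgue unit_interval (\<lambda>r. u r * r)"
    using set_integrable_weight scaleR_integrable[OF assms one] by simp
  then have "set_borel_measurable lebesgue unit_disc (radial u)" by (rule radial_integral(1)[OF m])
  then show "in_L2 unit_disc (radial u)" using sq(2) unfolding in_L2_def rsq by simp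
  show eq: "(L2_nrm unit_disc (radial u))\<^sup>2 = 2 * pi * (LINT r:unit_interval|lebesgue. (u r)\<^sup>2 * r)"
    unfolding L2_nrm_power2 using sq(3) unfolding rsq .
  have "(LINT r:unit_interval|lebesgue. (u r)\<^sup>2 * r) \<le> (LINT r:unit_interval|lebesgue. (u r)\<^sup>2)"
    by (rule set_integral_mono[OF set_integrable_weight[OF i] i]) (auto intro: mult_left_le)
  then have "(L2_nrm unit_disc (radial u))\<^sup>2 \<le> (sqrt (2 * pi) * L2_nrm unit_interval u)\<^sup>2"
    unfolding eq by (simp add: power_mult_distrib L2_nrm_power2)
  then show "L2_nrm unit_disc (radial u) \<le> sqrt (2 * pi) * L2_nrm unit_interval u"
    by (rule power2_le_imp_le) (simp add: L2_nrm_nonneg)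
qed

text \<open>If \<open>g\<close> is the derivative of \<open>u\<close>, this is the gradient of the radial function \<open>u\<close>: the unit
  vector field \<open>sgn x = x / norm x\<close> is zero at the origin.\<close>

definition radial_field :: "(real \<Rightarrow> real) \<Rightarrow> real^2 \<Rightarrow> real^2" where
  "radial_field g x = radial g x *\<^sub>R sgn x"

lemma in_L2_radial_field:
  assumes "in_L2 unit_interval g"
  shows "in_L2 unit_disc (radial_field g)"
    and "L2_nrm unit_disc (radial_field g) = L2_nrm unit_disc (radial g)"
proof -
  note g = in_L2_radial(1)[OF assms]
  have nz: "AE x in lebesgue. x \<noteq> (0::real^2)"
    using AE_lborel_singleton[of "0::real^2"] by (rule AE_completion)
  have m: "(\<lambda>x. (indicator unit_disc x *\<^sub>R radial g x) *\<^sub>R sgn x) \<in> borel_measurable lebesgue"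
  proof (rule borel_measurable_scaleR)
    show "(\<lambda>x. indicator unit_disc x *\<^sub>R radial g x) \<in> borel_measurable lebesgue"
      using g unfolding in_L2_iff by blast
    have "(sgn :: real^2 \<Rightarrow> _) \<in> borel_measurable lborel" unfolding sgn_div_norm[abs_def] by measurable
    then show "(sgn :: real^2 \<Rightarrow> _) \<in> borel_measurable lebesgue" by (rule measurable_completion)
  qed
  have ae: "AE x in lebesgue. indicator unit_disc x *\<^sub>R (norm (radial g x))\<^sup>2 = indicator unit_disc x *\<^sub>R (norm (radial_field g x))\<^sup>2"
    using nz by eventually_elim (simp add: radial_field_def norm_sgn)
  have m2: "(\<lambda>x. indicator unit_disc x *\<^sub>R (norm (radial_field g x))\<^sup>2) \<in> borel_measurable lebesgue"
    using borel_measurable_AE[OF _ ae] g by (auto simp: in_L2_def set_integrable_def)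
  show "in_L2 unit_disc (radial_field g)"
    unfolding in_L2_def
  proof
    show "set_borel_measurable lebesgue unit_disc (radial_field g)"
      using m by (simp add: set_borel_measurable_def radial_field_def)
    show "set_integrable lebesgue unit_disc (\<lambda>x. (norm (radial_field g x))\<^sup>2)"
      unfolding set_integrable_def
      by (rule integrable_cong_AE_imp[OF _ m2 ae]) (use g in \<open>simp add: in_L2_def set_integrable_def\<close>)
  qed
  have "(LINT x|lebesgue. indicator unit_disc x *\<^sub>R (norm (radial g x))\<^sup>2) = (LINT x|lebesgue. indicator unit_disc x *\<^sub>R (norm (radial_field g x))\<^sup>2)"
    by (rule integral_cong_AE[OF _ m2 ae]) (use g in \<open>auto simp: in_L2_def set_integrable_def\<close>)
  then show "L2_nrm unit_disc (radial_field g) = L2_nrm unit_disc (radial g)"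
    by (simp add: L2_nrm_def set_lebesgue_integral_def)
qed

lemma L2_lim_radial:
  assumes "L2_lim unit_interval U u"
  shows "L2_lim unit_disc (\<lambda>n. radial (U n)) (radial u)"
    and "L2_lim unit_disc (\<lambda>n. radial_field (U n)) (radial_field u)"
proof -
  have i: "in_L2 unit_interval (U n)" "in_L2 unit_interval u" for n using assms by (auto simp: L2_lim_def)
  have d: "in_L2 unit_interval (\<lambda>x. U n x - u x)" for n by (intro in_L2_diff i)
  have r: "(\<lambda>x. radial (U n) x - radial u x) = radial (\<lambda>x. U n x - u x)"
     "(\<lambda>x. radial_field (U n) x - radial_field u x) = radial_field (\<lambda>x. U n x - u x)" for n
    by (auto simp: radial_def radial_field_def scaleR_diff_left)
  have "(\<lambda>n. sqrt (2 * pi) * L2_nrm unit_interval (\<lambda>x. U n x - u x)) \<longlonglongrightarrow> 0"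
    using assms by (intro tendsto_mult_right_zero) (simp add: L2_lim_def)
  then have "(\<lambda>n. L2_nrm unit_disc (radial (\<lambda>x. U n x - u x))) \<longlonglongrightarrow> 0"
    by (rule tendsto_zero_bound[rotated]) (use in_L2_radial(3)[OF d] in \<open>simp add: L2_nrm_nonneg\<close>)
  then show "L2_lim unit_disc (\<lambda>n. radial (U n)) (radial u)"
    and "L2_lim unit_disc (\<lambda>n. radial_field (U n)) (radial_field u)"
    unfolding L2_lim_def r using in_L2_radial_field[OF d] in_L2_radial_field(1)[OF i(1)] in_L2_radial_field(1)[OF i(2)]
     in_L2_radial(1)[OF i(1)] in_L2_radial(1)[OF i(2)] by auto
qed

text \<open>The condition \<open>f' 0 = 0\<close> makes the radial function differentiable at the origin, so the classical
  gradient exists everywhere.\<close>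

lemma radial_weak_gradient:
  assumes d: "\<And>r. r \<in> {0..1} \<Longrightarrow> (f has_real_derivative f' r) (at r within {0..1})"
    and c: "continuous_on {0..1} f'" and f'0: "f' 0 = 0"
  shows "is_weak_gradient unit_disc (radial f) (radial_field f')"
proof (rule classical_gradient_is_weak)
  show "GDERIV (radial f) x :> radial_field f' x" if x: "x \<in> unit_disc" for x
  proof (cases "x = 0")
    case False
    then have n: "norm x \<in> {0<..<1}" using x by simp
    have "(f has_real_derivative f' (norm x)) (at (norm x))"
      using d[of "norm x"] n at_within_interior[of "norm x" "{0..1}"] by auto
    from GDERIV_DERIV_compose[OF GDERIV_norm[OF False] this] show ?thesis
      by (simp add: radial_def[abs_def] radial_field_def)
  next
    case True
    have "(f has_derivative (*) 0) (at 0 within {0..1})"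
      using d[of 0] f'0 by (simp add: has_field_derivative_def)
    then have *: "\<exists>\<delta>>0. \<forall>y\<in>{0..1}. norm (y - 0) < \<delta> \<longrightarrow> norm (f y - f 0 - 0 * (y - 0)) \<le> e * norm (y - 0)" if "e > 0" for e
      using that unfolding has_derivative_within_alt by blast
    have "(radial f has_derivative (\<lambda>h. h \<bullet> 0)) (at 0)"
      unfolding has_derivative_at_alt
    proof (intro conjI allI impI)
      show "bounded_linear (\<lambda>h::real^2. h \<bullet> 0)" by simp
      fix e :: real assume "e > 0"
      from *[OF this] obtain \<delta> where \<delta>: "\<delta> > 0" "\<And>y. y \<in> {0..1} \<Longrightarrow> \<bar>y\<bar> < \<delta> \<Longrightarrow> \<bar>f y - f 0\<bar> \<le> e * \<bar>y\<bar>"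
        by (auto simp del: atLeastAtMost_iff)
      show "\<exists>\<delta>>0. \<forall>y. norm (y - 0) < \<delta> \<longrightarrow> norm (radial f y - radial f 0 - (y - 0) \<bullet> 0) \<le> e * norm (y - 0)"
        using \<delta> by (intro exI[of _ "min \<delta> 1"]) (auto simp: radial_def)
    qed
    then show ?thesis using True by (simp add: gderiv_def radial_field_def)
  qed
  show "continuous_on unit_disc (radial_field f')"
  proof (rule continuous_at_imp_continuous_on, rule ballI)
    fix x :: "real^2" assume x: "x \<in> unit_disc"
    show "isCont (radial_field f') x"
    proof (cases "x = 0")
      case False
      then have n: "norm x \<in> {0<..<1}" using x by simp
      then have "isCont f' (norm x)"
        by (intro continuous_on_interior[OF c]) auto
      then have "isCont (\<lambda>x. f' (norm x)) x" using isCont_o2[OF isCont_norm[OF continuous_ident]] by blast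
      moreover have "isCont sgn x" using False by (intro continuous_intros) auto
      ultimately show ?thesis unfolding radial_field_def[abs_def] radial_def by (rule continuous_scaleR)
    next
      case True
      have "(f' \<longlongrightarrow> 0) (at 0 within {0..1})" using c f'0 unfolding continuous_on_def by force
      then have *: "\<exists>d>0. \<forall>y\<in>{0..1}. 0 < dist y 0 \<and> dist y 0 < d \<longrightarrow> dist (f' y) 0 < e" if "e > 0" for e
        using that unfolding Lim_within by blast
      have "(radial_field f' \<longlongrightarrow> 0) (at 0)"
        unfolding Lim_at
      proof (intro allI impI)
        fix e :: real assume "e > 0"
        then obtain d where d: "d > 0" "\<And>y. y \<in> {0..1} \<Longrightarrow> 0 < \<bar>y\<bar> \<Longrightarrow> \<bar>y\<bar> < d \<Longrightarrow> \<bar>f' y\<bar> < e" using * by fastforce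
        show "\<exists>d>0. \<forall>x. 0 < dist x 0 \<and> dist x 0 < d \<longrightarrow> dist (radial_field f' x) 0 < e"
          using d by (intro exI[of _ "min d 1"]) (auto simp: radial_field_def radial_def norm_sgn)
      qed
      then show ?thesis using True by (simp add: isCont_def radial_field_def)
    qed
  qed
qed simp

section \<open>Functions of space and time that are regular up to the boundary\<close>

definition cont2 :: "(real \<Rightarrow> real \<Rightarrow> real) \<Rightarrow> bool" where
  "cont2 f \<longleftrightarrow> continuous_on ({0..1} \<times> {0<..}) (\<lambda>p. f (fst p) (snd p))"

definition rderiv :: "(real \<Rightarrow> real \<Rightarrow> real) \<Rightarrow> (real \<Rightarrow> real \<Rightarrow> real) \<Rightarrow> bool" where
  "rderiv f f' \<longleftrightarrow> (\<forall>r\<in>{0..1}. \<forall>t>0. ((\<lambda>x. f x t) has_real_derivative f' r t) (at r within {0..1}))"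

definition tderiv :: "(real \<Rightarrow> real \<Rightarrow> real) \<Rightarrow> (real \<Rightarrow> real \<Rightarrow> real) \<Rightarrow> bool" where
  "tderiv f f' \<longleftrightarrow> (\<forall>r\<in>{0..1}. \<forall>t>0. (f r has_real_derivative f' r t) (at t))"

named_theorems cont2_intros

lemma cont2_const [cont2_intros]: "cont2 (\<lambda>r t. c)" and cont2_fst [cont2_intros]: "cont2 (\<lambda>r t. r)"
  by (auto simp: cont2_def intro!: continuous_intros)

lemma cont2_add [cont2_intros]: "cont2 f \<Longrightarrow> cont2 g \<Longrightarrow> cont2 (\<lambda>r t. f r t + g r t)"
  and cont2_diff [cont2_intros]: "cont2 f \<Longrightarrow> cont2 g \<Longrightarrow> cont2 (\<lambda>r t. f r t - g r t)"
  and cont2_mult [cont2_intros]: "cont2 f \<Longrightarrow> cont2 g \<Longrightarrow> cont2 (\<lambda>r t. f r t * g r t)"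
  and cont2_minus [cont2_intros]: "cont2 f \<Longrightarrow> cont2 (\<lambda>r t. - f r t)"
  and cont2_power [cont2_intros]: "cont2 f \<Longrightarrow> cont2 (\<lambda>r t. f r t ^ n)"
  by (auto simp: cont2_def intro!: continuous_intros)

lemma cont2_divide [cont2_intros]:
  "cont2 f \<Longrightarrow> cont2 g \<Longrightarrow> (\<And>r t. r \<in> {0..1} \<Longrightarrow> t > 0 \<Longrightarrow> g r t \<noteq> 0) \<Longrightarrow> cont2 (\<lambda>r t. f r t / g r t)"
  by (auto simp: cont2_def intro!: continuous_intros)

lemma cont2_compose:
  assumes "cont2 f" "continuous_on S a" "continuous_on S b" "\<And>x. x \<in> S \<Longrightarrow> a x \<in> {0..1} \<and> b x > 0"
  shows "continuous_on S (\<lambda>x. f (a x) (b x))"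
  using continuous_on_compose2[OF assms(1)[unfolded cont2_def] continuous_on_Pair[OF assms(2,3)]] assms(4)
  by fastforce

lemma cont2_r: "cont2 f \<Longrightarrow> t > 0 \<Longrightarrow> continuous_on {0..1} (\<lambda>r. f r t)"
  by (rule cont2_compose) (auto intro: continuous_intros)

lemma cont2_t: "cont2 f \<Longrightarrow> r \<in> {0..1} \<Longrightarrow> S \<subseteq> {0<..} \<Longrightarrow> continuous_on S (f r)"
  using cont2_compose[of f S "\<lambda>_. r" "\<lambda>t. t"] by (auto intro: continuous_intros)

lemma cont2_integral_t:
  assumes "cont2 g" "0 < a"
  shows "continuous_on {0..1} (\<lambda>r. integral {a..b} (g r))"
proof -
  have "continuous_on ({0..1} \<times> cbox a b) (\<lambda>p. g (fst p) (snd p))"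
    using assms(2) by (intro cont2_compose[OF assms(1)]) (auto intro: continuous_intros)
  from integral_continuous_on_param[of "{0..1}" a b g] this show ?thesis by (simp add: split_beta)
qed

text \<open>The fundamental theorem of calculus in the form in which derivatives are transported below:
  an integral representation passes to limits and can be differentiated in a parameter, whereas a
  derivative cannot.\<close>

lemma tderiv_if_integral:
  assumes g: "continuous_on {0<..} g" and F: "\<And>a b. 0 < a \<Longrightarrow> a \<le> b \<Longrightarrow> F b - F a = integral {a..b} g"
    and t: "t > (0::real)"
  shows "(F has_real_derivative g t) (at t)"
proof -
  have "((\<lambda>s. F (t/2) + integral {t/2..s} g) has_real_derivative 0 + g t) (at t within {t/2..2*t})"
    using t by (intro derivative_intros integral_has_real_derivative continuous_on_subset[OF g]) auto
  then have "(F has_real_derivative g t) (at t within {t/2..2*t})"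
    unfolding add_0
  proof (rule has_field_derivative_transform_within[OF _ zero_less_one])
    show "F (t / 2) + integral {t / 2..x} g = F x" if "x \<in> {t / 2..2 * t}" for x
      using F[of "t/2" x] that t by simp
  qed (use t in auto)
  moreover have "t \<in> interior {t/2..2*t}" using t by simp
  ultimately show ?thesis using at_within_interior by metis
qed

lemma integral_tderiv:
  assumes g: "continuous_on {0<..} g" and F: "\<And>t. t > 0 \<Longrightarrow> (F has_real_derivative g t) (at t)"
    and "0 < a" "a \<le> (b::real)"
  shows "F b - F a = integral {a..b} g"
proof -
  have "(g has_integral F b - F a) {a..b}"
  proof (rule fundamental_theorem_of_calculus[OF assms(4)])
    show "(F has_vector_derivative g x) (at x within {a..b})" if "x \<in> {a..b}" for x
      using has_field_derivative_at_within[OF F[of x], of "{a..b}"] that assms(3)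
      by (simp add: has_real_derivative_iff_has_vector_derivative)
  qed
  then show ?thesis by (simp add: integral_unique)
qed

text \<open>Integrated in time, the relation is an equality of functions continuous in \<open>r\<close>, so it extends from
  \<open>(0,1)\<close> to \<open>[0,1]\<close>.\<close>

lemma tderiv_up_to_boundary:
  assumes f: "cont2 f" and g: "cont2 g"
    and d: "\<And>r t. r \<in> {0<..<1} \<Longrightarrow> t > 0 \<Longrightarrow> (f r has_real_derivative g r t) (at t)"
  shows "tderiv f g"
proof -
  have *: "f r b - f r a = integral {a..b} (g r)" if r: "r \<in> {0..1}" and ab: "0 < a" "a \<le> b" for r a b
  proof -
    have c: "continuous_on (closure {0<..<1}) (\<lambda>r. f r b - f r a - integral {a..b} (g r))"
      using ab cont2_r[OF f] cont2_integral_t[OF g] by (auto intro!: continuous_intros)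
    have "f r b - f r a - integral {a..b} (g r) = 0" if "r \<in> {0<..<1}" for r
      using integral_tderiv[OF cont2_t[OF g] d[OF that] ab] that by simp
    then show ?thesis using continuous_constant_on_closure[OF c, of 0 r] r by auto
  qed
  show ?thesis
    unfolding tderiv_def using * cont2_t[OF g] by (auto intro!: tderiv_if_integral)
qed

text \<open>The integrated relation \<open>f r b - f r a = \<integral> q\<close> is differentiated in \<open>r\<close> under the integral and then in
  time.\<close>

lemma mixed_derivative:
  assumes f1: "rderiv f f1" and q: "tderiv f q" "cont2 q" and q1: "rderiv q q1" "cont2 q1"
  shows "tderiv f1 q1"
  unfolding tderiv_def
proof (intro ballI allI impI)
  fix r t :: real assume r: "r \<in> {0..1}" and t: "t > 0"
  have "f1 r b - f1 r a = integral {a..b} (q1 r)" if ab: "0 < a" "a \<le> b" for a b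
  proof -
    have F: "f x b - f x a = integral {a..b} (q x)" if "x \<in> {0..1}" for x
      using integral_tderiv[OF cont2_t[OF q(2) that] _ ab, of "f x"] q(1) that unfolding tderiv_def by auto
    have "((\<lambda>x. integral (cbox a b) (q x)) has_field_derivative integral (cbox a b) (q1 r)) (at r within {0..1})"
    proof (rule leibniz_rule_field_derivative)
      show "continuous_on ({0..1} \<times> cbox a b) (\<lambda>(x, t). q1 x t)"
        unfolding split_beta using ab by (intro cont2_compose[OF q1(2)]) (auto intro: continuous_intros)
      show "q x integrable_on cbox a b" if "x \<in> {0..1}" for x
        using ab that by (intro integrable_continuous cont2_t[OF q(2)]) auto
    qed (use q1(1) r ab in \<open>auto simp: rderiv_def\<close>)
    then have 1: "((\<lambda>x. f x b - f x a) has_real_derivative integral {a..b} (q1 r)) (at r within {0..1})"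
      unfolding box_real by (rule has_field_derivative_transform_within[OF _ zero_less_one]) (use F r in auto)
    have 2: "((\<lambda>x. f x b - f x a) has_real_derivative f1 r b - f1 r a) (at r within {0..1})"
      using f1 r ab unfolding rderiv_def by (intro derivative_intros) auto
    show ?thesis
      using vector_derivative_unique_within_closed_interval[of 0 1 r "\<lambda>x. f x b - f x a"] 1 2 r
      by (auto simp: has_real_derivative_iff_has_vector_derivative)
  qed
  then show "(f1 r has_real_derivative q1 r t) (at t)"
    using r t cont2_t[OF q1(2)] by (intro tderiv_if_integral) auto
qed

lemma integral_has_tderiv:
  assumes e: "tderiv e e'" "cont2 e" "cont2 e'" and t: "t > 0"
  shows "((\<lambda>t. integral {0..1} (\<lambda>r. e r t)) has_real_derivative integral {0..1} (\<lambda>r. e' r t)) (at t)"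
proof -
  have "((\<lambda>t. integral (cbox 0 1) (\<lambda>r. e r t)) has_field_derivative integral (cbox 0 1) (\<lambda>r. e' r t)) (at t within {0<..})"
  proof (rule leibniz_rule_field_derivative)
    show "continuous_on ({0<..} \<times> cbox 0 1) (\<lambda>(t, r). e' r t)"
      unfolding split_beta by (intro cont2_compose[OF e(3)]) (auto intro: continuous_intros)
    show "(\<lambda>r. e r s) integrable_on cbox 0 1" if "s \<in> {0<..}" for s
      using that by (intro integrable_continuous) (auto intro: cont2_r[OF e(2)])
    show "((\<lambda>t. e r t) has_real_derivative e' r s) (at s within {0<..})" if "s \<in> {0<..}" "r \<in> cbox 0 1" for r s
      using e(1) that by (auto simp: tderiv_def intro: has_field_derivative_at_within)
  qed (use t in auto)
  then show ?thesis using t by (simp add: at_within_open[of t "{0<..}"])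
qed

text \<open>All integrations by parts below take this form: the derivative of a flux that vanishes at both
  ends has integral zero.\<close>

lemma integral_rderiv_vanishing:
  assumes "\<And>r. r \<in> {0..1} \<Longrightarrow> (F has_real_derivative F' r) (at r within {0..1})" "F 0 = 0" "F 1 = (0::real)"
  shows "(F' has_integral 0) {0..1}"
proof -
  have "(F' has_integral F 1 - F 0) {0..1}"
    using assms(1) by (intro fundamental_theorem_of_calculus)
      (auto simp: has_real_derivative_iff_has_vector_derivative[symmetric])
  then show ?thesis using assms(2,3) by simp
qed

text \<open>Division by \<open>r\<close>: if \<open>f\<close> vanishes at \<open>r = 0\<close>, then \<open>f r / r\<close> is the mean of \<open>f'\<close>
  over \<open>[0,r]\<close>, which is as smooth as \<open>f'\<close> up to \<open>r = 0\<close>. The weight \<open>s ^ k\<close> accounts for \<open>k\<close>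
  differentiations in \<open>r\<close>.\<close>

definition mean_scaled :: "nat \<Rightarrow> (real \<Rightarrow> real \<Rightarrow> real) \<Rightarrow> real \<Rightarrow> real \<Rightarrow> real" where
  "mean_scaled k f r t = integral {0..1} (\<lambda>s. s ^ k * f (s * r) t)"

lemma mean_scaled_continuous_param:
  assumes "cont2 f"
  shows "continuous_on (({0..1} \<times> {0<..}) \<times> cbox 0 1) (\<lambda>(p, s). s ^ k * f (s * fst p) (snd p))"
  unfolding split_beta
  by (intro continuous_on_mult continuous_on_power continuous_on_snd continuous_on_id cont2_compose[OF assms])
    (auto intro!: continuous_intros mult_le_one)

lemma cont2_mean_scaled [cont2_intros]:
  assumes "cont2 f" shows "cont2 (mean_scaled k f)"
  unfolding cont2_def mean_scaled_def
  using integral_continuous_on_param[OF mean_scaled_continuous_param[OF assms]] by simp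

lemma rderiv_mean_scaled:
  assumes "rderiv f f1" "cont2 f" "cont2 f1"
  shows "rderiv (mean_scaled k f) (mean_scaled (Suc k) f1)"
  unfolding rderiv_def
proof (intro ballI allI impI)
  fix r t :: real assume r: "r \<in> {0..1}" and t: "t > 0"
  have "((\<lambda>x. integral (cbox 0 1) (\<lambda>s. s ^ k * f (s * x) t)) has_field_derivative
     integral (cbox 0 1) (\<lambda>s. s ^ k * (f1 (s * r) t * s))) (at r within {0..1})"
  proof (rule leibniz_rule_field_derivative)
    show "continuous_on ({0..1} \<times> cbox 0 1) (\<lambda>(x, s). s ^ k * (f1 (s * x) t * s))"
      unfolding split_beta using t
      by (intro continuous_on_mult continuous_on_power continuous_on_snd continuous_on_id cont2_compose[OF assms(3)])
        (auto intro!: continuous_intros mult_le_one)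
    show "(\<lambda>s. s ^ k * f (s * x) t) integrable_on cbox 0 1" if "x \<in> {0..1}" for x
      using t that
      by (intro integrable_continuous continuous_on_mult continuous_on_power continuous_on_id cont2_compose[OF assms(2)])
        (auto intro!: continuous_intros mult_le_one)
    show "((\<lambda>x. s ^ k * f (s * x) t) has_real_derivative s ^ k * (f1 (s * x) t * s)) (at x within {0..1})"
      if "x \<in> {0..1}" "s \<in> cbox 0 1" for x s
    proof (rule DERIV_cmult)
      have sx: "s * x \<in> {0..1}" using that by (auto intro: mult_le_one)
      have "((\<lambda>y. f y t) has_real_derivative f1 (s * x) t) (at (s * x) within (\<lambda>x. s * x) ` {0..1})"
        by (rule DERIV_subset[OF assms(1)[unfolded rderiv_def, rule_format, OF sx t]])
           (use that in \<open>auto intro: mult_le_one\<close>)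
      moreover have "((\<lambda>x. s * x) has_real_derivative s) (at x within {0..1})" by (auto intro!: derivative_eq_intros)
      ultimately show "((\<lambda>x. f (s * x) t) has_real_derivative f1 (s * x) t * s) (at x within {0..1})"
        using DERIV_image_chain[of "\<lambda>y. f y t" _ "\<lambda>x. s * x" x "{0..1}" s] by (simp add: o_def)
    qed
  qed (use r in auto)
  then show "((\<lambda>x. mean_scaled k f x t) has_real_derivative mean_scaled (Suc k) f1 r t) (at r within {0..1})"
    unfolding mean_scaled_def by (simp add: mult_ac)
qed

lemma mean_scaled_mult:
  assumes "rderiv f f1" "cont2 f1" "\<And>t. t > 0 \<Longrightarrow> f 0 t = 0" "r \<in> {0..1}" "t > 0"
  shows "f r t = r * mean_scaled 0 f1 r t"
proof -
  have "((\<lambda>s. f1 (s * r) t * r) has_integral f (1 * r) t - f (0 * r) t) {0..1}"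
  proof (rule fundamental_theorem_of_calculus)
    fix s :: real assume s: "s \<in> {0..1}"
    have sx: "s * r \<in> {0..1}" using s assms(4) by (auto intro: mult_le_one)
    have "((\<lambda>y. f y t) has_real_derivative f1 (s * r) t) (at (s * r) within (\<lambda>s. s * r) ` {0..1})"
      by (rule DERIV_subset[OF assms(1)[unfolded rderiv_def, rule_format, OF sx assms(5)]])
         (use assms(4) in \<open>auto intro: mult_le_one\<close>)
    moreover have "((\<lambda>s. s * r) has_real_derivative r) (at s within {0..1})" by (auto intro!: derivative_eq_intros)
    ultimately have "((\<lambda>s. f (s * r) t) has_real_derivative f1 (s * r) t * r) (at s within {0..1})"
      using DERIV_image_chain[of "\<lambda>y. f y t" _ "\<lambda>s. s * r" s "{0..1}" r] by (simp add: o_def)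
    then show "((\<lambda>s. f (s * r) t) has_vector_derivative f1 (s * r) t * r) (at s within {0..1})"
      by (simp add: has_real_derivative_iff_has_vector_derivative)
  qed simp
  then have "integral {0..1} (\<lambda>s. r * f1 (s * r) t) = f r t"
    using assms(3)[OF assms(5)] by (intro integral_unique) (simp add: mult.commute)
  moreover have "integral {0..1} (\<lambda>s. r * f1 (s * r) t) = r * integral {0..1} (\<lambda>s. f1 (s * r) t)"
    by (rule integral_mult_right)
  ultimately show ?thesis by (simp add: mean_scaled_def)
qed

section \<open>Energy and entropy balance\<close>

lemma rderiv_unique:
  assumes "rderiv f a" "rderiv f b" "r \<in> {0..1}" "t > 0"
  shows "a r t = b r t"
  using assms vector_derivative_unique_within_closed_interval[of 0 1 r "\<lambda>x. f x t" "a r t" "b r t"]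
  unfolding rderiv_def by (auto simp: has_real_derivative_iff_has_vector_derivative)

text \<open>The pointwise form of the energy balance. The left-hand side is the \<open>r\<close>-derivative of the flux
  \<open>- r h v\<^sup>3 / 2 + \<sigma> (r h v \<Delta>h + r h\<^sub>r h\<^sub>t) + 4 \<mu> (r v h (v\<^sub>r + v/r) - v\<^sup>2 h / 2)\<close>, and \<open>hz\<close> is \<open>h v\<^sub>t\<close>. The
  relations \<open>v = r V\<close> and \<open>h1 = r P\<close> remove all divisions by \<open>r\<close>, leaving a polynomial identity.\<close>

lemma energy_identity:
  fixes r h v V v1 V1 v2 h1 h2 h3 P P1 q q1 hz \<sigma> \<mu> :: real
  assumes "hz = - h * v * v1 + \<sigma> * h * (h3 + P1) + 4 * \<mu> * (h1 * (v1 + V) + h * (v2 + V1) - V * h1 / 2)"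
    and "q = - (v * h1 + h * v1 + h * V)"
    and "q1 = - (2 * v1 * h1 + v * h2 + h * v2 + h1 * V + h * V1)"
    and "v1 = V + r * V1" "h2 = P + r * P1" "v = r * V" "h1 = r * P"
  shows "- 1/2 * (h * v^3 + r * h1 * v^3 + r * h * (3 * v^2 * v1)) +
      \<sigma> * ((h * v + r * h1 * v + r * h * v1) * (h2 + P) + r * h * v * (h3 + P1) + (h1 * q + r * h2 * q + r * h1 * q1)) +
      4 * \<mu> * ((v * h + r * v1 * h + r * v * h1) * (v1 + V) + r * v * h * (v2 + V1) - 1/2 * (2 * v * v1 * h + v^2 * h1))
    = (q * v^2 + 2 * v * hz + 2 * \<sigma> * h1 * q1) * r / 2 + 4 * \<mu> * (h * (v * V + r * v1^2 + v * v1))"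
  unfolding assms by (simp add: field_simps power2_eq_square power3_eq_cube)

text \<open>The pointwise form of the entropy balance. Here \<open>f = h\<^sub>r / h\<close>, and the step \<open>key\<close> is the equation
  \<open>h (w\<^sub>t + v w\<^sub>r) = \<sigma> h (\<Delta>h)\<^sub>r + 2 \<mu> h\<^sub>r v / r\<close> of the effective velocity, in which the second
  derivatives of \<open>v\<close> have cancelled. The derivative of \<open>r h w\<close> is taken in the form
  \<open>r h v + 4 \<mu> r h\<^sub>r\<close>, whose first summand has derivative \<open>- r h\<^sub>t\<close>.\<close>

lemma entropy_identity:
  fixes r h v V v1 V1 v2 h1 h2 h3 P P1 q q1 hz f hfr hft \<sigma> \<mu> w hwr hwt wr :: real
  assumes hz: "hz = - h * v * v1 + \<sigma> * h * (h3 + P1) + 4 * \<mu> * (h1 * (v1 + V) + h * (v2 + V1) - V * h1 / 2)"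
    and q: "q = - (v * h1 + h * v1 + h * V)"
    and q1: "q1 = - (2 * v1 * h1 + v * h2 + h * v2 + h1 * V + h * V1)"
    and v1: "v1 = V + r * V1" and h2: "h2 = P + r * P1" and v: "v = r * V" and h1: "h1 = r * P"
    and f: "h * f = h1" and w: "w = v + 4 * \<mu> * f"
    and wr: "h * wr = h * v1 + 4 * \<mu> * (h2 - f * h1)" and wt: "hwt = hz + 4 * \<mu> * (q1 - f * q)"
  shows "- 1/2 * ((h * v + r * h1 * v + r * h * v1) * w^2 + r * h * v * (2 * w * wr)) +
      \<sigma> * ((h * v + r * h1 * v + r * h * v1 + 4 * \<mu> * (h1 + r * h2)) * (h2 + P) + (r * h * v + 4 * \<mu> * r * h1) * (h3 + P1)
        + (h1 * q + r * h2 * q + r * h1 * q1))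
    = (q * w^2 + 2 * w * hwt + 2 * \<sigma> * h1 * q1) * r / 2 + 4 * \<mu> * \<sigma> * (r * (h2 + P)^2) - 2 * \<mu> * (w * h1 * v)"
proof -
  have fq: "f * q = - (v * f * h1 + h1 * v1 + h1 * V)"
    unfolding q f[symmetric] by (simp add: algebra_simps)
  have key: "hwt + v * (h * wr) = \<sigma> * h * (h3 + P1) + 2 * \<mu> * V * h1"
    unfolding wt wr hz right_diff_distrib fq q1 by (simp add: algebra_simps)
  have rq: "h * v + r * h1 * v + r * h * v1 = - (r * q)" unfolding q v by (simp add: algebra_simps)
  have rh: "h1 + r * h2 = r * (h2 + P)" unfolding h1 by (simp add: algebra_simps)
  have rw: "r * h * v + 4 * \<mu> * r * h1 = r * w * h" unfolding w f[symmetric] by (simp add: algebra_simps)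
  have e1: "- 1/2 * ((h * v + r * h1 * v + r * h * v1) * w^2 + r * h * v * (2 * w * wr)) = r * q * w^2 / 2 - r * w * (v * (h * wr))"
    unfolding rq by (simp add: algebra_simps)
  have e2: "(h * v + r * h1 * v + r * h * v1 + 4 * \<mu> * (h1 + r * h2)) * (h2 + P) + (h1 * q + r * h2 * q + r * h1 * q1)
      = 4 * \<mu> * (r * (h2 + P)^2) + r * h1 * q1"
  proof -
    have "h1 * q + r * h2 * q = r * (h2 + P) * q" using rh by (simp add: algebra_simps)
    then show ?thesis unfolding rq rh by (simp add: algebra_simps power2_eq_square)
  qed
  have "- 1/2 * ((h * v + r * h1 * v + r * h * v1) * w^2 + r * h * v * (2 * w * wr)) +
      \<sigma> * ((h * v + r * h1 * v + r * h * v1 + 4 * \<mu> * (h1 + r * h2)) * (h2 + P) + (r * h * v + 4 * \<mu> * r * h1) * (h3 + P1)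
        + (h1 * q + r * h2 * q + r * h1 * q1)) =
    r * q * w^2 / 2 - r * w * (v * (h * wr)) + \<sigma> * (4 * \<mu> * (r * (h2 + P)^2) + r * h1 * q1) + \<sigma> * (r * w * h) * (h3 + P1)"
    unfolding e1 rw e2[symmetric] by (simp add: algebra_simps)
  also have "\<sigma> * (r * w * h) * (h3 + P1) = r * w * (hwt + v * (h * wr) - 2 * \<mu> * V * h1)"
    unfolding key by (simp add: algebra_simps)
  also have "r * q * w^2 / 2 - r * w * (v * (h * wr)) + \<sigma> * (4 * \<mu> * (r * (h2 + P)^2) + r * h1 * q1) + \<dots> =
    (q * w^2 + 2 * w * hwt + 2 * \<sigma> * h1 * q1) * r / 2 + 4 * \<mu> * \<sigma> * (r * (h2 + P)^2) - 2 * \<mu> * (w * h1 * (r * V))"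
    by (simp add: algebra_simps)
  finally show ?thesis unfolding v[symmetric] .
qed

text \<open>The constants of the decay argument, for an upper bound \<open>Em\<close> of the energy. The coefficient of \<open>X\<close> in
  the estimate of the term without sign is \<open>2 \<mu> + cross_const\<close>. The energy enters with a weight for
  which its dissipation absorbs this and leaves \<open>- 2 \<mu> X\<close>. The coercivity constant compares the
  resulting functional with \<open>X + Y\<close>.\<close>

definition cross_const :: "real \<Rightarrow> real \<Rightarrow> real \<Rightarrow> real \<Rightarrow> real" where
  "cross_const \<sigma> \<mu> m Em = 16 * \<mu>^3 * Em / (m^3 * \<sigma>^2)"

definition energy_weight :: "real \<Rightarrow> real \<Rightarrow> real \<Rightarrow> real \<Rightarrow> real" where
  "energy_weight \<sigma> \<mu> m Em = (2 * \<mu> + cross_const \<sigma> \<mu> m Em) / (2 * \<mu>) + 1"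

definition coercivity_const :: "real \<Rightarrow> real \<Rightarrow> real \<Rightarrow> real \<Rightarrow> real" where
  "coercivity_const \<sigma> \<mu> m Em = 1 + 16 * \<mu>^2 / m + \<sigma> + energy_weight \<sigma> \<mu> m Em * (1 + \<sigma>)"

definition decay_rate :: "real \<Rightarrow> real \<Rightarrow> real \<Rightarrow> real \<Rightarrow> real" where
  "decay_rate \<sigma> \<mu> m Em = 2 * \<mu> * min 1 \<sigma> / coercivity_const \<sigma> \<mu> m Em"

lemma const_pos:
  assumes "\<sigma> > 0" "\<mu> > 0" "m > 0" "Em \<ge> 0"
  shows "cross_const \<sigma> \<mu> m Em \<ge> 0" "energy_weight \<sigma> \<mu> m Em \<ge> 1" "coercivity_const \<sigma> \<mu> m Em > 0" "decay_rate \<sigma> \<mu> m Em > 0"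
proof -
  show 1: "cross_const \<sigma> \<mu> m Em \<ge> 0" using assms by (simp add: cross_const_def)
  show 2: "energy_weight \<sigma> \<mu> m Em \<ge> 1" using assms 1 by (simp add: energy_weight_def)
  show 3: "coercivity_const \<sigma> \<mu> m Em > 0"
    using assms 2 by (simp add: coercivity_const_def add_pos_nonneg)
  show "decay_rate \<sigma> \<mu> m Em > 0" using assms 3 by (simp add: decay_rate_def)
qed

text \<open>The system with names for its derivatives in \<open>r\<close>, which are continuous up to \<open>r = 0\<close> and \<open>r = 1\<close>.
  The two evolution equations are written out and hold in the open interval, where division by \<open>r\<close>
  makes sense.\<close>

locale radial_flow =
  fixes \<sigma> \<mu> m :: real and h h1 h2 h3 v v1 v2 :: "real \<Rightarrow> real \<Rightarrow> real"
  assumes pos: "\<sigma> > 0" "\<mu> > 0" "m > 0"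
    and rd: "rderiv h h1" "rderiv h1 h2" "rderiv h2 h3" "rderiv v v1" "rderiv v1 v2"
    and ct: "cont2 h" "cont2 h1" "cont2 h2" "cont2 h3" "cont2 v" "cont2 v1" "cont2 v2"
    and bc: "\<And>t. t > 0 \<Longrightarrow> h1 0 t = 0" "\<And>t. t > 0 \<Longrightarrow> h1 1 t = 0" "\<And>t. t > 0 \<Longrightarrow> v 0 t = 0" "\<And>t. t > 0 \<Longrightarrow> v 1 t = 0"
    and low: "\<And>r t. r \<in> {0..1} \<Longrightarrow> t > 0 \<Longrightarrow> m \<le> h r t"
    and h_time: "\<And>r t. r \<in> {0<..<1} \<Longrightarrow> t > 0 \<Longrightarrow>
      (h r has_real_derivative - (v r t * h1 r t + h r t * v1 r t + h r t * (v r t / r))) (at t)"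
    and v_time: "\<And>r t. r \<in> {0<..<1} \<Longrightarrow> t > 0 \<Longrightarrow>
      (v r has_real_derivative - v r t * v1 r t + \<sigma> * (h3 r t + (h2 r t - h1 r t / r) / r) +
        4 * \<mu> / h r t * (h1 r t * (v1 r t + v r t / r) + h r t * (v2 r t + (v1 r t - v r t / r) / r) - v r t / r * h1 r t / 2)) (at t)"
begin

text \<open>On \<open>[0,1]\<close> these are \<open>v / r\<close>, its \<open>r\<close>-derivative, \<open>h\<^sub>r / r\<close> and its \<open>r\<close>-derivative.\<close>

definition "V = mean_scaled 0 v1"
definition "V1 = mean_scaled 1 v2"
definition "P = mean_scaled 0 h2"
definition "P1 = mean_scaled 1 h3"

lemma ct': "cont2 V" "cont2 V1" "cont2 P" "cont2 P1"
  unfolding V_def V1_def P_def P1_def by (intro cont2_mean_scaled ct)+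

lemma rd': "rderiv V V1" "rderiv P P1"
  unfolding V_def V1_def P_def P1_def using rderiv_mean_scaled[of _ _ 0] rd ct by auto

lemma v_eq: "r \<in> {0..1} \<Longrightarrow> t > 0 \<Longrightarrow> v r t = r * V r t"
  unfolding V_def by (rule mean_scaled_mult[OF rd(4) ct(6) bc(3)])

lemma h1_eq: "r \<in> {0..1} \<Longrightarrow> t > 0 \<Longrightarrow> h1 r t = r * P r t"
  unfolding P_def by (rule mean_scaled_mult[OF rd(2) ct(3) bc(1)])

lemma rderivD: "rderiv f g \<Longrightarrow> r \<in> {0..1} \<Longrightarrow> t > 0 \<Longrightarrow> ((\<lambda>x. f x t) has_real_derivative g r t) (at r within {0..1})"
  by (simp add: rderiv_def)

lemma rderiv_times_r:
  assumes "rderiv f f1" "rderiv g g1" "\<And>r t. r \<in> {0..1} \<Longrightarrow> t > 0 \<Longrightarrow> f r t = r * g r t" "r \<in> {0..1}" "t > 0"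
  shows "f1 r t = g r t + r * g1 r t"
proof -
  have "rderiv f (\<lambda>r t. g r t + r * g1 r t)"
    unfolding rderiv_def
  proof (intro ballI allI impI)
    fix r t :: real assume r: "r \<in> {0..1}" "t > 0"
    have "((\<lambda>x. x * g x t) has_real_derivative g r t + r * g1 r t) (at r within {0..1})"
      using rderivD[OF assms(2) r] by (auto intro!: derivative_eq_intros)
    then show "((\<lambda>x. f x t) has_real_derivative g r t + r * g1 r t) (at r within {0..1})"
      by (rule has_field_derivative_transform_within[OF _ zero_less_one]) (use assms(3) r in auto)
  qed
  then show ?thesis using rderiv_unique[OF assms(1)] assms(4,5) by blast
qed

lemma v1_eq: "r \<in> {0..1} \<Longrightarrow> t > 0 \<Longrightarrow> v1 r t = V r t + r * V1 r t"
  by (rule rderiv_times_r[OF rd(4) rd'(1) v_eq])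

lemma h2_eq: "r \<in> {0..1} \<Longrightarrow> t > 0 \<Longrightarrow> h2 r t = P r t + r * P1 r t"
  by (rule rderiv_times_r[OF rd(2) rd'(2) h1_eq])

lemma h_pos: "r \<in> {0..1} \<Longrightarrow> t > 0 \<Longrightarrow> h r t > 0"
  using low pos(3) by fastforce

text \<open>The equations turn the time derivatives into continuous functions on the closed interval:
  \<open>q = h\<^sub>t\<close>, \<open>q1 = h\<^sub>r\<^sub>t\<close> and \<open>z = v\<^sub>t\<close>. The functions \<open>f\<close>, \<open>fr\<close>, \<open>ft\<close> are \<open>(ln h)\<^sub>r\<close> and its derivatives in
  \<open>r\<close> and \<open>t\<close>, and \<open>w\<close>, \<open>wr\<close>, \<open>wt\<close> are the effective velocity and its derivatives.\<close>

definition "q r t = - (v r t * h1 r t + h r t * v1 r t + h r t * V r t)"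
definition "q1 r t = - (2 * v1 r t * h1 r t + v r t * h2 r t + h r t * v2 r t + h1 r t * V r t + h r t * V1 r t)"
definition "z r t = - v r t * v1 r t + \<sigma> * (h3 r t + P1 r t) +
        4 * \<mu> / h r t * (h1 r t * (v1 r t + V r t) + h r t * (v2 r t + V1 r t) - V r t * h1 r t / 2)"
definition "f r t = h1 r t / h r t"
definition "fr r t = (h2 r t - f r t * h1 r t) / h r t"
definition "ft r t = (q1 r t - f r t * q r t) / h r t"
definition "w r t = v r t + 4 * \<mu> * f r t"
definition "wr r t = v1 r t + 4 * \<mu> * fr r t"
definition "wt r t = z r t + 4 * \<mu> * ft r t"

lemma h_nz: "r \<in> {0..1} \<Longrightarrow> t > 0 \<Longrightarrow> h r t \<noteq> 0"
  using h_pos by fastforce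

lemma cts: "cont2 q" "cont2 q1" "cont2 z" "cont2 f" "cont2 fr" "cont2 ft" "cont2 w" "cont2 wr" "cont2 wt"
proof -
  show q: "cont2 q" "cont2 q1" "cont2 z" unfolding q_def[abs_def] q1_def[abs_def] z_def[abs_def]
    by (intro cont2_intros ct ct' h_nz; (assumption | simp))+
  show f: "cont2 f" unfolding f_def[abs_def] by (intro cont2_intros ct h_nz)
  show "cont2 fr" "cont2 ft" "cont2 w" unfolding fr_def[abs_def] ft_def[abs_def] w_def[abs_def]
    by (intro cont2_intros ct h_nz f q; assumption)+
  then show "cont2 wr" "cont2 wt" unfolding wr_def[abs_def] wt_def[abs_def]
    by (auto intro!: cont2_intros ct q)
qed

lemma td_h: "tderiv h q"
proof (rule tderiv_up_to_boundary[OF ct(1) cts(1)])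
  fix r t :: real assume r: "r \<in> {0<..<1}" and t: "t > 0"
  have "v r t / r = V r t" using v_eq[of r t] r t by simp
  then show "(h r has_real_derivative q r t) (at t)" using h_time[OF r t] by (simp add: q_def)
qed

lemma td_v: "tderiv v z"
proof (rule tderiv_up_to_boundary[OF ct(5) cts(3)])
  fix r t :: real assume r: "r \<in> {0<..<1}" and t: "t > 0"
  have "v r t / r = V r t" "(v1 r t - V r t) / r = V1 r t" "h1 r t / r = P r t" "(h2 r t - P r t) / r = P1 r t"
    using v_eq[of r t] v1_eq[of r t] h1_eq[of r t] h2_eq[of r t] r t by auto
  then show "(v r has_real_derivative z r t) (at t)" using v_time[OF r t] by (simp add: z_def)
qed

lemma rd_q: "rderiv q q1"
  unfolding rderiv_def
proof (intro ballI allI impI)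
  fix r t :: real assume r: "r \<in> {0..1}" "t > 0"
  show "((\<lambda>x. q x t) has_real_derivative q1 r t) (at r within {0..1})"
    unfolding q_def[abs_def] q1_def
    by (auto intro!: derivative_eq_intros rderivD[OF rd(1) r] rderivD[OF rd(2) r] rderivD[OF rd(4) r] rderivD[OF rd(5) r] rderivD[OF rd'(1) r]
        simp: algebra_simps)
qed

lemma td_h1: "tderiv h1 q1"
  by (rule mixed_derivative[OF rd(1) td_h cts(1) rd_q cts(2)])

lemma tderivD: "tderiv F G \<Longrightarrow> r \<in> {0..1} \<Longrightarrow> t > 0 \<Longrightarrow> (F r has_real_derivative G r t) (at t)"
  by (simp add: tderiv_def)

lemma td_w: "tderiv w wt"
  unfolding tderiv_def
proof (intro ballI allI impI)
  fix r t :: real assume r: "r \<in> {0..1}" "t > 0"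
  have "(f r has_real_derivative ft r t) (at t)"
    unfolding f_def[abs_def] ft_def using h_nz[OF r]
    by (auto intro!: derivative_eq_intros tderivD[OF td_h r] tderivD[OF td_h1 r] simp: field_simps f_def)
  then show "(w r has_real_derivative wt r t) (at t)"
    unfolding w_def[abs_def] wt_def by (auto intro!: derivative_eq_intros tderivD[OF td_v r])
qed

lemma rd_w: "rderiv w wr"
  unfolding rderiv_def
proof (intro ballI allI impI)
  fix r t :: real assume r: "r \<in> {0..1}" "t > 0"
  have "((\<lambda>x. f x t) has_real_derivative fr r t) (at r within {0..1})"
    unfolding f_def[abs_def] fr_def using h_nz[OF r]
    by (auto intro!: derivative_eq_intros rderivD[OF rd(1) r] rderivD[OF rd(2) r] simp: field_simps f_def)
  then show "((\<lambda>x. w x t) has_real_derivative wr r t) (at r within {0..1})"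
    unfolding w_def[abs_def] wr_def by (auto intro!: derivative_eq_intros rderivD[OF rd(4) r])
qed

lemma hz_eq: "r \<in> {0..1} \<Longrightarrow> t > 0 \<Longrightarrow> h r t * z r t = - h r t * v r t * v1 r t + \<sigma> * h r t * (h3 r t + P1 r t) +
   4 * \<mu> * (h1 r t * (v1 r t + V r t) + h r t * (v2 r t + V1 r t) - V r t * h1 r t / 2)"
  using h_nz[of r t] unfolding z_def by (simp add: distrib_left) (simp add: algebra_simps)

text \<open>\<open>X\<close> and \<open>Y\<close> are the dissipation functionals of the viscous and the capillary forces.\<close>

definition "energy_at t = 1/2 * integral {0..1} (\<lambda>r. (h r t * (v r t)\<^sup>2 + \<sigma> * (h1 r t)\<^sup>2) * r)"
definition "entropy_at t = 1/2 * integral {0..1} (\<lambda>r. (h r t * (w r t)\<^sup>2 + \<sigma> * (h1 r t)\<^sup>2) * r)"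
definition "X t = integral {0..1} (\<lambda>r. h r t * (v r t * V r t + r * (v1 r t)\<^sup>2))"
definition "Y t = integral {0..1} (\<lambda>r. r * (h2 r t + P r t)\<^sup>2)"

lemma cont2_integrable: "cont2 g \<Longrightarrow> t > 0 \<Longrightarrow> (\<lambda>r. g r t) integrable_on {0..1}"
  by (intro integrable_continuous_interval cont2_r)

lemma energy_deriv:
  assumes t: "t > 0"
  shows "(energy_at has_real_derivative - 4 * \<mu> * integral {0..1} (\<lambda>r. h r t * (v r t * V r t + r * (v1 r t)\<^sup>2 + v r t * v1 r t))) (at t)"
proof -
  let ?e' = "\<lambda>r t. (q r t * (v r t)\<^sup>2 + 2 * v r t * (h r t * z r t) + 2 * \<sigma> * h1 r t * q1 r t) * r"
  let ?d = "\<lambda>r t. h r t * (v r t * V r t + r * (v1 r t)\<^sup>2 + v r t * v1 r t)"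
  have c: "cont2 ?e'" "cont2 ?d" "cont2 (\<lambda>r t. (h r t * (v r t)\<^sup>2 + \<sigma> * (h1 r t)\<^sup>2) * r)"
    by (intro cont2_intros ct ct' cts)+
  have "tderiv (\<lambda>r t. (h r t * (v r t)\<^sup>2 + \<sigma> * (h1 r t)\<^sup>2) * r) ?e'"
    unfolding tderiv_def
  proof (intro ballI allI impI)
    fix r t :: real assume r: "r \<in> {0..1}" "t > 0"
    show "((\<lambda>t. (h r t * (v r t)\<^sup>2 + \<sigma> * (h1 r t)\<^sup>2) * r) has_real_derivative ?e' r t) (at t)"
      by (auto intro!: derivative_eq_intros tderivD[OF td_h r] tderivD[OF td_h1 r] tderivD[OF td_v r] simp: algebra_simps)
  qed
  from integral_has_tderiv[OF this c(3,1) t]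
  have 1: "(energy_at has_real_derivative 1/2 * integral {0..1} (\<lambda>r. ?e' r t)) (at t)"
    unfolding energy_at_def[abs_def] by (rule DERIV_cmult)
  let ?\<Phi> = "\<lambda>r. - 1/2 * (r * h r t * (v r t)^3) + \<sigma> * (r * h r t * v r t * (h2 r t + P r t) + r * h1 r t * q r t)
      + 4 * \<mu> * (r * v r t * h r t * (v1 r t + V r t) - 1/2 * ((v r t)\<^sup>2 * h r t))"
  have "((\<lambda>r. ?e' r t / 2 + 4 * \<mu> * ?d r t) has_integral 0) {0..1}"
  proof (rule integral_rderiv_vanishing[of ?\<Phi>])
    fix r :: real assume r: "r \<in> {0..1}"
    note rt = r t
    show "(?\<Phi> has_real_derivative ?e' r t / 2 + 4 * \<mu> * ?d r t) (at r within {0..1})"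
      unfolding energy_identity[OF hz_eq[OF rt] q_def q1_def v1_eq[OF rt] h2_eq[OF rt] v_eq[OF rt] h1_eq[OF rt], symmetric]
      by (auto intro!: derivative_eq_intros rderivD[OF rd(1) rt] rderivD[OF rd(2) rt] rderivD[OF rd(3) rt] rderivD[OF rd(4) rt]
          rderivD[OF rd(5) rt] rderivD[OF rd'(1) rt] rderivD[OF rd'(2) rt] rderivD[OF rd_q rt] simp: algebra_simps)
  qed (use bc t in auto)
  then have "integral {0..1} (\<lambda>r. ?e' r t / 2 + 4 * \<mu> * ?d r t) = 0" by (rule integral_unique)
  moreover have i: "cont2 (\<lambda>r t. ?e' r t / 2)" "cont2 (\<lambda>r t. 4 * \<mu> * ?d r t)" by (intro cont2_intros c; simp)+
  have "integral {0..1} (\<lambda>r. ?e' r t / 2 + 4 * \<mu> * ?d r t) = integral {0..1} (\<lambda>r. ?e' r t / 2) + integral {0..1} (\<lambda>r. 4 * \<mu> * ?d r t)"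
    by (rule Henstock_Kurzweil_Integration.integral_add[OF cont2_integrable[OF i(1) t] cont2_integrable[OF i(2) t]])
  ultimately have "1/2 * integral {0..1} (\<lambda>r. ?e' r t) = - 4 * \<mu> * integral {0..1} (\<lambda>r. ?d r t)" by simp
  then show ?thesis by (rule DERIV_cong[OF 1])
qed

lemma entropy_deriv:
  assumes t: "t > 0"
  shows "(entropy_at has_real_derivative - 4 * \<mu> * \<sigma> * Y t + 2 * \<mu> * integral {0..1} (\<lambda>r. w r t * h1 r t * v r t)) (at t)"
proof -
  let ?e' = "\<lambda>r t. (q r t * (w r t)\<^sup>2 + 2 * w r t * (h r t * wt r t) + 2 * \<sigma> * h1 r t * q1 r t) * r"
  let ?y = "\<lambda>r t. r * (h2 r t + P r t)\<^sup>2" and ?c = "\<lambda>r t. w r t * h1 r t * v r t"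
  have c: "cont2 ?e'" "cont2 ?y" "cont2 ?c" "cont2 (\<lambda>r t. (h r t * (w r t)\<^sup>2 + \<sigma> * (h1 r t)\<^sup>2) * r)"
    by (intro cont2_intros ct ct' cts)+
  have "tderiv (\<lambda>r t. (h r t * (w r t)\<^sup>2 + \<sigma> * (h1 r t)\<^sup>2) * r) ?e'"
    unfolding tderiv_def
  proof (intro ballI allI impI)
    fix r t :: real assume r: "r \<in> {0..1}" "t > 0"
    show "((\<lambda>t. (h r t * (w r t)\<^sup>2 + \<sigma> * (h1 r t)\<^sup>2) * r) has_real_derivative ?e' r t) (at t)"
      by (auto intro!: derivative_eq_intros tderivD[OF td_h r] tderivD[OF td_h1 r] tderivD[OF td_w r] simp: algebra_simps)
  qed
  from integral_has_tderiv[OF this c(4,1) t]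
  have 1: "(entropy_at has_real_derivative 1/2 * integral {0..1} (\<lambda>r. ?e' r t)) (at t)"
    unfolding entropy_at_def[abs_def] by (rule DERIV_cmult)
  let ?\<Psi> = "\<lambda>r. - 1/2 * (r * h r t * v r t * (w r t)\<^sup>2) +
      \<sigma> * ((r * h r t * v r t + 4 * \<mu> * (r * h1 r t)) * (h2 r t + P r t) + r * h1 r t * q r t)"
  have "((\<lambda>r. ?e' r t / 2 + 4 * \<mu> * \<sigma> * ?y r t - 2 * \<mu> * ?c r t) has_integral 0) {0..1}"
  proof (rule integral_rderiv_vanishing[of ?\<Psi>])
    fix r :: real assume r: "r \<in> {0..1}"
    note rt = r t
    have hf: "h r t * f r t = h1 r t" using h_nz[OF rt] by (simp add: f_def)
    have hwr: "h r t * wr r t = h r t * v1 r t + 4 * \<mu> * (h2 r t - f r t * h1 r t)"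
      using h_nz[OF rt] by (simp add: wr_def fr_def distrib_left)
    have hwt: "h r t * wt r t = h r t * z r t + 4 * \<mu> * (q1 r t - f r t * q r t)"
      using h_nz[OF rt] by (simp add: wt_def ft_def distrib_left)
    show "(?\<Psi> has_real_derivative ?e' r t / 2 + 4 * \<mu> * \<sigma> * ?y r t - 2 * \<mu> * ?c r t) (at r within {0..1})"
      unfolding entropy_identity[OF hz_eq[OF rt] q_def q1_def v1_eq[OF rt] h2_eq[OF rt] v_eq[OF rt] h1_eq[OF rt] hf w_def hwr hwt, symmetric]
      by (auto intro!: derivative_eq_intros rderivD[OF rd(1) rt] rderivD[OF rd(2) rt] rderivD[OF rd(3) rt] rderivD[OF rd(4) rt]
          rderivD[OF rd(5) rt] rderivD[OF rd'(1) rt] rderivD[OF rd'(2) rt] rderivD[OF rd_q rt] rderivD[OF rd_w rt] simp: algebra_simps)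
  qed (use bc t in auto)
  then have "integral {0..1} (\<lambda>r. ?e' r t / 2 + 4 * \<mu> * \<sigma> * ?y r t - 2 * \<mu> * ?c r t) = 0" by (rule integral_unique)
  moreover have i: "cont2 (\<lambda>r t. ?e' r t / 2)" "cont2 (\<lambda>r t. 4 * \<mu> * \<sigma> * ?y r t)" "cont2 (\<lambda>r t. 2 * \<mu> * ?c r t)"
    "cont2 (\<lambda>r t. ?e' r t / 2 + 4 * \<mu> * \<sigma> * ?y r t)" by (intro cont2_intros c; simp)+
  moreover have "integral {0..1} (\<lambda>r. ?e' r t / 2 + 4 * \<mu> * \<sigma> * ?y r t - 2 * \<mu> * ?c r t) =
     integral {0..1} (\<lambda>r. ?e' r t / 2 + 4 * \<mu> * \<sigma> * ?y r t) - integral {0..1} (\<lambda>r. 2 * \<mu> * ?c r t)"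
    by (rule Henstock_Kurzweil_Integration.integral_diff[OF cont2_integrable[OF i(4) t] cont2_integrable[OF i(3) t]])
  moreover have "integral {0..1} (\<lambda>r. ?e' r t / 2 + 4 * \<mu> * \<sigma> * ?y r t) = integral {0..1} (\<lambda>r. ?e' r t / 2) + integral {0..1} (\<lambda>r. 4 * \<mu> * \<sigma> * ?y r t)"
    by (rule Henstock_Kurzweil_Integration.integral_add[OF cont2_integrable[OF i(1) t] cont2_integrable[OF i(2) t]])
  ultimately have "1/2 * integral {0..1} (\<lambda>r. ?e' r t) = - 4 * \<mu> * \<sigma> * Y t + 2 * \<mu> * integral {0..1} (\<lambda>r. ?c r t)"
    unfolding Y_def by simp
  then show ?thesis by (rule DERIV_cong[OF 1])
qed

end

section \<open>Dissipation and exponential decay for positive times\<close>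

context radial_flow
begin

lemma XY_nonneg: assumes t: "t > 0" shows "X t \<ge> 0" "Y t \<ge> 0"
proof -
  have "0 \<le> h r t * (v r t * V r t + r * (v1 r t)\<^sup>2)" if "r \<in> {0..1}" for r
    using h_pos[OF that t] that v_eq[OF that t] by (auto simp: mult.assoc intro!: mult_nonneg_nonneg add_nonneg_nonneg)
  moreover have "(\<lambda>r. h r t * (v r t * V r t + r * (v1 r t)\<^sup>2)) integrable_on {0..1}"
    by (rule cont2_integrable[OF _ t, of "\<lambda>r t. h r t * (v r t * V r t + r * (v1 r t)\<^sup>2)"]) (intro cont2_intros ct ct')
  ultimately show "X t \<ge> 0" unfolding X_def by (intro Henstock_Kurzweil_Integration.integral_nonneg) auto
  show "Y t \<ge> 0" unfolding Y_def
    by (intro Henstock_Kurzweil_Integration.integral_nonneg cont2_integrable[OF _ t, of "\<lambda>r t. r * (h2 r t + P r t)\<^sup>2"])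
      (auto intro!: cont2_intros ct ct')
qed

lemma integral_mono_cont2:
  assumes "cont2 F" "cont2 G" "t > 0" "\<And>r. r \<in> {0..1} \<Longrightarrow> F r t \<le> G r t"
  shows "integral {0..1} (\<lambda>r. F r t) \<le> integral {0..1} (\<lambda>r. G r t)"
  using assms by (intro integral_le cont2_integrable) auto

lemma integral_cmult_cont2: "integral {0..1} (\<lambda>r. c * G r) = c * integral {0..1} G" for c :: real and G :: "real \<Rightarrow> real"
  by simp

lemma integral_add_cont2:
  assumes "cont2 F" "cont2 G" "t > 0"
  shows "integral {0..1} (\<lambda>r. F r t + G r t) = integral {0..1} (\<lambda>r. F r t) + integral {0..1} (\<lambda>r. G r t)"
  using assms by (intro Henstock_Kurzweil_Integration.integral_add cont2_integrable)

lemma cross_v: "r \<in> {0..1} \<Longrightarrow> t > 0 \<Longrightarrow> 2 * \<bar>v r t * v1 r t\<bar> \<le> v r t * V r t + r * (v1 r t)\<^sup>2"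
proof -
  assume r: "r \<in> {0..1}" "t > 0"
  have "0 \<le> r * (V r t + v1 r t)\<^sup>2" "0 \<le> r * (V r t - v1 r t)\<^sup>2" using r by auto
  then have "- (2 * (v r t * v1 r t)) \<le> v r t * V r t + r * (v1 r t)\<^sup>2" "2 * (v r t * v1 r t) \<le> v r t * V r t + r * (v1 r t)\<^sup>2"
    unfolding v_eq[OF r] by (simp_all add: power2_sum power2_diff power2_eq_square algebra_simps)
  then show ?thesis by linarith
qed

lemma X_cont: "cont2 (\<lambda>r t. h r t * (v r t * V r t + r * (v1 r t)\<^sup>2))"
  and d_cont: "cont2 (\<lambda>r t. v r t * V r t + r * (v1 r t)\<^sup>2)"
  and vv_cont: "cont2 (\<lambda>r t. h r t * (v r t * v1 r t))"
  and Y_cont: "cont2 (\<lambda>r t. r * (h2 r t + P r t)\<^sup>2)"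
  and rP_cont: "cont2 (\<lambda>r t. r * (P r t)\<^sup>2)"
  and rh1_cont: "cont2 (\<lambda>r t. r * (h1 r t)\<^sup>2)"
  and hv_cont: "cont2 (\<lambda>r t. r * (h r t * (v r t)\<^sup>2))"
  by (intro cont2_intros ct ct')+

lemma hvv_bound:
  assumes t: "t > 0"
  shows "\<bar>integral {0..1} (\<lambda>r. h r t * (v r t * v1 r t))\<bar> \<le> X t / 2"
proof -
  have c2: "cont2 (\<lambda>r t. 1/2 * (h r t * (v r t * V r t + r * (v1 r t)\<^sup>2)))"
     "cont2 (\<lambda>r t. (-1/2) * (h r t * (v r t * V r t + r * (v1 r t)\<^sup>2)))" by (intro cont2_intros ct ct')+
  have "\<bar>h r t * (v r t * v1 r t)\<bar> \<le> 1/2 * (h r t * (v r t * V r t + r * (v1 r t)\<^sup>2))" if "r \<in> {0..1}" for r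
    using mult_left_mono[OF cross_v[OF that t], of "h r t"] h_pos[OF that t] by (simp add: abs_mult mult_ac)
  then have p: "h r t * (v r t * v1 r t) \<le> 1/2 * (h r t * (v r t * V r t + r * (v1 r t)\<^sup>2))"
      "(-1/2) * (h r t * (v r t * V r t + r * (v1 r t)\<^sup>2)) \<le> h r t * (v r t * v1 r t)" if "r \<in> {0..1}" for r
    using that by (fastforce simp: abs_le_iff)+
  have "integral {0..1} (\<lambda>r. h r t * (v r t * v1 r t)) \<le> integral {0..1} (\<lambda>r. 1/2 * (h r t * (v r t * V r t + r * (v1 r t)\<^sup>2)))"
    by (rule integral_mono_cont2[OF vv_cont c2(1) t]) (rule p(1))
  moreover have "integral {0..1} (\<lambda>r. (-1/2) * (h r t * (v r t * V r t + r * (v1 r t)\<^sup>2))) \<le> integral {0..1} (\<lambda>r. h r t * (v r t * v1 r t))"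
    by (rule integral_mono_cont2[OF c2(2) vv_cont t]) (rule p(2))
  ultimately show ?thesis
    unfolding integral_cmult_cont2 X_def by (simp only: abs_le_iff) linarith
qed

lemma energy_deriv_le:
  assumes t: "t > 0"
  shows "\<exists>D. (energy_at has_real_derivative D) (at t) \<and> D \<le> - 2 * \<mu> * X t"
proof -
  have "integral {0..1} (\<lambda>r. h r t * (v r t * V r t + r * (v1 r t)\<^sup>2 + v r t * v1 r t)) = X t + integral {0..1} (\<lambda>r. h r t * (v r t * v1 r t))"
    unfolding X_def by (subst integral_add_cont2[OF X_cont vv_cont t, symmetric]) (simp add: distrib_left)
  then have "integral {0..1} (\<lambda>r. h r t * (v r t * V r t + r * (v1 r t)\<^sup>2 + v r t * v1 r t)) \<ge> X t / 2"
    using hvv_bound[OF t] by linarith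
  then have "4 * \<mu> * integral {0..1} (\<lambda>r. h r t * (v r t * V r t + r * (v1 r t)\<^sup>2 + v r t * v1 r t)) \<ge> 4 * \<mu> * (X t / 2)"
    using pos by (intro mult_left_mono) auto
  then have "- 4 * \<mu> * integral {0..1} (\<lambda>r. h r t * (v r t * V r t + r * (v1 r t)\<^sup>2 + v r t * v1 r t)) \<le> - 2 * \<mu> * X t"
    by simp
  with energy_deriv[OF t] show ?thesis by blast
qed

text \<open>\<open>v\<^sup>2\<close> is the integral of \<open>2 v v\<^sub>r\<close> from \<open>0\<close>, and \<open>2 v v\<^sub>r \<le> v\<^sup>2/r + r v\<^sub>r\<^sup>2\<close>.\<close>

lemma v_sup:
  assumes r: "r \<in> {0..1}" and t: "t > 0"
  shows "(v r t)\<^sup>2 \<le> X t / m"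
proof -
  have sub: "{0..r} \<subseteq> {0..1}" using r by auto
  have i1: "(\<lambda>r. v r t * V r t + r * (v1 r t)\<^sup>2) integrable_on {0..1}" by (rule cont2_integrable[OF d_cont t])
  have i2: "(\<lambda>r. v r t * V r t + r * (v1 r t)\<^sup>2) integrable_on {0..r}" by (rule integrable_on_subinterval[OF i1 sub])
  have "((\<lambda>x. 2 * (v x t * v1 x t)) has_integral (v r t)\<^sup>2 - (v 0 t)\<^sup>2) {0..r}"
  proof (rule fundamental_theorem_of_calculus)
    show "((\<lambda>x. (v x t)\<^sup>2) has_vector_derivative 2 * (v x t * v1 x t)) (at x within {0..r})" if "x \<in> {0..r}" for x
    proof -
      have x: "x \<in> {0..1}" using that sub by auto
      have "((\<lambda>x. (v x t)\<^sup>2) has_real_derivative 2 * (v x t * v1 x t)) (at x within {0..1})"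
        by (auto intro!: derivative_eq_intros rderivD[OF rd(4) x t])
      then show ?thesis unfolding has_real_derivative_iff_has_vector_derivative
        by (rule has_vector_derivative_within_subset[OF _ sub])
    qed
  qed (use r in auto)
  then have vi: "((\<lambda>x. 2 * (v x t * v1 x t)) has_integral (v r t)\<^sup>2) {0..r}" using bc(3)[OF t] by simp
  have "(v r t)\<^sup>2 \<le> integral {0..r} (\<lambda>r. v r t * V r t + r * (v1 r t)\<^sup>2)"
  proof (rule has_integral_le[OF vi integrable_integral[OF i2]])
    fix x assume "x \<in> {0..r}"
    then have "x \<in> {0..1}" using r by simp
    from cross_v[OF this t] show "2 * (v x t * v1 x t) \<le> v x t * V x t + x * (v1 x t)\<^sup>2" by linarith
  qed
  also have "\<dots> \<le> integral {0..1} (\<lambda>r. v r t * V r t + r * (v1 r t)\<^sup>2)"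
  proof (rule integral_subset_le[OF sub i2 i1], rule ballI)
    fix x :: real assume that: "x \<in> {0..1}"
    show "0 \<le> v x t * V x t + x * (v1 x t)\<^sup>2"
      using v_eq[OF that t] that by (auto simp: mult.assoc)
  qed
  also have "\<dots> \<le> integral {0..1} (\<lambda>r. (1/m) * (h r t * (v r t * V r t + r * (v1 r t)\<^sup>2)))"
  proof (rule integral_mono_cont2[OF d_cont _ t])
    show "cont2 (\<lambda>r t. (1/m) * (h r t * (v r t * V r t + r * (v1 r t)\<^sup>2)))" by (intro cont2_intros ct ct')
    fix r :: real assume r: "r \<in> {0..1}"
    have "0 \<le> v r t * V r t + r * (v1 r t)\<^sup>2" using v_eq[OF r t] r by (auto simp: mult.assoc)
    then have "m * (v r t * V r t + r * (v1 r t)\<^sup>2) \<le> h r t * (v r t * V r t + r * (v1 r t)\<^sup>2)"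
      using low[OF r t] by (intro mult_right_mono)
    then show "v r t * V r t + r * (v1 r t)\<^sup>2 \<le> (1/m) * (h r t * (v r t * V r t + r * (v1 r t)\<^sup>2))"
      using pos by (simp add: pos_le_divide_eq mult.commute)
  qed
  also have "\<dots> = X t / m" unfolding integral_cmult_cont2 X_def by simp
  finally show ?thesis .
qed

text \<open>Expanding the square gives \<open>r h\<^sub>r\<^sub>r\<^sup>2 + (h\<^sub>r\<^sup>2)\<^sub>r + h\<^sub>r\<^sup>2 / r\<close>, and the middle term integrates to zero.\<close>

lemma Y_lower:
  assumes t: "t > 0"
  shows "integral {0..1} (\<lambda>r. r * (P r t)\<^sup>2) \<le> Y t"
proof -
  have c: "cont2 (\<lambda>r t. r * (P r t)\<^sup>2 + 2 * (h1 r t * h2 r t))" "cont2 (\<lambda>r t. 2 * (h1 r t * h2 r t))" by (intro cont2_intros ct ct')+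
  have "((\<lambda>r. 2 * (h1 r t * h2 r t)) has_integral 0) {0..1}"
    by (rule integral_rderiv_vanishing[of "\<lambda>r. (h1 r t)\<^sup>2"])
      (use bc t in \<open>auto intro!: derivative_eq_intros rderivD[OF rd(2) _ t]\<close>)
  then have z: "integral {0..1} (\<lambda>r. 2 * (h1 r t * h2 r t)) = 0" by (rule integral_unique)
  have "integral {0..1} (\<lambda>r. r * (P r t)\<^sup>2) = integral {0..1} (\<lambda>r. r * (P r t)\<^sup>2 + 2 * (h1 r t * h2 r t))"
    unfolding integral_add_cont2[OF rP_cont c(2) t] z by simp
  also have "\<dots> \<le> Y t" unfolding Y_def
  proof (rule integral_mono_cont2[OF c(1) Y_cont t])
    fix r :: real assume r: "r \<in> {0..1}"
    have "0 \<le> r * (h2 r t)\<^sup>2" using r by auto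
    then show "r * (P r t)\<^sup>2 + 2 * (h1 r t * h2 r t) \<le> r * (h2 r t + P r t)\<^sup>2"
      unfolding h1_eq[OF r t] by (simp add: power2_eq_square algebra_simps)
  qed
  finally show ?thesis .
qed

lemma energy_split:
  assumes t: "t > 0"
  shows "energy_at t = 1/2 * integral {0..1} (\<lambda>r. r * (h r t * (v r t)\<^sup>2)) + \<sigma>/2 * integral {0..1} (\<lambda>r. r * (h1 r t)\<^sup>2)"
    and "0 \<le> integral {0..1} (\<lambda>r. r * (h r t * (v r t)\<^sup>2))" and "0 \<le> integral {0..1} (\<lambda>r. r * (h1 r t)\<^sup>2)"
proof -
  have c: "cont2 (\<lambda>r t. \<sigma> * (r * (h1 r t)\<^sup>2))" by (intro cont2_intros ct)
  have "integral {0..1} (\<lambda>r. (h r t * (v r t)\<^sup>2 + \<sigma> * (h1 r t)\<^sup>2) * r) = integral {0..1} (\<lambda>r. r * (h r t * (v r t)\<^sup>2) + \<sigma> * (r * (h1 r t)\<^sup>2))"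
    by (simp add: algebra_simps)
  also have "\<dots> = integral {0..1} (\<lambda>r. r * (h r t * (v r t)\<^sup>2)) + \<sigma> * integral {0..1} (\<lambda>r. r * (h1 r t)\<^sup>2)"
    unfolding integral_add_cont2[OF hv_cont c t] integral_cmult_cont2 ..
  finally have "integral {0..1} (\<lambda>r. (h r t * (v r t)\<^sup>2 + \<sigma> * (h1 r t)\<^sup>2) * r) = \<dots>" .
  then show "energy_at t = 1/2 * integral {0..1} (\<lambda>r. r * (h r t * (v r t)\<^sup>2)) + \<sigma>/2 * integral {0..1} (\<lambda>r. r * (h1 r t)\<^sup>2)"
    unfolding energy_at_def by simp
  show "0 \<le> integral {0..1} (\<lambda>r. r * (h r t * (v r t)\<^sup>2))"
    by (rule Henstock_Kurzweil_Integration.integral_nonneg[OF cont2_integrable[OF hv_cont t]])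
      (use h_pos[OF _ t] in \<open>force intro!: mult_nonneg_nonneg\<close>)
  show "0 \<le> integral {0..1} (\<lambda>r. r * (h1 r t)\<^sup>2)"
    by (rule Henstock_Kurzweil_Integration.integral_nonneg[OF cont2_integrable[OF rh1_cont t]]) auto
qed

lemma h1_le_Y:
  assumes t: "t > 0"
  shows "integral {0..1} (\<lambda>r. r * (h1 r t)\<^sup>2) \<le> Y t"
proof (rule order_trans[OF integral_mono_cont2[OF rh1_cont rP_cont t] Y_lower[OF t]])
  fix r :: real assume r: "r \<in> {0..1}"
  have "(h1 r t)\<^sup>2 \<le> (P r t)\<^sup>2" unfolding h1_eq[OF r t] power_mult_distrib using r
    by (intro mult_left_le_one_le) (auto simp: power_le_one)
  then show "r * (h1 r t)\<^sup>2 \<le> r * (P r t)\<^sup>2" using r by (intro mult_left_mono) auto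
qed

lemma hv2_le_X:
  assumes t: "t > 0"
  shows "integral {0..1} (\<lambda>r. r * (h r t * (v r t)\<^sup>2)) \<le> X t"
  unfolding X_def
proof (rule integral_mono_cont2[OF hv_cont X_cont t])
  fix r :: real assume r: "r \<in> {0..1}"
  have "r * (v r t)\<^sup>2 \<le> v r t * V r t"
  proof -
    have "r * (v r t)\<^sup>2 = r\<^sup>2 * (r * (V r t)\<^sup>2)" unfolding v_eq[OF r t] by (simp add: power2_eq_square)
    also have "\<dots> \<le> r * (V r t)\<^sup>2" using r by (intro mult_left_le_one_le) (auto simp: power_le_one)
    also have "\<dots> = v r t * V r t" unfolding v_eq[OF r t] by (simp add: power2_eq_square)
    finally show ?thesis .
  qed
  moreover have "0 \<le> r * (v1 r t)\<^sup>2" using r by simp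
  ultimately have "h r t * (r * (v r t)\<^sup>2) \<le> h r t * (v r t * V r t + r * (v1 r t)\<^sup>2)"
    using h_pos[OF r t] by (intro mult_left_mono) linarith+
  then show "r * (h r t * (v r t)\<^sup>2) \<le> h r t * (v r t * V r t + r * (v1 r t)\<^sup>2)" by (simp add: mult_ac)
qed

lemma energy_le: "t > 0 \<Longrightarrow> energy_at t \<le> 1/2 * X t + \<sigma>/2 * Y t"
proof -
  assume t: "t > 0"
  have "\<sigma>/2 * integral {0..1} (\<lambda>r. r * (h1 r t)\<^sup>2) \<le> \<sigma>/2 * Y t"
    using h1_le_Y[OF t] pos(1) by (intro mult_left_mono) auto
  then show ?thesis using energy_split(1)[OF t] hv2_le_X[OF t] by linarith
qed

lemma energy_nonneg: "t > 0 \<Longrightarrow> energy_at t \<ge> 0"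
  using energy_split[of t] pos(1) by simp

lemma h1_le_energy: "t > 0 \<Longrightarrow> integral {0..1} (\<lambda>r. r * (h1 r t)\<^sup>2) \<le> 2 * energy_at t / \<sigma>"
  using energy_split[of t] pos(1) by (simp add: field_simps)

lemma v_le_energy: assumes t: "t > 0" shows "integral {0..1} (\<lambda>r. r * (v r t)\<^sup>2) \<le> 2 * energy_at t / m"
proof -
  have "integral {0..1} (\<lambda>r. m * (r * (v r t)\<^sup>2)) \<le> integral {0..1} (\<lambda>r. r * (h r t * (v r t)\<^sup>2))"
  proof (rule integral_mono_cont2[OF _ hv_cont t])
    show "cont2 (\<lambda>r t. m * (r * (v r t)\<^sup>2))" by (intro cont2_intros ct)
    show "m * (r * (v r t)\<^sup>2) \<le> r * (h r t * (v r t)\<^sup>2)" if "r \<in> {0..1}" for r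
      using mult_right_mono[OF low[OF that t], of "r * (v r t)\<^sup>2"] that by (simp add: mult_ac)
  qed
  then have "m * integral {0..1} (\<lambda>r. r * (v r t)\<^sup>2) \<le> 2 * energy_at t"
  proof -
    assume "integral {0..1} (\<lambda>r. m * (r * (v r t)\<^sup>2)) \<le> integral {0..1} (\<lambda>r. r * (h r t * (v r t)\<^sup>2))"
    moreover have "0 \<le> \<sigma>/2 * integral {0..1} (\<lambda>r. r * (h1 r t)\<^sup>2)" using energy_split(3)[OF t] pos(1) by simp
    ultimately show ?thesis unfolding integral_cmult_cont2 using energy_split(1)[OF t] by linarith
  qed
  then show ?thesis using pos(3) by (simp add: field_simps)
qed

lemma entropy_nonneg: assumes t: "t > 0" shows "entropy_at t \<ge> 0"
proof -
  have "cont2 (\<lambda>r t. (h r t * (w r t)\<^sup>2 + \<sigma> * (h1 r t)\<^sup>2) * r)" by (intro cont2_intros ct cts)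
  then have "(\<lambda>r. (h r t * (w r t)\<^sup>2 + \<sigma> * (h1 r t)\<^sup>2) * r) integrable_on {0..1}" by (rule cont2_integrable[OF _ t])
  moreover have "0 \<le> (h r t * (w r t)\<^sup>2 + \<sigma> * (h1 r t)\<^sup>2) * r" if r: "r \<in> {0..1}" for r
    using h_pos[OF r t] pos(1) r by (intro mult_nonneg_nonneg add_nonneg_nonneg) auto
  ultimately have "0 \<le> integral {0..1} (\<lambda>r. (h r t * (w r t)\<^sup>2 + \<sigma> * (h1 r t)\<^sup>2) * r)"
    by (rule Henstock_Kurzweil_Integration.integral_nonneg)
  then show ?thesis unfolding entropy_at_def by simp
qed

lemma entropy_le: assumes t: "t > 0" shows "entropy_at t \<le> X t + (16 * \<mu>\<^sup>2 / m + \<sigma>/2) * Y t"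
proof -
  have c: "cont2 (\<lambda>r t. 2 * (r * (h r t * (v r t)\<^sup>2)) + (32 * \<mu>\<^sup>2 / m + \<sigma>) * (r * (h1 r t)\<^sup>2))"
    "cont2 (\<lambda>r t. 2 * (r * (h r t * (v r t)\<^sup>2)))" "cont2 (\<lambda>r t. (32 * \<mu>\<^sup>2 / m + \<sigma>) * (r * (h1 r t)\<^sup>2))"
    by (intro cont2_intros ct)+
  have "integral {0..1} (\<lambda>r. (h r t * (w r t)\<^sup>2 + \<sigma> * (h1 r t)\<^sup>2) * r) \<le>
      integral {0..1} (\<lambda>r. 2 * (r * (h r t * (v r t)\<^sup>2)) + (32 * \<mu>\<^sup>2 / m + \<sigma>) * (r * (h1 r t)\<^sup>2))"
  proof (rule integral_mono_cont2[OF _ c(1) t])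
    show "cont2 (\<lambda>r t. (h r t * (w r t)\<^sup>2 + \<sigma> * (h1 r t)\<^sup>2) * r)" by (intro cont2_intros ct cts)
    fix r :: real assume r: "r \<in> {0..1}"
    have "(w r t)\<^sup>2 \<le> 2 * (v r t)\<^sup>2 + 2 * (4 * \<mu> * f r t)\<^sup>2"
      using zero_le_power2[of "v r t - 4 * \<mu> * f r t"] unfolding w_def power2_sum power2_diff by linarith
    then have "h r t * (w r t)\<^sup>2 \<le> h r t * (2 * (v r t)\<^sup>2 + 2 * (4 * \<mu> * f r t)\<^sup>2)"
      using h_pos[OF r t] by (intro mult_left_mono) auto
    also have "\<dots> = 2 * (h r t * (v r t)\<^sup>2) + 32 * \<mu>\<^sup>2 * ((h1 r t)\<^sup>2 / h r t)"
      using h_nz[OF r t] by (simp add: f_def field_simps power2_eq_square)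
    also have "\<dots> \<le> 2 * (h r t * (v r t)\<^sup>2) + 32 * \<mu>\<^sup>2 * ((h1 r t)\<^sup>2 / m)"
      using low[OF r t] pos h_pos[OF r t] by (intro add_left_mono mult_left_mono divide_left_mono) auto
    finally have "h r t * (w r t)\<^sup>2 + \<sigma> * (h1 r t)\<^sup>2 \<le> 2 * (h r t * (v r t)\<^sup>2) + (32 * \<mu>\<^sup>2 / m + \<sigma>) * (h1 r t)\<^sup>2"
      by (simp add: algebra_simps)
    then have "(h r t * (w r t)\<^sup>2 + \<sigma> * (h1 r t)\<^sup>2) * r \<le> (2 * (h r t * (v r t)\<^sup>2) + (32 * \<mu>\<^sup>2 / m + \<sigma>) * (h1 r t)\<^sup>2) * r"
      using r by (intro mult_right_mono) auto
    then show "(h r t * (w r t)\<^sup>2 + \<sigma> * (h1 r t)\<^sup>2) * r \<le> 2 * (r * (h r t * (v r t)\<^sup>2)) + (32 * \<mu>\<^sup>2 / m + \<sigma>) * (r * (h1 r t)\<^sup>2)"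
      by (simp add: algebra_simps)
  qed
  also have "\<dots> = 2 * integral {0..1} (\<lambda>r. r * (h r t * (v r t)\<^sup>2)) + (32 * \<mu>\<^sup>2 / m + \<sigma>) * integral {0..1} (\<lambda>r. r * (h1 r t)\<^sup>2)"
    unfolding integral_add_cont2[OF c(2,3) t] integral_cmult_cont2 ..
  also have "\<dots> \<le> 2 * X t + (32 * \<mu>\<^sup>2 / m + \<sigma>) * Y t"
    using hv2_le_X[OF t] h1_le_Y[OF t] pos by (intro add_mono mult_left_mono) auto
  finally show ?thesis unfolding entropy_at_def by (simp add: algebra_simps)
qed

text \<open>The only term of the entropy balance without a sign. It is cubic; the energy bound takes one
  factor, so that the rest is controlled by the dissipation.\<close>

lemma cross_term:
  assumes t: "t > 0" and Em: "energy_at t \<le> Em"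
  shows "2 * \<mu> * integral {0..1} (\<lambda>r. w r t * h1 r t * v r t) \<le> 2 * \<mu> * \<sigma> * Y t + (2 * \<mu> + cross_const \<sigma> \<mu> m Em) * X t"
proof -
  \<comment> \<open>The weight in Young's inequality that makes the coefficient of \<open>Y\<close> equal to \<open>2 \<mu> \<sigma>\<close>, half of
    the capillary dissipation.\<close>
  define \<alpha> where "\<alpha> = \<sigma> * m / (2 * \<mu>)"
  have \<alpha>: "\<alpha> > 0" using pos by (simp add: \<alpha>_def)
  define B where "B = X t / (2 * \<alpha> * m)"
  have B: "B \<ge> 0" unfolding B_def using XY_nonneg[OF t] \<alpha> pos by simp
  have c: "cont2 (\<lambda>r t. h1 r t * (v r t)\<^sup>2)" "cont2 (\<lambda>r t. 4 * \<mu> * (f r t * h1 r t * v r t))" "cont2 (\<lambda>r t. f r t * h1 r t * v r t)"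
     "cont2 (\<lambda>r t. \<alpha>/(2*m) * (r * (P r t)\<^sup>2))" "cont2 (\<lambda>r t. B/m * (r * (h1 r t)\<^sup>2))" "cont2 (\<lambda>r t. 2 * (h r t * (v r t * v1 r t)))"
     "cont2 (\<lambda>r t. \<alpha>/(2*m) * (r * (P r t)\<^sup>2) + B/m * (r * (h1 r t)\<^sup>2))"
    by (intro cont2_intros ct cts ct')+
  have "integral {0..1} (\<lambda>r. w r t * h1 r t * v r t) = integral {0..1} (\<lambda>r. h1 r t * (v r t)\<^sup>2 + 4 * \<mu> * (f r t * h1 r t * v r t))"
    unfolding w_def by (simp add: algebra_simps power2_eq_square)
  also have "\<dots> = integral {0..1} (\<lambda>r. h1 r t * (v r t)\<^sup>2) + 4 * \<mu> * integral {0..1} (\<lambda>r. f r t * h1 r t * v r t)"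
    unfolding integral_add_cont2[OF c(1,2) t] integral_cmult_cont2 ..
  finally have split: "integral {0..1} (\<lambda>r. w r t * h1 r t * v r t) = \<dots>" .
  have "((\<lambda>r. h1 r t * (v r t)\<^sup>2 + 2 * (h r t * (v r t * v1 r t))) has_integral 0) {0..1}"
    by (rule integral_rderiv_vanishing[of "\<lambda>r. h r t * (v r t)\<^sup>2"])
      (use bc t in \<open>auto intro!: derivative_eq_intros rderivD[OF rd(1) _ t] rderivD[OF rd(4) _ t] simp: algebra_simps\<close>)
  then have "integral {0..1} (\<lambda>r. h1 r t * (v r t)\<^sup>2) + 2 * integral {0..1} (\<lambda>r. h r t * (v r t * v1 r t)) = 0"
    using integral_add_cont2[OF c(1) c(6) t] by (simp add: integral_unique)
  then have 1: "integral {0..1} (\<lambda>r. h1 r t * (v r t)\<^sup>2) \<le> X t" using hvv_bound[OF t] by linarith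
  have "integral {0..1} (\<lambda>r. f r t * h1 r t * v r t) \<le> integral {0..1} (\<lambda>r. \<alpha>/(2*m) * (r * (P r t)\<^sup>2) + B/m * (r * (h1 r t)\<^sup>2))"
  proof (rule integral_mono_cont2[OF c(3) c(7) t])
    fix r :: real assume r: "r \<in> {0..1}"
    have "f r t * h1 r t * v r t = (h1 r t)\<^sup>2 / h r t * v r t" by (simp add: f_def power2_eq_square)
    also have "\<dots> \<le> (h1 r t)\<^sup>2 / h r t * \<bar>v r t\<bar>" using h_pos[OF r t] by (intro mult_left_mono) auto
    also have "\<dots> = \<bar>v r t\<bar> * (h1 r t)\<^sup>2 / h r t" by simp
    also have "\<dots> \<le> \<bar>v r t\<bar> * (h1 r t)\<^sup>2 / m"
      using low[OF r t] pos h_pos[OF r t] by (intro divide_left_mono) auto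
    also have "\<bar>v r t\<bar> * (h1 r t)\<^sup>2 = r * (\<bar>P r t\<bar> * \<bar>v r t * h1 r t\<bar>)"
      using r by (simp add: h1_eq[OF r t] abs_mult power2_eq_square)
    also have "r * (\<bar>P r t\<bar> * \<bar>v r t * h1 r t\<bar>) \<le> r * (\<alpha>/2 * (P r t)\<^sup>2 + 1/(2*\<alpha>) * (v r t * h1 r t)\<^sup>2)"
    proof (rule mult_left_mono)
      have "0 \<le> (\<alpha> * \<bar>P r t\<bar> - \<bar>v r t * h1 r t\<bar>)\<^sup>2" by simp
      then have "2 * \<alpha> * (\<bar>P r t\<bar> * \<bar>v r t * h1 r t\<bar>) \<le> \<alpha>\<^sup>2 * (P r t)\<^sup>2 + (v r t * h1 r t)\<^sup>2"
        unfolding power2_diff power_mult_distrib power2_abs by (simp add: algebra_simps)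
      then show "\<bar>P r t\<bar> * \<bar>v r t * h1 r t\<bar> \<le> \<alpha>/2 * (P r t)\<^sup>2 + 1/(2*\<alpha>) * (v r t * h1 r t)\<^sup>2"
        using \<alpha> by (simp add: field_simps power2_eq_square)
    qed (use r in auto)
    also have "\<dots> \<le> r * (\<alpha>/2 * (P r t)\<^sup>2 + 1/(2*\<alpha>) * (X t / m * (h1 r t)\<^sup>2))"
      using v_sup[OF r t] r \<alpha> unfolding power_mult_distrib
      by (intro mult_left_mono add_left_mono mult_right_mono) auto
    finally have "f r t * h1 r t * v r t \<le> r * (\<alpha>/2 * (P r t)\<^sup>2 + 1/(2*\<alpha>) * (X t / m * (h1 r t)\<^sup>2)) / m"
      using pos by (simp add: divide_right_mono)
    then show "f r t * h1 r t * v r t \<le> \<alpha>/(2*m) * (r * (P r t)\<^sup>2) + B/m * (r * (h1 r t)\<^sup>2)"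
      using pos \<alpha> by (simp add: B_def field_simps)
  qed
  also have "\<dots> = \<alpha>/(2*m) * integral {0..1} (\<lambda>r. r * (P r t)\<^sup>2) + B/m * integral {0..1} (\<lambda>r. r * (h1 r t)\<^sup>2)"
    unfolding integral_add_cont2[OF c(4,5) t] integral_cmult_cont2 ..
  also have "\<dots> \<le> \<alpha>/(2*m) * Y t + B/m * (2 * Em / \<sigma>)"
  proof -
    have "2 * energy_at t / \<sigma> \<le> 2 * Em / \<sigma>" using Em pos by (intro divide_right_mono) auto
    then have "integral {0..1} (\<lambda>r. r * (h1 r t)\<^sup>2) \<le> 2 * Em / \<sigma>" using h1_le_energy[OF t] by linarith
    then show ?thesis using Y_lower[OF t] \<alpha> pos B by (intro add_mono mult_left_mono) auto
  qed
  finally have 2: "integral {0..1} (\<lambda>r. f r t * h1 r t * v r t) \<le> \<alpha>/(2*m) * Y t + B/m * (2 * Em / \<sigma>)" .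
  have "2 * \<mu> * integral {0..1} (\<lambda>r. w r t * h1 r t * v r t) \<le> 2 * \<mu> * (X t + 4 * \<mu> * (\<alpha>/(2*m) * Y t + B/m * (2 * Em / \<sigma>)))"
    unfolding split using 1 2 pos by (intro mult_left_mono add_mono) auto
  also have "\<dots> = 2 * \<mu> * \<sigma> * Y t + (2 * \<mu> + cross_const \<sigma> \<mu> m Em) * X t"
    unfolding B_def \<alpha>_def cross_const_def using pos by (simp add: field_simps power2_eq_square power3_eq_cube)
  finally show ?thesis .
qed

text \<open>The bound \<open>Em\<close> is assumed here; it is supplied by the initial energy once the limit at time
  zero is taken.\<close>

lemma decay:
  assumes E: "\<And>t. t > 0 \<Longrightarrow> energy_at t \<le> Em" and Em: "Em \<ge> 0" and st: "0 < s" "s \<le> t"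
  defines "F \<equiv> \<lambda>t. entropy_at t + energy_weight \<sigma> \<mu> m Em * energy_at t"
  shows "F t \<le> F s * exp (- decay_rate \<sigma> \<mu> m Em * (t - s))"
proof -
  note k = const_pos[OF pos Em]
  let ?b = "decay_rate \<sigma> \<mu> m Em" and ?K = "energy_weight \<sigma> \<mu> m Em" and ?C = "coercivity_const \<sigma> \<mu> m Em"
  have "\<exists>D. ((\<lambda>t. exp (?b * t) * F t) has_real_derivative D) (at t) \<and> D \<le> 0" if t: "t > 0" for t
  proof -
    obtain D1 where D1: "(energy_at has_real_derivative D1) (at t)" "D1 \<le> - 2 * \<mu> * X t" using energy_deriv_le[OF t] by blast
    define D2 where "D2 = - 4 * \<mu> * \<sigma> * Y t + 2 * \<mu> * integral {0..1} (\<lambda>r. w r t * h1 r t * v r t)"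
    have D2: "(entropy_at has_real_derivative D2) (at t)" unfolding D2_def by (rule entropy_deriv[OF t])
    have D2': "D2 \<le> - 2 * \<mu> * \<sigma> * Y t + (2 * \<mu> + cross_const \<sigma> \<mu> m Em) * X t"
      unfolding D2_def using cross_term[OF t E[OF t]] by simp
    have "?K * D1 \<le> ?K * (- 2 * \<mu> * X t)" using D1(2) k(2) by (intro mult_left_mono) auto
    also have "\<dots> = - (2 * \<mu> + cross_const \<sigma> \<mu> m Em) * X t - 2 * \<mu> * X t"
      unfolding energy_weight_def using pos by (simp add: field_simps)
    finally have D: "D2 + ?K * D1 \<le> - 2 * \<mu> * \<sigma> * Y t - 2 * \<mu> * X t" using D2' by (simp add: algebra_simps)
    have "F t \<le> ?C * (X t + Y t)"
    proof -
      have "?K * energy_at t \<le> ?K * (1/2 * X t + \<sigma>/2 * Y t)" using energy_le[OF t] k(2) by (intro mult_left_mono) auto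
      moreover have "X t + (16 * \<mu>\<^sup>2 / m + \<sigma>/2) * Y t + ?K * (1/2 * X t + \<sigma>/2 * Y t) \<le> ?C * (X t + Y t)"
      proof -
        have "?C * (X t + Y t) - (X t + (16 * \<mu>\<^sup>2 / m + \<sigma>/2) * Y t + ?K * (1/2 * X t + \<sigma>/2 * Y t))
          = (16 * \<mu>\<^sup>2 / m + \<sigma> + ?K * (1/2 + \<sigma>)) * X t + (1 + \<sigma>/2 + ?K * (1 + \<sigma>/2)) * Y t"
          unfolding coercivity_const_def by (simp add: algebra_simps add_divide_distrib)
        also have "\<dots> \<ge> 0" using k pos XY_nonneg[OF t] by (intro add_nonneg_nonneg mult_nonneg_nonneg) auto
        finally show ?thesis by simp
      qed
      ultimately show ?thesis unfolding F_def using entropy_le[OF t] by linarith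
    qed
    then have "?b * F t \<le> ?b * (?C * (X t + Y t))" using k by (intro mult_left_mono) auto
    also have "\<dots> = 2 * \<mu> * min 1 \<sigma> * (X t + Y t)" unfolding decay_rate_def using k by simp
    also have "\<dots> \<le> 2 * \<mu> * X t + 2 * \<mu> * \<sigma> * Y t"
    proof -
      have "min 1 \<sigma> * X t \<le> 1 * X t" "min 1 \<sigma> * Y t \<le> \<sigma> * Y t" using XY_nonneg[OF t] by (intro mult_right_mono; simp)+
      then have "min 1 \<sigma> * X t + min 1 \<sigma> * Y t \<le> X t + \<sigma> * Y t" by linarith
      then have "2 * \<mu> * (min 1 \<sigma> * X t + min 1 \<sigma> * Y t) \<le> 2 * \<mu> * (X t + \<sigma> * Y t)" using pos by (intro mult_left_mono) auto
      then show ?thesis by (simp add: algebra_simps)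
    qed
    finally have "?b * F t + (D2 + ?K * D1) \<le> 0" using D by linarith
    then have le: "exp (?b * t) * (?b * F t + (D2 + ?K * D1)) \<le> 0" by (simp add: mult_le_0_iff)
    have "((\<lambda>t. exp (?b * t) * F t) has_real_derivative exp (?b * t) * (?b * F t + (D2 + ?K * D1))) (at t)"
      unfolding F_def by (auto intro!: derivative_eq_intros D1(1) D2 simp: algebra_simps)
    then show ?thesis using le by blast
  qed
  then have "exp (?b * t) * F t \<le> exp (?b * s) * F s"
    using st by (intro DERIV_nonpos_imp_nonincreasing[of s t "\<lambda>t. exp (?b * t) * F t"]) auto
  then have "exp (- ?b * t) * (exp (?b * t) * F t) \<le> exp (- ?b * t) * (exp (?b * s) * F s)" by (intro mult_left_mono) auto
  moreover have "exp (- ?b * t) * exp (?b * t) = 1" by (simp add: exp_add[symmetric])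
  moreover have "exp (- ?b * t) * exp (?b * s) = exp (- ?b * (t - s))"
    unfolding exp_add[symmetric] by (rule arg_cong[where f=exp]) (simp add: right_diff_distrib)
  ultimately show ?thesis by (simp only: mult.assoc[symmetric] mult_1) (simp only: mult.commute)
qed

lemma energy_antimono:
  assumes "0 < s" "s \<le> t" shows "energy_at t \<le> energy_at s"
proof (rule DERIV_nonpos_imp_nonincreasing[OF assms(2)])
  fix x assume "s \<le> x" "x \<le> t"
  then have x: "x > 0" using assms by simp
  then obtain D where "(energy_at has_real_derivative D) (at x)" "D \<le> - 2 * \<mu> * X x" using energy_deriv_le by blast
  moreover have "- 2 * \<mu> * X x \<le> 0" using XY_nonneg[OF x] pos by simp
  ultimately show "\<exists>y. (energy_at has_real_derivative y) (at x) \<and> y \<le> 0" by force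
qed

lemma mass_conserved:
  assumes "0 < s" "s \<le> t"
  shows "integral {0..1} (\<lambda>r. h r t * r) = integral {0..1} (\<lambda>r. h r s * r)"
proof -
  have c: "cont2 (\<lambda>r t. h r t * r)" "cont2 (\<lambda>r t. q r t * r)" by (intro cont2_intros ct cts)+
  have td: "tderiv (\<lambda>r t. h r t * r) (\<lambda>r t. q r t * r)"
    using td_h unfolding tderiv_def by (auto intro!: derivative_eq_intros)
  have zero: "integral {0..1} (\<lambda>r. q r u * r) = 0" if u: "u > 0" for u
  proof (rule integral_unique, rule integral_rderiv_vanishing[of "\<lambda>r. - (r * h r u * v r u)"])
    fix r :: real assume r: "r \<in> {0..1}"
    show "((\<lambda>r. - (r * h r u * v r u)) has_real_derivative q r u * r) (at r within {0..1})"
      unfolding q_def using v_eq[OF r u]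
      by (auto intro!: derivative_eq_intros rderivD[OF rd(1) r u] rderivD[OF rd(4) r u] simp: algebra_simps)
  qed (use bc[OF u] in auto)
  have d: "((\<lambda>t. integral {0..1} (\<lambda>r. h r t * r)) has_real_derivative 0) (at u)" if "u > 0" for u
    using integral_has_tderiv[OF td c that] unfolding zero[OF that] .
  show ?thesis
    using DERIV_nonpos_imp_nonincreasing[OF assms(2), of "\<lambda>t. integral {0..1} (\<lambda>r. h r t * r)"]
      DERIV_nonneg_imp_nondecreasing[OF assms(2), of "\<lambda>t. integral {0..1} (\<lambda>r. h r t * r)"] d assms(1)
    by (smt (verit, ccfv_SIG))
qed

end

section \<open>Classical solutions of the system, and a Poincare inequality on the disc\<close>

lemma C_spaceD:
  assumes "C_space k u"
  obtains D where "D 0 = u" "\<And>j. j < k \<Longrightarrow> rderiv (D j) (D (Suc j))" "\<And>j. j \<le> k \<Longrightarrow> cont2 (D j)"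
  using assms unfolding C_space_def rderiv_def cont2_def split_beta by blast

lemma rderiv_interior:
  assumes "rderiv f f'" "r \<in> {0<..<1}" "t > 0"
  shows "((\<lambda>x. f x t) has_real_derivative f' r t) (at r)"
proof -
  have "r \<in> interior {0..1}" using assms(2) by simp
  moreover have "((\<lambda>x. f x t) has_real_derivative f' r t) (at r within {0..1})"
    using assms unfolding rderiv_def by auto
  ultimately show ?thesis using at_within_interior by metis
qed

lemma deriv_eq_on_unit_interval:
  assumes "\<And>x. x \<in> {0<..<1} \<Longrightarrow> F x = (G x :: real)" "(G has_real_derivative d) (at r)" "r \<in> {0<..<1}"
  shows "deriv F r = d"
proof -
  have "(F has_real_derivative d) (at r)"
    by (rule has_field_derivative_transform_within_open[OF assms(2), of "{0<..<1}"]) (use assms in auto)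
  then show ?thesis by (rule DERIV_imp_deriv)
qed

lemma radial_flow_if_solution:
  assumes sol: "positive_classical_solution \<sigma> \<mu> h0 v0 h v" and pos: "\<sigma> > 0" "\<mu> > 0" "m > 0"
    and low: "\<And>r t. r \<in> unit_interval \<Longrightarrow> t > 0 \<Longrightarrow> h r t \<ge> m"
  obtains h1 h2 h3 v1 v2 where "radial_flow \<sigma> \<mu> m h h1 h2 h3 v v1 v2"
proof -
  have sp: "C_space 3 h" "C_space 2 v" using sol unfolding positive_classical_solution_def by auto
  obtain D where D: "D 0 = h" "\<And>j. j < 3 \<Longrightarrow> rderiv (D j) (D (Suc j))" "\<And>j. j \<le> 3 \<Longrightarrow> cont2 (D j)"
    using C_spaceD[OF sp(1)] by blast
  obtain G where G: "G 0 = v" "\<And>j. j < 2 \<Longrightarrow> rderiv (G j) (G (Suc j))" "\<And>j. j \<le> 2 \<Longrightarrow> cont2 (G j)"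
    using C_spaceD[OF sp(2)] by blast
  define h1 where "h1 = D 1" define h2 where "h2 = D 2" define h3 where "h3 = D 3"
  define v1 where "v1 = G 1" define v2 where "v2 = G 2"
  have rd: "rderiv h h1" "rderiv h1 h2" "rderiv h2 h3" "rderiv v v1" "rderiv v1 v2"
    using D(2)[of 0] D(2)[of 1] D(2)[of 2] G(2)[of 0] G(2)[of 1] D(1) G(1)
    by (simp_all add: h1_def h2_def h3_def v1_def v2_def numeral_2_eq_2 numeral_3_eq_3)
  have ct: "cont2 h" "cont2 h1" "cont2 h2" "cont2 h3" "cont2 v" "cont2 v1" "cont2 v2"
    using D(3)[of 0] D(3)[of 1] D(3)[of 2] D(3)[of 3] G(3)[of 0] G(3)[of 1] G(3)[of 2] D(1) G(1)
    by (simp_all add: h1_def h2_def h3_def v1_def v2_def)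
  have bnd: "((\<lambda>r. h r t) has_real_derivative 0) (at 0 within {0..1})" "((\<lambda>r. h r t) has_real_derivative 0) (at 1 within {0..1})"
    "v 0 t = 0" "v 1 t = 0" if "t > 0" for t
    using sol that unfolding positive_classical_solution_def by auto
  have uniq: "a = b" if "(f has_real_derivative a) (at r within {0..1})" "(f has_real_derivative b) (at r within {0..1})" "r \<in> {0..1}"
    for f :: "real \<Rightarrow> real" and a b r
    using vector_derivative_unique_within_closed_interval[of 0 1 r f a b] that
    by (auto simp: has_real_derivative_iff_has_vector_derivative)
  have eqs: "(h r) differentiable (at t)" "(v r) differentiable (at t)" "momentum_eq \<sigma> \<mu> h v r t" "continuity_eq h v r t"
    if "r \<in> {0<..<1}" "t > 0" for r t
    using sol that unfolding positive_classical_solution_def by auto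
  have "radial_flow \<sigma> \<mu> m h h1 h2 h3 v v1 v2"
  proof
    show "h1 0 t = 0" "h1 1 t = 0" "v 0 t = 0" "v 1 t = 0" if t: "t > 0" for t
      using uniq[OF _ bnd(1)[OF t], of "h1 0 t"] uniq[OF _ bnd(2)[OF t], of "h1 1 t"] bnd(3,4)[OF t] rd(1) t
      unfolding rderiv_def by auto
    show "m \<le> h r t" if r: "r \<in> {0..1}" and t: "t > 0" for r t
    proof -
      have "continuous_on (closure {0<..<1}) (\<lambda>r. h r t)" using cont2_r[OF ct(1) t] by simp
      then show ?thesis using continuous_ge_on_closure[of "{0<..<1}" "\<lambda>r. h r t" r m] r low t by auto
    qed
    fix r t :: real assume r: "r \<in> {0<..<1}" and t: "t > 0"
    note d = rderiv_interior[OF rd(1) _ t] rderiv_interior[OF rd(2) _ t] rderiv_interior[OF rd(3) _ t]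
      rderiv_interior[OF rd(4) _ t] rderiv_interior[OF rd(5) _ t]
    have r0: "r \<noteq> 0" using r by simp
    have dh: "deriv (\<lambda>x. h x t) x = h1 x t" if "x \<in> {0<..<1}" for x using DERIV_imp_deriv[OF d(1)[OF that]] .
    have dv: "deriv (\<lambda>x. v x t) x = v1 x t" if "x \<in> {0<..<1}" for x using DERIV_imp_deriv[OF d(4)[OF that]] .
    have hp: "h r t > 0" using low[of r t] r t pos(3) by fastforce
    show "(h r has_real_derivative - (v r t * h1 r t + h r t * v1 r t + h r t * (v r t / r))) (at t)"
    proof -
      have "((\<lambda>x. x * h x t * v x t) has_real_derivative (h r t + r * h1 r t) * v r t + r * h r t * v1 r t) (at r)"
        by (auto intro!: derivative_eq_intros d(1)[OF r] d(4)[OF r] simp: algebra_simps)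
      then have e: "deriv (\<lambda>x. x * h x t * v x t) r = (h r t + r * h1 r t) * v r t + r * h r t * v1 r t"
        by (rule DERIV_imp_deriv)
      have "deriv (h r) t = - deriv (\<lambda>x. x * h x t * v x t) r / r"
        using eqs(4)[OF r t] unfolding continuity_eq_def .
      also have "\<dots> = - (v r t * h1 r t + h r t * v1 r t + h r t * (v r t / r))"
        unfolding e using r0 by (simp add: field_simps)
      finally have e2: "deriv (h r) t = - (v r t * h1 r t + h r t * v1 r t + h r t * (v r t / r))" .
      have "(h r has_real_derivative deriv (h r) t) (at t)"
        using eqs(1)[OF r t] DERIV_deriv_iff_real_differentiable by blast
      then show ?thesis unfolding e2 .
    qed
    show "(v r has_real_derivative - v r t * v1 r t + \<sigma> * (h3 r t + (h2 r t - h1 r t / r) / r) +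
        4 * \<mu> / h r t * (h1 r t * (v1 r t + v r t / r) + h r t * (v2 r t + (v1 r t - v r t / r) / r) - v r t / r * h1 r t / 2)) (at t)"
    proof -
      have a: "deriv (\<lambda>y. y * deriv (\<lambda>z. h z t) y) x = h1 x t + x * h2 x t" if x: "x \<in> {0<..<1}" for x
      proof (rule deriv_eq_on_unit_interval[OF _ _ x])
        show "((\<lambda>y. y * h1 y t) has_real_derivative h1 x t + x * h2 x t) (at x)"
          by (auto intro!: derivative_eq_intros d(2)[OF x])
      qed (simp add: dh)
      have b: "deriv (\<lambda>x. 1 / x * deriv (\<lambda>y. y * deriv (\<lambda>z. h z t) y) x) r = h3 r t + (h2 r t - h1 r t / r) / r"
      proof (rule deriv_eq_on_unit_interval[OF _ _ r])
        show "((\<lambda>x. h1 x t / x + h2 x t) has_real_derivative h3 r t + (h2 r t - h1 r t / r) / r) (at r)"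
          using r0 by (auto intro!: derivative_eq_intros d(2)[OF r] d(3)[OF r] simp: field_simps)
      qed (simp add: a add_divide_distrib)
      have c: "deriv (\<lambda>y. y * v y t) x = v x t + x * v1 x t" if x: "x \<in> {0<..<1}" for x
        by (rule DERIV_imp_deriv) (auto intro!: derivative_eq_intros d(4)[OF x])
      have e: "deriv (\<lambda>x. h x t / x * deriv (\<lambda>y. y * v y t) x) r
         = h1 r t * (v1 r t + v r t / r) + h r t * (v2 r t + (v1 r t - v r t / r) / r)"
      proof (rule deriv_eq_on_unit_interval[OF _ _ r])
        show "((\<lambda>x. h x t * (v x t / x + v1 x t)) has_real_derivative
            h1 r t * (v1 r t + v r t / r) + h r t * (v2 r t + (v1 r t - v r t / r) / r)) (at r)"
          using r0 by (auto intro!: derivative_eq_intros d(1)[OF r] d(4)[OF r] d(5)[OF r] simp: field_simps)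
      qed (simp add: c field_simps)
      have "deriv (v r) t = - v r t * v1 r t + \<sigma> * (h3 r t + (h2 r t - h1 r t / r) / r) +
        4 * \<mu> / h r t * (h1 r t * (v1 r t + v r t / r) + h r t * (v2 r t + (v1 r t - v r t / r) / r) - v r t * h1 r t / (2 * r))"
        using eqs(3)[OF r t] unfolding momentum_eq_def b e dh[OF r] dv[OF r] by linarith
      moreover have "v r t * h1 r t / (2 * r) = v r t / r * h1 r t / 2" using r0 by simp
      ultimately have e2: "deriv (v r) t = - v r t * v1 r t + \<sigma> * (h3 r t + (h2 r t - h1 r t / r) / r) +
        4 * \<mu> / h r t * (h1 r t * (v1 r t + v r t / r) + h r t * (v2 r t + (v1 r t - v r t / r) / r) - v r t / r * h1 r t / 2)"
        by simp
      have "(v r has_real_derivative deriv (v r) t) (at t)"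
        using eqs(2)[OF r t] DERIV_deriv_iff_real_differentiable by blast
      then show ?thesis unfolding e2 .
    qed
  qed (use pos rd ct in auto)
  then show ?thesis by (rule that)
qed

text \<open>The function \<open>g = f - f 1\<close> vanishes at \<open>r = 1\<close>, so \<open>r\<^sup>2 g\<^sup>2\<close> is a flux vanishing at both ends;
  its derivative gives \<open>\<integral> r g\<^sup>2 \<le> \<integral> r\<^sup>3 f'\<^sup>2\<close>. Subtracting the mean instead of \<open>f 1\<close> only decreases
  the left-hand side.\<close>

lemma poincare_unit_disc:
  fixes f f' :: "real \<Rightarrow> real"
  assumes d: "\<And>r. r \<in> {0..1} \<Longrightarrow> (f has_real_derivative f' r) (at r within {0..1})" and c': "continuous_on {0..1} f'"
  defines "c \<equiv> 2 * integral {0..1} (\<lambda>r. f r * r)"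
  shows "integral {0..1} (\<lambda>r. (f r - c)\<^sup>2 * r) \<le> integral {0..1} (\<lambda>r. (f' r)\<^sup>2 * r)"
proof -
  have cf: "continuous_on {0..1} f" by (rule DERIV_continuous_on) (rule d)
  define g where "g r = f r - f 1" for r
  have cg: "continuous_on {0..1} g" unfolding g_def by (intro continuous_intros cf)
  have i: "F integrable_on {0..1}" if "continuous_on {0..1} F" for F :: "real \<Rightarrow> real"
    using that by (rule integrable_continuous_interval)
  define I where "I = integral {0..1} (\<lambda>r. (g r)\<^sup>2 * r)"
  define J where "J = integral {0..1} (\<lambda>r. g r * r)"
  define L where "L = integral {0..1} (\<lambda>r. (f' r)\<^sup>2 * r)"
  have IL: "I \<le> L"
  proof -
    have z: "((\<lambda>r. 2 * r * (g r)\<^sup>2 + 2 * r\<^sup>2 * (g r * f' r)) has_integral 0) {0..1}"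
      by (rule integral_rderiv_vanishing[of "\<lambda>r. r\<^sup>2 * (g r)\<^sup>2"])
        (auto simp: g_def algebra_simps intro!: derivative_eq_intros d)
    have "((\<lambda>r. (g r)\<^sup>2 * r) has_integral I) {0..1}" "((\<lambda>r. (f' r)\<^sup>2 * r) has_integral L) {0..1}"
      unfolding I_def L_def by (intro integrable_integral i continuous_intros cg c')+
    then have "((\<lambda>r. (f' r)\<^sup>2 * r - (g r)\<^sup>2 * r + (2 * r * (g r)\<^sup>2 + 2 * r\<^sup>2 * (g r * f' r))) has_integral L - I + 0) {0..1}"
      by (intro has_integral_add has_integral_diff z)
    then have "0 \<le> L - I + 0"
    proof (rule has_integral_nonneg)
      fix r :: real assume r: "r \<in> {0..1}"
      have "0 \<le> r * (g r + r * f' r)\<^sup>2" using r by simp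
      moreover have "r * (r * f' r)\<^sup>2 \<le> r * (f' r)\<^sup>2" unfolding power_mult_distrib
        using r by (intro mult_left_mono mult_left_le_one_le) (auto simp: power_le_one)
      ultimately show "0 \<le> (f' r)\<^sup>2 * r - (g r)\<^sup>2 * r + (2 * r * (g r)\<^sup>2 + 2 * r\<^sup>2 * (g r * f' r))"
        by (simp add: power2_eq_square algebra_simps)
    qed
    then show ?thesis by simp
  qed
  have r2: "((\<lambda>r. r) has_integral 1/2) {0..1::real}"
    using ident_has_integral[of 0 "1::real"] by simp
  have hg: "((\<lambda>r. g r * r) has_integral J) {0..1}" unfolding J_def by (intro integrable_integral i continuous_intros cg)
  have hI: "((\<lambda>r. (g r)\<^sup>2 * r) has_integral I) {0..1}" unfolding I_def by (intro integrable_integral i continuous_intros cg)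
  have "((\<lambda>r. g r * r + f 1 * r) has_integral J + f 1 * (1/2)) {0..1}"
    by (intro has_integral_add has_integral_mult_right hg r2)
  then have "((\<lambda>r. f r * r) has_integral J + f 1 / 2) {0..1}" by (simp add: g_def algebra_simps)
  then have cc: "c = 2 * J + f 1" unfolding c_def by (simp add: integral_unique)
  have "((\<lambda>r. (g r)\<^sup>2 * r - 4 * J * (g r * r) + 4 * J\<^sup>2 * r) has_integral I - 4 * J * J + 4 * J\<^sup>2 * (1/2)) {0..1}"
    by (intro has_integral_add has_integral_diff has_integral_mult_right hg r2 hI)
  moreover have "(\<lambda>r. (g r)\<^sup>2 * r - 4 * J * (g r * r) + 4 * J\<^sup>2 * r) = (\<lambda>r. (f r - c)\<^sup>2 * r)"
    unfolding cc g_def by (auto simp: power2_eq_square algebra_simps)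
  ultimately have "integral {0..1} (\<lambda>r. (f r - c)\<^sup>2 * r) = I - 2 * J\<^sup>2"
    by (simp add: integral_unique power2_eq_square)
  then show ?thesis using IL zero_le_power2[of J] unfolding L_def by linarith
qed

section \<open>Uniform convergence and weighted quadratic forms\<close>

lemma unit_interval_continuous:
  fixes f :: "real \<Rightarrow> real"
  assumes c: "continuous_on {0..1} f"
  shows "in_L2 unit_interval f" and "set_borel_measurable lebesgue unit_interval f"
    and "set_integrable lebesgue unit_interval f"
    and "(LINT r:unit_interval|lebesgue. f r) = integral {0..1} f"
proof -
  have "compact (f ` {0..1})" by (rule compact_continuous_image[OF c]) simp
  then obtain C where C: "\<And>r. r \<in> {0..1} \<Longrightarrow> norm (f r) \<le> C"
    using compact_imp_bounded by (fastforce simp: bounded_iff)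
  have c': "continuous_on unit_interval f" using c by (rule continuous_on_subset) auto
  have C': "\<And>r. r \<in> unit_interval \<Longrightarrow> norm (f r) \<le> C" using C by auto
  show "in_L2 unit_interval f" by (rule in_L2_continuous_bounded[OF _ _ c' C']) auto
  show "set_borel_measurable lebesgue unit_interval f"
    by (rule set_integrable_continuous_bounded(2)[OF _ _ c' C']) auto
  show i: "set_integrable lebesgue unit_interval f"
    by (rule set_integrable_continuous_bounded(1)[OF _ _ c' C']) auto
  show "(LINT r:unit_interval|lebesgue. f r) = integral {0..1} f"
    using set_lebesgue_integral_eq_integral(2)[OF i] by (simp add: integral_open_interval_real)
qed

lemma L2_nrm_unit_interval:
  fixes f :: "real \<Rightarrow> real"
  assumes "continuous_on {0..1} f"
  shows "(L2_nrm unit_interval f)\<^sup>2 = integral {0..1} (\<lambda>r. (f r)\<^sup>2)"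
  unfolding L2_nrm_power2 using unit_interval_continuous(4)[of "\<lambda>r. (f r)\<^sup>2"] assms
  by (simp add: continuous_on_power)

lemma L2_nrm_zero_AE:
  assumes "in_L2 \<Omega> u" "L2_nrm \<Omega> u = 0"
  shows "AE x in lebesgue. x \<in> \<Omega> \<longrightarrow> u x = 0"
proof -
  have i: "integrable lebesgue (\<lambda>x. indicator \<Omega> x *\<^sub>R (norm (u x))\<^sup>2)"
    using assms(1) by (simp add: in_L2_def set_integrable_def)
  have "(LINT x|lebesgue. indicator \<Omega> x *\<^sub>R (norm (u x))\<^sup>2) = 0"
    using L2_nrm_power2[of \<Omega> u] assms(2) by (simp add: set_lebesgue_integral_def)
  then have "AE x in lebesgue. indicator \<Omega> x *\<^sub>R (norm (u x))\<^sup>2 = 0"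
    by (subst (asm) integral_nonneg_eq_0_iff_AE[OF i]) auto
  then show ?thesis by eventually_elim (auto simp: indicator_def split: if_splits)
qed

lemma L2_nrm_sup_bound:
  fixes f :: "real \<Rightarrow> real"
  assumes "in_L2 unit_interval f" "\<And>r. r \<in> unit_interval \<Longrightarrow> \<bar>f r\<bar> \<le> C" "C \<ge> 0"
  shows "L2_nrm unit_interval f \<le> C"
proof (rule power2_le_imp_le[OF _ assms(3)])
  have c: "continuous_on {0..1} (\<lambda>_::real. C\<^sup>2)" by simp
  have "(L2_nrm unit_interval f)\<^sup>2 \<le> (LINT r:unit_interval|lebesgue. C\<^sup>2)"
    unfolding L2_nrm_power2
  proof (rule set_integral_mono)
    show "(norm (f r))\<^sup>2 \<le> C\<^sup>2" if "r \<in> unit_interval" for r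
      using assms(2)[OF that] by (intro power_mono) auto
  qed (use assms(1) unit_interval_continuous(3)[OF c] in \<open>auto simp: in_L2_def\<close>)
  also have "\<dots> = C\<^sup>2" unfolding unit_interval_continuous(4)[OF c] by simp
  finally show "(L2_nrm unit_interval f)\<^sup>2 \<le> C\<^sup>2" .
qed

text \<open>The Sobolev inequality of the interval: the minimum of \<open>\<bar>f\<bar>\<close> is at most the \<open>L\<^sup>2\<close> norm, and the
  oscillation is at most the \<open>L\<^sup>1\<close> norm of the derivative.\<close>

lemma sup_le_H1:
  fixes f f' :: "real \<Rightarrow> real"
  assumes d: "\<And>r. r \<in> {0..1} \<Longrightarrow> (f has_real_derivative f' r) (at r within {0..1})" and c': "continuous_on {0..1} f'"
    and x: "x \<in> {0..1}"
  shows "\<bar>f x\<bar> \<le> L2_nrm unit_interval f + L2_nrm unit_interval f'"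
proof -
  have cf: "continuous_on {0..1} f" by (rule DERIV_continuous_on) (rule d)
  obtain y where y: "y \<in> {0..1}" "\<And>z. z \<in> {0..1} \<Longrightarrow> \<bar>f y\<bar> \<le> \<bar>f z\<bar>"
    using continuous_attains_inf[of "{0..1}" "\<lambda>z. \<bar>f z\<bar>"] cf by (force intro!: continuous_intros)
  have "\<bar>f y\<bar> \<le> L2_nrm unit_interval f"
  proof (rule power2_le_imp_le[OF _ L2_nrm_nonneg])
    have "integral {0..1} (\<lambda>_::real. \<bar>f y\<bar>\<^sup>2) \<le> integral {0..1} (\<lambda>r. (f r)\<^sup>2)"
    proof (rule integral_le)
      show "(\<lambda>r. (f r)\<^sup>2) integrable_on {0..1}" by (intro integrable_continuous_interval continuous_intros cf)
      show "\<bar>f y\<bar>\<^sup>2 \<le> (f z)\<^sup>2" if "z \<in> {0..1}" for z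
        using power_mono[OF y(2)[OF that], of 2] by simp
      show "(\<lambda>_::real. \<bar>f y\<bar>\<^sup>2) integrable_on {0..1}" by (rule integrable_continuous_interval) simp
    qed
    then show "\<bar>f y\<bar>\<^sup>2 \<le> (L2_nrm unit_interval f)\<^sup>2" unfolding L2_nrm_unit_interval[OF cf] by simp
  qed
  moreover have "\<bar>f x - f y\<bar> \<le> L2_nrm unit_interval f'"
  proof -
    define I where "I = integral {0..1} (\<lambda>r. \<bar>f' r\<bar>)"
    have ab: "(\<lambda>r. \<bar>f' r\<bar>) integrable_on {0..1}" by (intro integrable_continuous_interval continuous_intros c')
    have main: "\<bar>f b - f a\<bar> \<le> I" if "0 \<le> a" "a \<le> b" "b \<le> 1" for a b
    proof -
      have sub: "{a..b} \<subseteq> {0..1}" using that by auto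
      have "(f' has_integral f b - f a) {a..b}"
      proof (rule fundamental_theorem_of_calculus[OF that(2)])
        fix r assume "r \<in> {a..b}"
        then have "(f has_real_derivative f' r) (at r within {0..1})" using d sub by auto
        then have "(f has_real_derivative f' r) (at r within {a..b})" using sub by (rule DERIV_subset)
        then show "(f has_vector_derivative f' r) (at r within {a..b})"
          by (simp add: has_real_derivative_iff_has_vector_derivative)
      qed
      then have "f b - f a = integral {a..b} f'" "f' integrable_on {a..b}" by (auto simp: integral_unique integrable_on_def)
      moreover have abi: "(\<lambda>r. \<bar>f' r\<bar>) integrable_on {a..b}" by (rule integrable_on_subinterval[OF ab sub])
      ultimately have "\<bar>f b - f a\<bar> \<le> integral {a..b} (\<lambda>r. \<bar>f' r\<bar>)"
        using integral_norm_bound_integral[of f' "{a..b}" "\<lambda>r. \<bar>f' r\<bar>"] by simp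
      also have "\<dots> \<le> I" unfolding I_def by (rule integral_subset_le[OF sub abi ab]) simp
      finally show ?thesis .
    qed
    have "\<bar>f x - f y\<bar> \<le> I"
      using main[of x y] main[of y x] x y(1) by (cases "x \<le> y") (auto simp: abs_minus_commute)
    also have "I \<le> L2_nrm unit_interval (\<lambda>_::real. 1::real) * L2_nrm unit_interval f'"
    proof -
      have c1: "continuous_on {0..1} (\<lambda>_::real. 1::real)" by simp
      have "I = (LINT r:unit_interval|lebesgue. norm (1::real) * norm (f' r))"
        unfolding I_def using unit_interval_continuous(4)[of "\<lambda>r. \<bar>f' r\<bar>"] c' by (simp add: continuous_intros)
      also have "\<dots> \<le> L2_nrm unit_interval (\<lambda>_::real. 1::real) * L2_nrm unit_interval f'"
        by (rule Cauchy_Schwarz_L2_norms[OF unit_interval_continuous(1)[OF c1] unit_interval_continuous(1)[OF c']])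
      finally show ?thesis .
    qed
    also have "L2_nrm unit_interval (\<lambda>_::real. 1::real) = 1"
    proof -
      have "(L2_nrm unit_interval (\<lambda>_::real. 1::real))\<^sup>2 = 1" by (subst L2_nrm_unit_interval) auto
      then show ?thesis using L2_nrm_nonneg[of unit_interval "\<lambda>_::real. 1::real"] by (simp add: power2_eq_1_iff)
    qed
    finally show ?thesis by simp
  qed
  ultimately show ?thesis by linarith
qed

lemma abs_sqrt_diff_le:
  assumes "a \<ge> 0" "b \<ge> 0" shows "\<bar>sqrt a - sqrt b\<bar> \<le> sqrt \<bar>a - b\<bar>"
proof -
  have "sqrt a \<le> sqrt b + sqrt \<bar>a - b\<bar>" if "a \<ge> 0" "b \<ge> 0" for a b :: real
  proof -
    have "sqrt a \<le> sqrt (b + \<bar>a - b\<bar>)" by (rule real_sqrt_le_mono) linarith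
    also have "\<dots> \<le> sqrt b + sqrt \<bar>a - b\<bar>" using that by (intro sqrt_add_le_add_sqrt) auto
    finally show ?thesis .
  qed
  from this[OF assms] this[OF assms(2,1)] show ?thesis by (simp add: abs_minus_commute abs_le_iff)
qed

text \<open>Only the \<open>C\<^sup>1\<close> functions \<open>H n\<close> are compared with each other, so the Sobolev inequality for \<open>C\<^sup>1\<close>
  functions suffices. The uniform limit \<open>K\<close> is a continuous representative of the \<open>H\<^sup>1\<close> limit \<open>h\<close>,
  which itself may be unbounded on a null set.\<close>

lemma uniform_limit_of_H1_Cauchy:
  fixes H H' :: "nat \<Rightarrow> real \<Rightarrow> real"
  assumes d: "\<And>n r. r \<in> {0..1} \<Longrightarrow> (H n has_real_derivative H' n r) (at r within {0..1})" and c': "\<And>n. continuous_on {0..1} (H' n)"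
    and L: "L2_lim unit_interval H h" "L2_lim unit_interval H' g" and m: "\<And>n r. r \<in> {0..1} \<Longrightarrow> m \<le> H n r"
  obtains K e where "continuous_on {0..1} K" "e \<longlonglongrightarrow> 0" "\<And>n. e n \<ge> 0" "\<And>n r. r \<in> {0..1} \<Longrightarrow> \<bar>H n r - K r\<bar> \<le> e n"
    "AE r in lebesgue. r \<in> unit_interval \<longrightarrow> K r = h r" "\<And>r. r \<in> {0..1} \<Longrightarrow> m \<le> K r"
proof -
  define e where "e n = L2_nrm unit_interval (\<lambda>r. H n r - h r) + L2_nrm unit_interval (\<lambda>r. H' n r - g r)" for n
  have inH: "in_L2 unit_interval (H n)" "in_L2 unit_interval h" "in_L2 unit_interval (H' n)" "in_L2 unit_interval g" for n
    using L by (auto simp: L2_lim_def)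
  have e0: "e \<longlonglongrightarrow> 0" unfolding e_def using L by (intro tendsto_add_zero) (auto simp: L2_lim_def)
  have en: "e n \<ge> 0" for n unfolding e_def by (intro add_nonneg_nonneg L2_nrm_nonneg)
  have cH: "continuous_on {0..1} (H n)" for n by (rule DERIV_continuous_on) (rule d)
  have tri: "L2_nrm unit_interval (\<lambda>r. a n r - a k r) \<le> L2_nrm unit_interval (\<lambda>r. a n r - b r) + L2_nrm unit_interval (\<lambda>r. a k r - b r)"
    if "\<And>n. in_L2 unit_interval (a n)" "in_L2 unit_interval b" for a :: "nat \<Rightarrow> real \<Rightarrow> real" and b n k
    using L2_nrm_triangle[OF in_L2_diff[OF that(1) that(2)] in_L2_cmult[OF in_L2_diff[OF that(1) that(2)], of "-1"], of n k]
      L2_nrm_cmult[of unit_interval "-1" "\<lambda>r. a k r - b r"] by simp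
  have cauchy: "\<bar>H n r - H k r\<bar> \<le> e n + e k" if r: "r \<in> {0..1}" for n k r
  proof -
    have "\<bar>H n r - H k r\<bar> \<le> L2_nrm unit_interval (\<lambda>r. H n r - H k r) + L2_nrm unit_interval (\<lambda>r. H' n r - H' k r)"
      by (rule sup_le_H1[OF _ _ r]) (auto intro!: derivative_intros continuous_intros d c')
    also have "\<dots> \<le> e n + e k" unfolding e_def using tri[of H h n k] tri[of H' g n k] inH by simp
    finally show ?thesis .
  qed
  define K where "K r = lim (\<lambda>n. H n r)" for r
  have HK: "(\<lambda>n. H n r) \<longlonglongrightarrow> K r" if r: "r \<in> {0..1}" for r
  proof -
    have "Cauchy (\<lambda>n. H n r)"
    proof (rule metric_CauchyI)
      fix \<epsilon> :: real assume "\<epsilon> > 0"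
      then obtain N where N: "\<And>n. n \<ge> N \<Longrightarrow> e n < \<epsilon> / 2"
        using order_tendstoD(2)[OF e0, of "\<epsilon>/2"] by (auto simp: eventually_sequentially)
      have "dist (H n r) (H k r) < \<epsilon>" if "n \<ge> N" "k \<ge> N" for n k
        using cauchy[OF r, of n k] N[OF that(1)] N[OF that(2)] by (simp add: dist_real_def)
      then show "\<exists>N. \<forall>n\<ge>N. \<forall>k\<ge>N. dist (H n r) (H k r) < \<epsilon>" by blast
    qed
    then show ?thesis unfolding K_def by (simp add: Cauchy_convergent convergent_LIMSEQ_iff[symmetric])
  qed
  have bd: "\<bar>H n r - K r\<bar> \<le> e n" if r: "r \<in> {0..1}" for n r
  proof (rule LIMSEQ_le[of "\<lambda>k. \<bar>H n r - H k r\<bar>" _ "\<lambda>k. e n + e k"])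
    show "(\<lambda>k. \<bar>H n r - H k r\<bar>) \<longlonglongrightarrow> \<bar>H n r - K r\<bar>" by (intro tendsto_intros HK r)
    show "(\<lambda>k. e n + e k) \<longlonglongrightarrow> e n" using tendsto_add[OF tendsto_const e0] by simp
  qed (use cauchy[OF r] in auto)
  have "uniform_limit {0..1} H K sequentially"
  proof (rule uniform_limitI)
    fix \<epsilon> :: real assume "\<epsilon> > 0"
    then have "\<forall>\<^sub>F n in sequentially. e n < \<epsilon>" using order_tendstoD(2)[OF e0] by blast
    then show "\<forall>\<^sub>F n in sequentially. \<forall>x\<in>{0..1}. dist (H n x) (K x) < \<epsilon>"
      by (rule eventually_mono) (auto simp: dist_real_def intro: order.strict_trans1[OF bd])
  qed
  then have cK: "continuous_on {0..1} K"
    by (rule uniform_limit_theorem[rotated]) (use cH in auto)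
  note iK = unit_interval_continuous(1)[OF cK]
  have nrm: "L2_nrm unit_interval (\<lambda>r. K r - h r) = 0"
  proof -
    have "L2_nrm unit_interval (\<lambda>r. K r - h r) \<le> e n + e n" for n
    proof -
      have "L2_nrm unit_interval (\<lambda>r. (K r - H n r) + (H n r - h r)) \<le> L2_nrm unit_interval (\<lambda>r. K r - H n r) + L2_nrm unit_interval (\<lambda>r. H n r - h r)"
        by (intro L2_nrm_triangle in_L2_diff iK inH)
      moreover have "L2_nrm unit_interval (\<lambda>r. K r - H n r) \<le> e n"
        using bd[of _ n] by (intro L2_nrm_sup_bound in_L2_diff iK inH en) (auto simp: abs_minus_commute)
      moreover have "L2_nrm unit_interval (\<lambda>r. H n r - h r) \<le> e n" unfolding e_def by (simp add: L2_nrm_nonneg)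
      ultimately show ?thesis by simp
    qed
    then have "L2_nrm unit_interval (\<lambda>r. K r - h r) \<le> 0"
      by (intro LIMSEQ_le_const[OF tendsto_add_zero[OF e0 e0]]) auto
    then show ?thesis using L2_nrm_nonneg by (rule antisym)
  qed
  have "AE r in lebesgue. r \<in> unit_interval \<longrightarrow> K r = h r"
    using L2_nrm_zero_AE[OF in_L2_diff[OF iK inH(2)] nrm] by simp
  moreover have "m \<le> K r" if r: "r \<in> {0..1}" for r
    by (rule LIMSEQ_le_const[OF HK[OF r]]) (use m[OF r] in auto)
  ultimately show ?thesis using that[OF cK e0 en bd] by blast
qed

text \<open>Energy and entropy are sums of squares of \<open>L\<^sup>2\<close> norms of functions \<open>sqrt a * u\<close>, where the weight \<open>a\<close> contains
  \<open>r\<close> and the height. Taking the root of the weight turns their convergence into convergence of norms.\<close>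

lemma sqrt_weights_uniform:
  fixes A :: "nat \<Rightarrow> real \<Rightarrow> real"
  assumes L: "L2_lim unit_interval U u"
    and cA: "\<And>n. continuous_on {0..1} (A n)" and cB: "continuous_on {0..1} B"
    and pos: "\<And>n r. r \<in> {0..1} \<Longrightarrow> 0 \<le> A n r" "\<And>r. r \<in> {0..1} \<Longrightarrow> 0 \<le> B r"
    and e: "e \<longlonglongrightarrow> 0" "\<And>n r. r \<in> {0..1} \<Longrightarrow> \<bar>A n r - B r\<bar> \<le> e n"
  shows "L2_lim unit_interval (\<lambda>n r. sqrt (A n r) *\<^sub>R U n r) (\<lambda>r. sqrt (B r) *\<^sub>R u r)"
proof -
  have csA: "continuous_on {0..1} (\<lambda>r. sqrt (A n r))" for n by (intro continuous_intros cA)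
  have csB: "continuous_on {0..1} (\<lambda>r. sqrt (B r))" by (intro continuous_intros cB)
  have "compact ((\<lambda>r. sqrt (B r)) ` {0..1})" by (rule compact_continuous_image[OF csB]) simp
  then obtain C where C: "\<And>r. r \<in> {0..1} \<Longrightarrow> \<bar>sqrt (B r)\<bar> \<le> C"
    using compact_imp_bounded by (fastforce simp: bounded_iff)
  show ?thesis
  proof (rule L2_lim_mult[OF L unit_interval_continuous(2)[OF csA] unit_interval_continuous(2)[OF csB]])
    have "\<bar>sqrt (A n r) - sqrt (B r)\<bar> \<le> sqrt (e n)" if r: "r \<in> {0..1}" for n r
      using abs_sqrt_diff_le[OF pos(1)[OF r] pos(2)[OF r], of n] real_sqrt_le_mono[OF e(2)[OF r], of n] by linarith
    then show "AE r in lebesgue. r \<in> unit_interval \<longrightarrow> \<bar>sqrt (A n r) - sqrt (B r)\<bar> \<le> sqrt (e n)" for n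
      by (intro AE_I2) auto
    show "(\<lambda>n. sqrt (e n)) \<longlonglongrightarrow> 0" using tendsto_real_sqrt[OF e(1)] by simp
    show "AE r in lebesgue. r \<in> unit_interval \<longrightarrow> \<bar>sqrt (B r)\<bar> \<le> C" using C by (intro AE_I2) auto
  qed
qed

section \<open>The decay estimates up to the initial time\<close>

lemma L2_nrm_le_H1_nrm: "L2_nrm \<Omega> u \<le> H1_nrm \<Omega> u" "L2_nrm \<Omega> (weak_grad \<Omega> u) \<le> H1_nrm \<Omega> u"
  unfolding H1_nrm_def by (rule real_le_rsqrt; simp)+

lemma set_integral_cong_AE_lebesgue:
  fixes f g :: "'a::euclidean_space \<Rightarrow> real"
  assumes "set_integrable lebesgue \<Omega> f" "AE x in lebesgue. x \<in> \<Omega> \<longrightarrow> f x = g x"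
  shows "(LINT x:\<Omega>|lebesgue. f x) = (LINT x:\<Omega>|lebesgue. g x)"
proof -
  have ae: "AE x in lebesgue. indicator \<Omega> x *\<^sub>R f x = indicator \<Omega> x *\<^sub>R g x"
    using assms(2) by eventually_elim (auto simp: indicator_def)
  have m: "(\<lambda>x. indicator \<Omega> x *\<^sub>R f x) \<in> borel_measurable lebesgue"
    using assms(1) unfolding set_integrable_def by (rule borel_measurable_integrable)
  show ?thesis
    unfolding set_lebesgue_integral_def by (rule integral_cong_AE[OF m borel_measurable_AE[OF m ae] ae])
qed

lemma L2_lim_cong:
  assumes "L2_lim \<Omega> U u" "\<And>x. x \<in> \<Omega> \<Longrightarrow> u x = w x"
  shows "L2_lim \<Omega> U w"
proof -
  have ae: "AE x in lebesgue. x \<in> \<Omega> \<longrightarrow> u x = w x" using assms(2) by (intro AE_I2) auto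
  have "L2_nrm \<Omega> (\<lambda>x. U n x - w x) = L2_nrm \<Omega> (\<lambda>x. U n x - u x)" for n
    by (rule in_L2_cong_AE(2)) (use assms in \<open>auto intro!: AE_I2 in_L2_diff simp: L2_lim_def\<close>)
  then show ?thesis using assms(1) in_L2_cong_AE(1)[OF ae] by (simp add: L2_lim_def)
qed

text \<open>The weak gradient of the radial function is assumed rather than deduced from \<open>u\<close> and \<open>g\<close>, because at
  the initial time it is obtained as a limit on the disc.\<close>

lemma H1_unit_disc_radial:
  assumes u: "in_L2 unit_interval u" and g: "in_L2 unit_interval g"
    and w: "is_weak_gradient unit_disc (radial u) (radial_field g)"
  shows "in_H1 unit_disc (radial u)"
    and "(H1_nrm unit_disc (radial u))\<^sup>2 = (L2_nrm unit_disc (radial u))\<^sup>2 + (L2_nrm unit_disc (radial g))\<^sup>2"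
proof -
  note i = in_L2_radial(1)[OF u] in_L2_radial_field(1)[OF g]
  show "in_H1 unit_disc (radial u)" unfolding in_H1_def using i w by blast
  have "L2_nrm unit_disc (weak_grad unit_disc (radial u)) = L2_nrm unit_disc (radial g)"
    using weak_grad_AE(2)[OF _ i(2) w] in_L2_radial_field(2)[OF g] by simp
  then show "(H1_nrm unit_disc (radial u))\<^sup>2 = (L2_nrm unit_disc (radial u))\<^sup>2 + (L2_nrm unit_disc (radial g))\<^sup>2"
    unfolding H1_nrm_def by simp
qed

lemma L2_nrm_radial_continuous:
  fixes u :: "real \<Rightarrow> real"
  assumes "continuous_on {0..1} u"
  shows "(L2_nrm unit_disc (radial u))\<^sup>2 = 2 * pi * integral {0..1} (\<lambda>r. r * (u r)\<^sup>2)"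
proof -
  have "continuous_on {0..1} (\<lambda>r. (u r)\<^sup>2 * r)" by (intro continuous_intros assms)
  from unit_interval_continuous(4)[OF this] show ?thesis
    unfolding in_L2_radial(2)[OF unit_interval_continuous(1)[OF assms]] by (simp add: mult.commute)
qed

text \<open>The entropy density as a single square that is linear in \<open>v\<close> and \<open>h\<^sub>r\<close>.\<close>

lemma completed_square:
  fixes r h v g \<mu> :: real
  assumes "h > 0" "\<mu> > 0" "r \<ge> 0"
  shows "(sqrt (r * h) * v + sqrt (16 * \<mu>\<^sup>2 * (r / h)) * g)\<^sup>2 = h * (v + 4 * \<mu> * (g / h))\<^sup>2 * r"
proof -
  have "16 * \<mu>\<^sup>2 * (r / h) = (4 * \<mu> / h)\<^sup>2 * (r * h)" using assms by (simp add: field_simps power2_eq_square)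
  then have "sqrt (16 * \<mu>\<^sup>2 * (r / h)) = 4 * \<mu> / h * sqrt (r * h)" using assms by (simp add: real_sqrt_mult)
  then have "sqrt (r * h) * v + sqrt (16 * \<mu>\<^sup>2 * (r / h)) * g = sqrt (r * h) * (v + 4 * \<mu> * (g / h))"
    by (simp add: algebra_simps)
  then have "(sqrt (r * h) * v + sqrt (16 * \<mu>\<^sup>2 * (r / h)) * g)\<^sup>2 = r * h * (v + 4 * \<mu> * (g / h))\<^sup>2"
    using assms by (simp add: power_mult_distrib)
  then show ?thesis by simp
qed

text \<open>The decay estimate is applied between the times \<open>s n\<close>, tending to \<open>0\<close>, and \<open>t\<close>; energy and
  entropy at time \<open>s n\<close> converge to those of the data. The estimates at \<open>t = 0\<close> are limits of those at
  \<open>s n\<close>, which also yields the weak gradient of the radial initial height on the disc.\<close>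

lemma solution_decay:
  assumes pos: "\<sigma> > 0" "\<mu> > 0" "m > 0"
    and h0: "in_H1 unit_interval h0" and v0: "in_L2 unit_interval v0"
    and sol: "positive_classical_solution \<sigma> \<mu> h0 v0 h v"
    and low: "\<forall>r\<in>unit_interval. \<forall>t>0. h r t \<ge> m"
    and t0: "t \<ge> 0"
  defines "E0 \<equiv> energy \<sigma> v0 h0"
  defines "F0 \<equiv> entropy \<sigma> \<mu> v0 h0 + energy_weight \<sigma> \<mu> m \<bar>E0\<bar> * E0"
  defines "b \<equiv> decay_rate \<sigma> \<mu> m \<bar>E0\<bar>"
  shows "in_H1 unit_disc (radial (\<lambda>r. h r t - disc_mean h0))"
    and "(H1_nrm unit_disc (radial (\<lambda>r. h r t - disc_mean h0)))\<^sup>2 \<le> 8 * pi / \<sigma> * (F0 * exp (- b * t))"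
    and "in_L2 unit_disc (radial (\<lambda>r. v r t))"
    and "(L2_nrm unit_disc (radial (\<lambda>r. v r t)))\<^sup>2 \<le> 4 * pi / m * (F0 * exp (- b * t))"
proof -
  obtain h1 h2 h3 v1 v2 where flow: "radial_flow \<sigma> \<mu> m h h1 h2 h3 v v1 v2"
    using radial_flow_if_solution[OF sol pos] low by blast
  interpret radial_flow \<sigma> \<mu> m h h1 h2 h3 v v1 v2 by (rule flow)
  define s :: "nat \<Rightarrow> real" where "s n = inverse (real (Suc n))" for n
  have s: "s n > 0" "s \<longlonglongrightarrow> 0" for n
    unfolding s_def using LIMSEQ_inverse_real_of_nat by auto
  have sR: "filterlim s (at_right 0) sequentially"
  proof -
    have "s n \<noteq> 0" for n using s(1)[of n] by simp
    then show ?thesis using s by (simp add: filterlim_at)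
  qed
  define g0 where "g0 = weak_grad unit_interval h0"
  have g0: "in_L2 unit_interval g0" "is_weak_gradient unit_interval h0 g0" and h0L: "in_L2 unit_interval h0"
    using h0 someI_ex[of "\<lambda>g. in_L2 unit_interval g \<and> is_weak_gradient unit_interval h0 g"]
    unfolding in_H1_def g0_def weak_grad_def by blast+
  have hc: "continuous_on {0..1} (\<lambda>r. h r t)" "continuous_on {0..1} (\<lambda>r. h1 r t)" "continuous_on {0..1} (\<lambda>r. v r t)" if "t > 0" for t
    using cont2_r[OF ct(1) that] cont2_r[OF ct(2) that] cont2_r[OF ct(5) that] .
  note L = unit_interval_continuous(1)[OF hc(1)] unit_interval_continuous(1)[OF hc(2)] unit_interval_continuous(1)[OF hc(3)]
  have wg: "is_weak_gradient unit_interval (\<lambda>r. h r t) (\<lambda>r. h1 r t)" if t: "t > 0" for t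
  proof (rule classical_gradient_is_weak)
    show "GDERIV (\<lambda>r. h r t) r :> h1 r t" if "r \<in> unit_interval" for r
      using rderiv_interior[OF rd(1) that t] by simp
    show "continuous_on unit_interval (\<lambda>r. h1 r t)" using hc(2)[OF t] by (rule continuous_on_subset) auto
  qed simp
  have limH: "(\<lambda>n. H1_nrm unit_interval (\<lambda>r. h r (s n) - h0 r)) \<longlonglongrightarrow> 0"
    and limv: "(\<lambda>n. L2_nrm unit_interval (\<lambda>r. v r (s n) - v0 r)) \<longlonglongrightarrow> 0"
    using sol filterlim_compose[OF _ sR] unfolding positive_classical_solution_def by blast+
  have Lh: "L2_lim unit_interval (\<lambda>n r. h r (s n)) h0"
  proof -
    have "(\<lambda>n. L2_nrm unit_interval (\<lambda>r. h r (s n) - h0 r)) \<longlonglongrightarrow> 0"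
      by (rule tendsto_zero_bound[OF _ limH]) (simp add: L2_nrm_le_H1_nrm(1) L2_nrm_nonneg)
    then show ?thesis using L(1)[OF s(1)] h0L by (simp add: L2_lim_def)
  qed
  have Lh1: "L2_lim unit_interval (\<lambda>n r. h1 r (s n)) g0"
  proof -
    have "L2_nrm unit_interval (\<lambda>r. h1 r (s n) - g0 r) \<le> H1_nrm unit_interval (\<lambda>r. h r (s n) - h0 r)" for n
    proof -
      have "is_weak_gradient unit_interval (\<lambda>r. h r (s n) - h0 r) (\<lambda>r. h1 r (s n) - g0 r)"
        by (rule is_weak_gradient_diff[OF _ L(1)[OF s(1)] L(2)[OF s(1)] h0L g0(1) wg[OF s(1)] g0(2)]) simp
      from weak_grad_AE(2)[OF _ in_L2_diff[OF L(2)[OF s(1)] g0(1)] this]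
      show ?thesis using L2_nrm_le_H1_nrm(2)[of unit_interval "\<lambda>r. h r (s n) - h0 r"] by simp
    qed
    then have "(\<lambda>n. L2_nrm unit_interval (\<lambda>r. h1 r (s n) - g0 r)) \<longlonglongrightarrow> 0"
      by (intro tendsto_zero_bound[OF _ limH]) (simp add: L2_nrm_nonneg)
    then show ?thesis using L(2)[OF s(1)] g0(1) by (simp add: L2_lim_def)
  qed
  have Lv: "L2_lim unit_interval (\<lambda>n r. v r (s n)) v0"
    unfolding L2_lim_def using L(3)[OF s(1)] v0 limv by auto
  obtain K e where cK: "continuous_on {0..1} K" and e: "e \<longlonglongrightarrow> 0" "\<And>n. e n \<ge> 0" "\<And>n r. r \<in> {0..1} \<Longrightarrow> \<bar>h r (s n) - K r\<bar> \<le> e n"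
    and Kh0: "AE r in lebesgue. r \<in> unit_interval \<longrightarrow> K r = h0 r" and Km: "\<And>r. r \<in> {0..1} \<Longrightarrow> m \<le> K r"
  proof (rule uniform_limit_of_H1_Cauchy[OF _ _ Lh Lh1])
    show "((\<lambda>r. h r (s n)) has_real_derivative h1 r (s n)) (at r within {0..1})" if "r \<in> {0..1}" for n r
      by (rule rderivD[OF rd(1) that s(1)])
    show "continuous_on {0..1} (\<lambda>r. h1 r (s n))" for n by (rule hc(2)[OF s(1)])
    show "m \<le> h r (s n)" if "r \<in> {0..1}" for n r by (rule low[OF that s(1)])
  qed blast
  \<comment> \<open>With these, the energy density is \<open>Q1\<^sup>2 + \<sigma> Q3\<^sup>2\<close> and the entropy density \<open>(Q1 + Q2)\<^sup>2 + \<sigma> Q3\<^sup>2\<close>, up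
    to the factor \<open>1/2\<close>; \<open>R1\<close>, \<open>R2\<close>, \<open>R3\<close> are the limits.\<close>
  define Q1 where "Q1 n r = sqrt (r * h r (s n)) *\<^sub>R v r (s n)" for n r
  define Q2 where "Q2 n r = sqrt (16 * \<mu>\<^sup>2 * (r / h r (s n))) *\<^sub>R h1 r (s n)" for n r
  define Q3 where "Q3 n r = sqrt r *\<^sub>R h1 r (s n)" for n r
  define R1 where "R1 r = sqrt (r * K r) *\<^sub>R v0 r" for r
  define R2 where "R2 r = sqrt (16 * \<mu>\<^sup>2 * (r / K r)) *\<^sub>R g0 r" for r
  define R3 where "R3 r = sqrt r *\<^sub>R g0 r" for r
  have hp: "h r (s n) > 0" "K r > 0" "h r (s n) \<noteq> 0" "K r \<noteq> 0" if "r \<in> {0..1}" for n r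
    using low[OF that s(1), of n] Km[OF that] pos(3) by auto
  have hn: "0 \<le> r * h r (s n)" "0 \<le> r * K r" "0 \<le> 16 * \<mu>\<^sup>2 * (r / h r (s n))" "0 \<le> 16 * \<mu>\<^sup>2 * (r / K r)"
    if "r \<in> {0..1}" for n r
    using less_imp_le[OF hp(1)[OF that, of n]] less_imp_le[OF hp(2)[OF that]] that by simp_all
  have c1: "continuous_on {0..1} (\<lambda>r. r * h r (s n))" for n by (intro continuous_intros hc s)
  have c2: "continuous_on {0..1} (\<lambda>r. 16 * \<mu>\<^sup>2 * (r / h r (s n)))" for n using hp by (intro continuous_intros hc s) auto
  have c3: "continuous_on {0..1} (\<lambda>r::real. r)" by (intro continuous_intros)
  have d1: "continuous_on {0..1} (\<lambda>r. r * K r)" by (intro continuous_intros cK)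
  have d2: "continuous_on {0..1} (\<lambda>r. 16 * \<mu>\<^sup>2 * (r / K r))" using hp by (intro continuous_intros cK) auto
  have L1: "L2_lim unit_interval Q1 R1"
    unfolding Q1_def R1_def
  proof (rule sqrt_weights_uniform[OF Lv c1 d1 _ _ e(1)])
    show "\<bar>r * h r (s n) - r * K r\<bar> \<le> e n" if r: "r \<in> {0..1}" for n r
    proof -
      have "\<bar>r * h r (s n) - r * K r\<bar> = r * \<bar>h r (s n) - K r\<bar>" using r by (simp add: right_diff_distrib[symmetric] abs_mult)
      also have "\<dots> \<le> 1 * e n" using r e(3)[OF r] e(2) by (intro mult_mono) auto
      finally show ?thesis by simp
    qed
  qed (rule hn, assumption)+
  have L2: "L2_lim unit_interval Q2 R2"
    unfolding Q2_def R2_def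
  proof (rule sqrt_weights_uniform[OF Lh1 c2 d2, where e="\<lambda>n. 16 * \<mu>\<^sup>2 * (e n / m\<^sup>2)"])
    show "(\<lambda>n. 16 * \<mu>\<^sup>2 * (e n / m\<^sup>2)) \<longlonglongrightarrow> 0"
      using e(1) by (intro tendsto_mult_right_zero tendsto_divide_zero)
    show "\<bar>16 * \<mu>\<^sup>2 * (r / h r (s n)) - 16 * \<mu>\<^sup>2 * (r / K r)\<bar> \<le> 16 * \<mu>\<^sup>2 * (e n / m\<^sup>2)" if r: "r \<in> {0..1}" for n r
    proof -
      have "r / h r (s n) - r / K r = r * (K r - h r (s n)) / (h r (s n) * K r)" using hp(1,3)[OF r, of n] hp(2,4)[OF r] by (simp add: field_simps)
      then have "\<bar>r / h r (s n) - r / K r\<bar> = r * \<bar>h r (s n) - K r\<bar> / (h r (s n) * K r)"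
        using hp(1,3)[OF r, of n] hp(2,4)[OF r] r by (simp add: abs_mult abs_minus_commute)
      also have "\<dots> \<le> (1 * e n) / (m * m)"
        using r e(3)[OF r] e(2) low[OF r s(1), of n] Km[OF r] pos(3) by (intro frac_le mult_mono mult_pos_pos) auto
      finally have "\<bar>r / h r (s n) - r / K r\<bar> \<le> e n / m\<^sup>2" by (simp add: power2_eq_square)
      then have "16 * \<mu>\<^sup>2 * \<bar>r / h r (s n) - r / K r\<bar> \<le> 16 * \<mu>\<^sup>2 * (e n / m\<^sup>2)" by (intro mult_left_mono) auto
      then show ?thesis unfolding right_diff_distrib[symmetric] abs_mult by simp
    qed
  qed (rule hn, assumption)+
  have L3: "L2_lim unit_interval Q3 R3"
    unfolding Q3_def R3_def by (rule sqrt_weights_uniform[OF Lh1 c3 c3 _ _ tendsto_const[of 0]]) auto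
  have q: "continuous_on {0..1} (Q1 n)" "continuous_on {0..1} (Q2 n)" "continuous_on {0..1} (Q3 n)" for n
    unfolding Q1_def[abs_def] Q2_def[abs_def] Q3_def[abs_def]
    by (intro continuous_on_scaleR continuous_on_real_sqrt c1 c2 c3 hc s)+
  have iR: "in_L2 unit_interval R1" "in_L2 unit_interval R2" "in_L2 unit_interval R3" using L1 L2 L3 by (auto simp: L2_lim_def)
  have int_sum: "integral {0..1} (\<lambda>r. (a r)\<^sup>2 + \<sigma> * (b r)\<^sup>2) = (L2_nrm unit_interval a)\<^sup>2 + \<sigma> * (L2_nrm unit_interval b)\<^sup>2"
    if "continuous_on {0..1} a" "continuous_on {0..1} b" for a b :: "real \<Rightarrow> real"
    unfolding L2_nrm_unit_interval[OF that(1)] L2_nrm_unit_interval[OF that(2)] integral_mult_right[symmetric]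
    by (rule Henstock_Kurzweil_Integration.integral_add) (intro integrable_continuous_interval continuous_intros that)+
  have LINT_sum: "set_integrable lebesgue unit_interval (\<lambda>r. (a r)\<^sup>2 + \<sigma> * (b r)\<^sup>2)"
    "(LINT r:unit_interval|lebesgue. (a r)\<^sup>2 + \<sigma> * (b r)\<^sup>2) = (L2_nrm unit_interval a)\<^sup>2 + \<sigma> * (L2_nrm unit_interval b)\<^sup>2"
    if "in_L2 unit_interval a" "in_L2 unit_interval b" for a b :: "real \<Rightarrow> real"
    using that unfolding in_L2_def L2_nrm_power2 by auto
  have limE: "(\<lambda>n. energy_at (s n)) \<longlonglongrightarrow> E0"
  proof -
    have "energy_at (s n) = 1/2 * ((L2_nrm unit_interval (Q1 n))\<^sup>2 + \<sigma> * (L2_nrm unit_interval (Q3 n))\<^sup>2)" for n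
      unfolding energy_at_def int_sum[OF q(1,3), symmetric]
      using hp by (intro arg_cong[where f="\<lambda>x. 1/2 * x"] Henstock_Kurzweil_Integration.integral_cong)
        (auto simp: Q1_def Q3_def power_mult_distrib algebra_simps less_imp_le)
    moreover have "E0 = 1/2 * ((L2_nrm unit_interval R1)\<^sup>2 + \<sigma> * (L2_nrm unit_interval R3)\<^sup>2)"
    proof -
      have "AE r in lebesgue. r \<in> unit_interval \<longrightarrow> (R1 r)\<^sup>2 + \<sigma> * (R3 r)\<^sup>2 = (h0 r * (v0 r)\<^sup>2 + \<sigma> * (g0 r)\<^sup>2) * r"
        using Kh0
      proof eventually_elim
        case (elim r)
        show ?case
        proof
          assume r: "r \<in> unit_interval"
          then have "K r > 0" using hp(2)[of r] by simp
          then show "(R1 r)\<^sup>2 + \<sigma> * (R3 r)\<^sup>2 = (h0 r * (v0 r)\<^sup>2 + \<sigma> * (g0 r)\<^sup>2) * r"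
            using elim r by (auto simp: R1_def R3_def power_mult_distrib algebra_simps)
        qed
      qed
      from set_integral_cong_AE_lebesgue[OF LINT_sum(1)[OF iR(1,3)] this]
      show ?thesis unfolding E0_def energy_def g0_def[symmetric] LINT_sum(2)[OF iR(1,3)] by simp
    qed
    ultimately show ?thesis by (simp only:) (intro tendsto_intros L2_lim_nrm[OF L1] L2_lim_nrm[OF L3])
  qed
  have limS: "(\<lambda>n. entropy_at (s n)) \<longlonglongrightarrow> entropy \<sigma> \<mu> v0 h0"
  proof -
    have qq: "continuous_on {0..1} (\<lambda>r. Q1 n r + Q2 n r)" for n by (intro continuous_intros q)
    note L12 = L2_lim_add[OF L1 L2]
    have "entropy_at (s n) = 1/2 * ((L2_nrm unit_interval (\<lambda>r. Q1 n r + Q2 n r))\<^sup>2 + \<sigma> * (L2_nrm unit_interval (Q3 n))\<^sup>2)" for n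
      unfolding entropy_at_def int_sum[OF qq q(3), symmetric]
    proof (intro arg_cong[where f="\<lambda>x. 1/2 * x"] Henstock_Kurzweil_Integration.integral_cong)
      fix r :: real assume r: "r \<in> {0..1}"
      then have r0: "r \<ge> 0" by simp
      show "(h r (s n) * (w r (s n))\<^sup>2 + \<sigma> * (h1 r (s n))\<^sup>2) * r = (Q1 n r + Q2 n r)\<^sup>2 + \<sigma> * (Q3 n r)\<^sup>2"
        unfolding Q1_def Q2_def Q3_def real_scaleR_def completed_square[OF hp(1)[OF r] pos(2) r0] w_def f_def
        using r by (simp add: power_mult_distrib algebra_simps)
    qed
    moreover have "entropy \<sigma> \<mu> v0 h0 = 1/2 * ((L2_nrm unit_interval (\<lambda>r. R1 r + R2 r))\<^sup>2 + \<sigma> * (L2_nrm unit_interval R3)\<^sup>2)"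
    proof -
      have iR12: "in_L2 unit_interval (\<lambda>r. R1 r + R2 r)" using L12 by (simp add: L2_lim_def)
      have "AE r in lebesgue. r \<in> unit_interval \<longrightarrow> (R1 r + R2 r)\<^sup>2 + \<sigma> * (R3 r)\<^sup>2 =
          (h0 r * (v0 r + 4 * \<mu> * (g0 r / h0 r))\<^sup>2 + \<sigma> * (g0 r)\<^sup>2) * r"
        using Kh0
      proof eventually_elim
        case (elim r)
        show ?case
        proof
          assume r: "r \<in> unit_interval"
          then have Kr: "K r > 0" "r \<ge> 0" using hp(2)[of r] by auto
          have "K r = h0 r" using elim r by simp
          then show "(R1 r + R2 r)\<^sup>2 + \<sigma> * (R3 r)\<^sup>2 = (h0 r * (v0 r + 4 * \<mu> * (g0 r / h0 r))\<^sup>2 + \<sigma> * (g0 r)\<^sup>2) * r"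
            unfolding R1_def R2_def R3_def real_scaleR_def completed_square[OF Kr(1) pos(2) Kr(2)]
            using Kr by (simp add: power_mult_distrib algebra_simps)
        qed
      qed
      from set_integral_cong_AE_lebesgue[OF LINT_sum(1)[OF iR12 iR(3)] this]
      show ?thesis unfolding entropy_def g0_def[symmetric] LINT_sum(2)[OF iR12 iR(3)] by simp
    qed
    ultimately show ?thesis by (simp only:) (intro tendsto_intros L2_lim_nrm[OF L12] L2_lim_nrm[OF L3])
  qed
  have ev: "\<forall>\<^sub>F n in sequentially. s n \<le> t" if "t > 0" for t
    using order_tendstoD(2)[OF s(2) that] by (rule eventually_mono) simp
  have Ele: "energy_at t \<le> E0" if t: "t > 0" for t
  proof (rule tendsto_lowerbound[OF limE])
    show "\<forall>\<^sub>F n in sequentially. energy_at t \<le> energy_at (s n)"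
      using ev[OF t] by (rule eventually_mono) (rule energy_antimono[OF s(1)])
  qed simp
  have Ele': "energy_at t \<le> \<bar>E0\<bar>" if "t > 0" for t using Ele[OF that] by simp
  let ?K = "energy_weight \<sigma> \<mu> m \<bar>E0\<bar>"
  have Fle: "energy_at t \<le> F0 * exp (- b * t)" if t: "t > 0" for t
  proof -
    have lim: "(\<lambda>n. (entropy_at (s n) + ?K * energy_at (s n)) * exp (- b * (t - s n))) \<longlonglongrightarrow> F0 * exp (- b * (t - 0))"
      unfolding F0_def by (intro tendsto_intros limS limE s(2))
    have "entropy_at t + ?K * energy_at t \<le> F0 * exp (- b * (t - 0))"
    proof (rule tendsto_lowerbound[OF lim])
      show "\<forall>\<^sub>F n in sequentially. entropy_at t + ?K * energy_at t \<le> (entropy_at (s n) + ?K * energy_at (s n)) * exp (- b * (t - s n))"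
        using ev[OF t] unfolding b_def by (rule eventually_mono) (rule decay[OF Ele' abs_ge_zero s(1)])
    qed simp
    moreover have "1 * energy_at t \<le> ?K * energy_at t"
      using const_pos(2)[OF pos abs_ge_zero, of E0] energy_nonneg[OF t] by (intro mult_right_mono)
    ultimately show ?thesis using entropy_nonneg[OF t] by simp
  qed
  have mean: "disc_mean h0 = 2 * integral {0..1} (\<lambda>r. h r t * r)" if t: "t > 0" for t
  proof -
    have cr: "continuous_on {0..1} (\<lambda>r. r * h r u)" if "u > 0" for u by (intro continuous_intros hc that)
    have "(\<lambda>n. LINT r:unit_interval|lebesgue. r *\<^sub>R h r (s n)) \<longlonglongrightarrow> (LINT r:unit_interval|lebesgue. r *\<^sub>R h0 r)"
      by (rule L2_lim_integral[OF Lh unit_interval_continuous(1)[OF c3]])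
    moreover have "(LINT r:unit_interval|lebesgue. r *\<^sub>R h r (s n)) = integral {0..1} (\<lambda>r. h r t * r)" for n
    proof -
      have "integral {0..1} (\<lambda>r. h r (s n) * r) = integral {0..1} (\<lambda>r. h r t * r)"
        using mass_conserved[of t "s n"] mass_conserved[of "s n" t] t s(1)[of n] by (cases "s n \<le> t") auto
      then show ?thesis using unit_interval_continuous(4)[OF cr[OF s(1)], of n] by (simp add: mult.commute)
    qed
    ultimately have "(LINT r:unit_interval|lebesgue. r *\<^sub>R h0 r) = integral {0..1} (\<lambda>r. h r t * r)"
      by (simp add: LIMSEQ_const_iff)
    then show ?thesis by (simp add: disc_mean_def mult.commute)
  qed
  define M where "M = disc_mean h0"
  have Lu: "in_L2 unit_interval (\<lambda>r. h r t - M)" and cu: "continuous_on {0..1} (\<lambda>r. h r t - M)" if "t > 0" for t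
    using hc(1)[OF that] by (auto intro!: unit_interval_continuous(1) continuous_intros)
  have wd: "is_weak_gradient unit_disc (radial (\<lambda>r. h r t - M)) (radial_field (\<lambda>r. h1 r t))" if t: "t > 0" for t
    by (rule radial_weak_gradient)
      (auto intro!: derivative_eq_intros rderivD[OF rd(1) _ t] simp: hc(2)[OF t] bc(1)[OF t])
  have posH: "(L2_nrm unit_disc (radial (\<lambda>r. h r t - M)))\<^sup>2 + (L2_nrm unit_disc (radial (\<lambda>r. h1 r t)))\<^sup>2 \<le> 8 * pi / \<sigma> * (F0 * exp (- b * t))"
    if t: "t > 0" for t
  proof -
    have "integral {0..1} (\<lambda>r. (h r t - M)\<^sup>2 * r) \<le> integral {0..1} (\<lambda>r. (h1 r t)\<^sup>2 * r)"
      unfolding M_def mean[OF t] by (rule poincare_unit_disc[OF rderivD[OF rd(1) _ t] hc(2)[OF t]])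
    then have "integral {0..1} (\<lambda>r. r * (h r t - M)\<^sup>2) \<le> integral {0..1} (\<lambda>r. r * (h1 r t)\<^sup>2)" by (simp add: mult.commute)
    then have "2 * pi * integral {0..1} (\<lambda>r. r * (h r t - M)\<^sup>2) \<le> 2 * pi * integral {0..1} (\<lambda>r. r * (h1 r t)\<^sup>2)"
      by (intro mult_left_mono) auto
    moreover have "4 * pi * integral {0..1} (\<lambda>r. r * (h1 r t)\<^sup>2) \<le> 4 * pi * (2 * (F0 * exp (- b * t)) / \<sigma>)"
    proof (intro mult_left_mono order_trans[OF h1_le_energy[OF t]])
      show "2 * energy_at t / \<sigma> \<le> 2 * (F0 * exp (- b * t)) / \<sigma>" using Fle[OF t] pos by (intro divide_right_mono) auto
    qed simp
    ultimately have "2 * pi * integral {0..1} (\<lambda>r. r * (h r t - M)\<^sup>2) + 2 * pi * integral {0..1} (\<lambda>r. r * (h1 r t)\<^sup>2)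
        \<le> 4 * pi * (2 * (F0 * exp (- b * t)) / \<sigma>)" by linarith
    also have "\<dots> = 8 * pi / \<sigma> * (F0 * exp (- b * t))" by simp
    finally show ?thesis
      unfolding L2_nrm_radial_continuous[OF cu[OF t]] L2_nrm_radial_continuous[OF hc(2)[OF t]] .
  qed
  have posv: "(L2_nrm unit_disc (radial (\<lambda>r. v r t)))\<^sup>2 \<le> 4 * pi / m * (F0 * exp (- b * t))" if t: "t > 0" for t
  proof -
    have "2 * pi * integral {0..1} (\<lambda>r. r * (v r t)\<^sup>2) \<le> 2 * pi * (2 * (F0 * exp (- b * t)) / m)"
    proof (intro mult_left_mono order_trans[OF v_le_energy[OF t]])
      show "2 * energy_at t / m \<le> 2 * (F0 * exp (- b * t)) / m" using Fle[OF t] pos by (intro divide_right_mono) auto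
    qed simp
    then show ?thesis unfolding L2_nrm_radial_continuous[OF hc(3)[OF t]] by simp
  qed
  have lim_exp: "(\<lambda>n. C * (F0 * exp (- b * s n))) \<longlonglongrightarrow> C * (F0 * exp (- b * 0))" for C
    by (intro tendsto_intros s(2))
  have init: "h r 0 = h0 r" "v r 0 = v0 r" if "r \<in> unit_interval" for r
    using sol that unfolding positive_classical_solution_def by auto
  have Lv0: "L2_lim unit_interval (\<lambda>n r. v r (s n)) (\<lambda>r. v r 0)" by (rule L2_lim_cong[OF Lv]) (simp add: init)
  have Lu0: "L2_lim unit_interval (\<lambda>n r. h r (s n) - M) (\<lambda>r. h r 0 - M)"
  proof -
    have "L2_lim unit_interval (\<lambda>n r. h r (s n)) (\<lambda>r. h r 0)" by (rule L2_lim_cong[OF Lh]) (simp add: init)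
    then show ?thesis
      unfolding L2_lim_def using unit_interval_continuous(1)[of "\<lambda>_. M"] by (auto intro!: in_L2_diff)
  qed
  have zero: "in_H1 unit_disc (radial (\<lambda>r. h r 0 - M)) \<and> (H1_nrm unit_disc (radial (\<lambda>r. h r 0 - M)))\<^sup>2 \<le> 8 * pi / \<sigma> * (F0 * exp (- b * 0))"
  proof -
    have w0: "is_weak_gradient unit_disc (radial (\<lambda>r. h r 0 - M)) (radial_field g0)"
      by (rule is_weak_gradient_limit[OF _ L2_lim_radial(1)[OF Lu0] L2_lim_radial(2)[OF Lh1] wd[OF s(1)]]) simp
    have i0: "in_L2 unit_interval (\<lambda>r. h r 0 - M)" using Lu0 by (simp add: L2_lim_def)
    have "(\<lambda>n. (L2_nrm unit_disc (radial (\<lambda>r. h r (s n) - M)))\<^sup>2 + (L2_nrm unit_disc (radial (\<lambda>r. h1 r (s n))))\<^sup>2)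
       \<longlonglongrightarrow> (L2_nrm unit_disc (radial (\<lambda>r. h r 0 - M)))\<^sup>2 + (L2_nrm unit_disc (radial g0))\<^sup>2"
      by (intro tendsto_intros L2_lim_nrm L2_lim_radial(1) Lu0 Lh1)
    then have "(L2_nrm unit_disc (radial (\<lambda>r. h r 0 - M)))\<^sup>2 + (L2_nrm unit_disc (radial g0))\<^sup>2 \<le> 8 * pi / \<sigma> * (F0 * exp (- b * 0))"
      by (rule LIMSEQ_le[OF _ lim_exp]) (use posH[OF s(1)] in auto)
    then show ?thesis using H1_unit_disc_radial[OF i0 g0(1) w0] by simp
  qed
  have zerov: "(L2_nrm unit_disc (radial (\<lambda>r. v r 0)))\<^sup>2 \<le> 4 * pi / m * (F0 * exp (- b * 0))"
  proof (rule LIMSEQ_le[OF _ lim_exp])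
    show "(\<lambda>n. (L2_nrm unit_disc (radial (\<lambda>r. v r (s n))))\<^sup>2) \<longlonglongrightarrow> (L2_nrm unit_disc (radial (\<lambda>r. v r 0)))\<^sup>2"
      by (intro tendsto_intros L2_lim_nrm L2_lim_radial(1) Lv0)
  qed (use posv[OF s(1)] in auto)
  have "in_H1 unit_disc (radial (\<lambda>r. h r t - M)) \<and> (H1_nrm unit_disc (radial (\<lambda>r. h r t - M)))\<^sup>2 \<le> 8 * pi / \<sigma> * (F0 * exp (- b * t))"
  proof (cases "t = 0")
    case False
    then have t: "t > 0" using t0 by simp
    show ?thesis using H1_unit_disc_radial[OF Lu[OF t] L(2)[OF t] wd[OF t]] posH[OF t] by simp
  qed (use zero in simp)
  then show "in_H1 unit_disc (radial (\<lambda>r. h r t - disc_mean h0))"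
    "(H1_nrm unit_disc (radial (\<lambda>r. h r t - disc_mean h0)))\<^sup>2 \<le> 8 * pi / \<sigma> * (F0 * exp (- b * t))"
    unfolding M_def by auto
  have Lvt: "in_L2 unit_interval (\<lambda>r. v r t)"
  proof (cases "t = 0")
    case True then show ?thesis using Lv0 by (simp add: L2_lim_def)
  next
    case False then show ?thesis using L(3)[of t] t0 by simp
  qed
  show "in_L2 unit_disc (radial (\<lambda>r. v r t))" by (rule in_L2_radial(1)[OF Lvt])
  show "(L2_nrm unit_disc (radial (\<lambda>r. v r t)))\<^sup>2 \<le> 4 * pi / m * (F0 * exp (- b * t))"
    using posv[of t] zerov t0 by (cases "t = 0") auto
qed

lemma exp_bound_of_square:
  fixes x C c b t :: real
  assumes "x\<^sup>2 \<le> c * (F * exp (- b * t))" "F \<le> G" "c \<ge> 0" "x \<ge> 0"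
  shows "x \<le> (sqrt (c * \<bar>G\<bar>) + 1) * exp (- (b / 2) * t)"
proof (rule power2_le_imp_le)
  have e: "exp (- b * t) = (exp (- (b / 2) * t))\<^sup>2" by (simp add: power2_eq_square exp_add[symmetric])
  have "x\<^sup>2 \<le> c * \<bar>G\<bar> * exp (- b * t)"
  proof (rule order_trans[OF assms(1)])
    have "F * exp (- b * t) \<le> \<bar>G\<bar> * exp (- b * t)" using assms(2) by (intro mult_right_mono) auto
    then show "c * (F * exp (- b * t)) \<le> c * \<bar>G\<bar> * exp (- b * t)" using assms(3) by (simp add: mult.assoc mult_left_mono)
  qed
  also have "\<dots> \<le> (sqrt (c * \<bar>G\<bar>) + 1)\<^sup>2 * exp (- b * t)"
    using assms(3) by (intro mult_right_mono) (auto simp: power2_sum)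
  also have "\<dots> = ((sqrt (c * \<bar>G\<bar>) + 1) * exp (- (b / 2) * t))\<^sup>2" unfolding e by (simp add: power_mult_distrib)
  finally show "x\<^sup>2 \<le> ((sqrt (c * \<bar>G\<bar>) + 1) * exp (- (b / 2) * t))\<^sup>2" .
  show "0 \<le> (sqrt (c * \<bar>G\<bar>) + 1) * exp (- (b / 2) * t)" using assms(3) by (intro mult_nonneg_nonneg add_nonneg_nonneg) auto
qed

theorem theoremA2:
  fixes \<sigma> \<mu> m E0 S0 :: real
  assumes "\<sigma> > 0" and "\<mu> > 0" and "m > 0"
  shows "\<exists>A1 B1 A2 B2 :: real. A1 > 0 \<and> B1 > 0 \<and> A2 > 0 \<and> B2 > 0 \<and>
    (\<forall>(h0 :: real \<Rightarrow> real) (v0 :: real \<Rightarrow> real)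
       (h :: real \<Rightarrow> real \<Rightarrow> real) (v :: real \<Rightarrow> real \<Rightarrow> real).
       in_H1 unit_interval h0 \<longrightarrow> in_L2 unit_interval v0 \<longrightarrow>
       positive_classical_solution \<sigma> \<mu> h0 v0 h v \<longrightarrow>
       (\<forall>r\<in>unit_interval. \<forall>t>0. h r t \<ge> m) \<longrightarrow>
       energy \<sigma> v0 h0 = E0 \<longrightarrow> entropy \<sigma> \<mu> v0 h0 = S0 \<longrightarrow>
       (\<forall>t\<ge>0.
          in_H1 unit_disc (radial (\<lambda>r. h r t - disc_mean h0)) \<and>
          H1_nrm unit_disc (radial (\<lambda>r. h r t - disc_mean h0)) \<le> A1 * exp (- B1 * t) \<and>
          in_L2 unit_disc (radial (\<lambda>r. v r t)) \<and>
          L2_nrm unit_disc (radial (\<lambda>r. v r t)) \<le> A2 * exp (- B2 * t)))"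
proof -
  define F where "F = S0 + energy_weight \<sigma> \<mu> m \<bar>E0\<bar> * E0"
  define b where "b = decay_rate \<sigma> \<mu> m \<bar>E0\<bar>"
  \<comment> \<open>The summand \<open>1\<close> keeps the constants positive when \<open>F = 0\<close>.\<close>
  define A1 where "A1 = sqrt (8 * pi / \<sigma> * \<bar>F\<bar>) + 1"
  define A2 where "A2 = sqrt (4 * pi / m * \<bar>F\<bar>) + 1"
  have b: "b / 2 > 0" unfolding b_def using const_pos(4)[OF assms abs_ge_zero, of E0] by simp
  have A: "A1 > 0" "A2 > 0" unfolding A1_def A2_def using assms by (auto intro!: add_nonneg_pos)
  show ?thesis
  proof (rule exI[of _ A1], rule exI[of _ "b/2"], rule exI[of _ A2], rule exI[of _ "b/2"], intro conjI A b allI impI)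
    fix h0 v0 :: "real \<Rightarrow> real" and h v :: "real \<Rightarrow> real \<Rightarrow> real" and t :: real
    assume a: "in_H1 unit_interval h0" "in_L2 unit_interval v0" "positive_classical_solution \<sigma> \<mu> h0 v0 h v"
      "\<forall>r\<in>unit_interval. \<forall>t>0. h r t \<ge> m" and ES: "energy \<sigma> v0 h0 = E0" "entropy \<sigma> \<mu> v0 h0 = S0" and t: "0 \<le> t"
    note dec = solution_decay[OF assms a t, unfolded ES, folded F_def b_def]
    show "in_H1 unit_disc (radial (\<lambda>r. h r t - disc_mean h0))" "in_L2 unit_disc (radial (\<lambda>r. v r t))"
      by (fact dec(1), fact dec(3))
    show "H1_nrm unit_disc (radial (\<lambda>r. h r t - disc_mean h0)) \<le> A1 * exp (- (b / 2) * t)"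
      unfolding A1_def
    proof (rule exp_bound_of_square[OF dec(2) order_refl])
      show "0 \<le> H1_nrm unit_disc (radial (\<lambda>r. h r t - disc_mean h0))" by (simp add: H1_nrm_def)
    qed (use assms in simp)
    show "L2_nrm unit_disc (radial (\<lambda>r. v r t)) \<le> A2 * exp (- (b / 2) * t)"
      unfolding A2_def by (rule exp_bound_of_square[OF dec(4) order_refl _ L2_nrm_nonneg]) (use assms in simp)
  qed
qed

end
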